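(* Let $(\Phi,0,S,T)$ be the modular data of an RCFT, and let $N$ be the order of $T$ (so $T^N=I$). If $N$ is odd, then the RCFT has the $\Gamma(N)$ congruence property.
   Context: Modular data of an RCFT: a finite set $\Phi$ (primary fields) with a distinguished element $0\in\Phi$, and complex matrices $S,T$ indexed by $\Phi$ such that: $S$ and $T$ are unitary and symmetric; $T$ is diagonal and of finite order; $(ST)^3=I$; $C:=S^2$ (charge conjugation) is a permutation matrix with $C^2=I$, corresponding to a permutation $a\mapsto Ca$ of $\Phi$ with $C0=0$, and $C$ commutes with $S$ and $T$; $S_{0a}\neq 0$ for all $a$; and the fusion coefficients $N_{ab}^c=\sum_{d\in\Phi}S_{ad}S_{bd}\overline{S_{cd}}/S_{0d}$ (Verlinde's formula) are nonnegative integers. These relations define a representation $\rho$ of $\mathrm{SL}_2(\mathbb Z)$ with $\rho\begin{pmatrix}0&1\\-1&0\end{pmatrix}=S$ and $\rho\begin{pmatrix}1&1\\0&1\end{pmatrix}=T$. Galois action: it is known that the entries of $S$ lie in a cyclotomic field $\mathbb Q[\xi_n]$, $\xi_n=\exp[2\pi i/n]$, and that for each Galois automorphism $\sigma$ there are signs $\epsilon_\sigma(a)\in\{\pm1\}$ and a permutation $a\mapsto\sigma a$ of $\Phi$ with $\sigma(S_{ab})=\epsilon_\sigma(a)S_{\sigma a,b}=\epsilon_\sigma(b)S_{a,\sigma b}$ for all $a,b\in\Phi$. Bantay's integrality: for any RCFT it is known (Bantay, from standard properties of the RCFT braiding matrices) that for all $a,b\in\Phi$ the number $$\mathcal Z(a,b):=T_{00}^{1/2}\,\overline{T_{bb}}^{\,1/2}\sum_{x,y\in\Phi}N_{xy}^a\,S_{bx}\,S_{0y}\,T_{yy}^{2}\,T_{xx}^{-2}$$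 is an integer (the choice of square roots affects only its sign), with $\mathcal Z(a,b)\equiv N_{aa}^b \pmod 2$ and $|\mathcal Z(a,b)|\le N_{aa}^b$. This is part of what is meant by RCFT modular data here. Congruence property: let $\Gamma(N)=\{A\in \mathrm{SL}_2(\mathbb Z): A\equiv I \pmod N\}$. The RCFT has the $\Gamma(N)$ congruence property if $\rho(A)=I$ for all $A\in\Gamma(N)$. *)

theory Defs
  imports "HOL-Analysis.Analysis" "HOL-Number_Theory.Cong"
begin

text \<open>
  Matrices indexed by a finite set \<open>\<Phi>\<close> are rendered as \<open>complex^'a^'a\<close>, where the finite index type
  \<open>'a\<close> plays the role of \<open>\<Phi>\<close>. Note that \<open>*\<close> and \<open>^\<close> on this type act componentwise; the
  matrix product is \<open>**\<close>, and matrix powers are introduced here.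
\<close>

definition matrix_pow :: "'r::semiring_1^'a::finite^'a \<Rightarrow> nat \<Rightarrow> 'r^'a^'a" where
  "matrix_pow A k = ((\<lambda>B. A ** B) ^^ k) (mat 1)"

definition matrix_order :: "'r::semiring_1^'a::finite^'a \<Rightarrow> nat" where
  "matrix_order A = (LEAST k. 0 < k \<and> matrix_pow A k = mat 1)"

definition conj_transpose :: "complex^'a::finite^'a \<Rightarrow> complex^'a^'a" where
  "conj_transpose A = transpose (map_matrix cnj A)"

definition unitary_matrix :: "complex^'a::finite^'a \<Rightarrow> bool" where
  "unitary_matrix A \<longleftrightarrow>
     A ** conj_transpose A = mat 1 \<and> conj_transpose A ** A = mat 1"

definition fusion ::
    "'a::finite \<Rightarrow> complex^'a^'a \<Rightarrow> 'a \<Rightarrow> 'a \<Rightarrow> 'a \<Rightarrow> complex" where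
  "fusion z S a b c = (\<Sum>d\<in>UNIV. S$a$d * S$b$d * cnj (S$c$d) / S$z$d)"

text \<open>
  The square roots below are the principal ones; any other choice changes the value only by a sign,
  which is irrelevant to integrality, parity and absolute value.
\<close>

definition bantay_Z ::
    "'a::finite \<Rightarrow> complex^'a^'a \<Rightarrow> complex^'a^'a \<Rightarrow> 'a \<Rightarrow> 'a \<Rightarrow> complex" where
  "bantay_Z z S T a b =
     csqrt (T$z$z) * csqrt (cnj (T$b$b)) *
     (\<Sum>x\<in>UNIV. \<Sum>y\<in>UNIV.
        fusion z S x y a * S$b$x * S$z$y * (T$y$y)^2 * (T$x$x) powi (- 2))"

locale rcft_modular_data =
  fixes z :: "'a::finite"
    and S T :: "complex^'a^'a"
  assumes S_unitary: "unitary_matrix S"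
    and T_unitary: "unitary_matrix T"
    and S_symmetric: "transpose S = S"
    and T_symmetric: "transpose T = T"
    and T_diagonal: "\<And>a b. a \<noteq> b \<Longrightarrow> T$a$b = 0"
    and T_finite_order: "\<exists>k>0. matrix_pow T k = mat 1"
    and ST_cubed: "matrix_pow (S ** T) 3 = mat 1"
    and charge_conjugation:
      "\<exists>C. bij C \<and> C z = z \<and> S ** S = (\<chi> a b. if b = C a then 1 else 0)"
    and charge_conjugation_involution: "matrix_pow (S ** S) 2 = mat 1"
    and charge_conjugation_commutes_S: "(S ** S) ** S = S ** (S ** S)"
    and charge_conjugation_commutes_T: "(S ** S) ** T = T ** (S ** S)"
    and S_vacuum_nonzero: "\<And>a. S$z$a \<noteq> 0"
    and verlinde: "\<And>a b c. fusion z S a b c \<in> \<nat>"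
    and bantay: "\<And>a b. \<exists>(k::int) (m::nat).
        bantay_Z z S T a b = of_int k \<and> fusion z S a a b = of_nat m \<and>
        [k = int m] (mod 2) \<and> \<bar>k\<bar> \<le> int m"

definition SL2Z :: "(int^2^2) set" where
  "SL2Z = {A. det A = 1}"

definition principal_congruence_subgroup :: "nat \<Rightarrow> (int^2^2) set" where
  "principal_congruence_subgroup N =
     {A \<in> SL2Z. \<forall>i j. [A$i$j = (mat 1 :: int^2^2)$i$j] (mod int N)}"

text \<open>
  The generators are the matrices with rows \<open>(0, 1)\<close>, \<open>(-1, 0)\<close> and \<open>(1, 1)\<close>, \<open>(0, 1)\<close>. Since they
  generate \<open>SL2Z\<close>, the values of \<open>\<rho>\<close> on \<open>SL2Z\<close> are determined by \<open>S\<close> and \<open>T\<close>; values outside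
  \<open>SL2Z\<close> are unconstrained.
\<close>

definition modular_representation ::
    "complex^'a::finite^'a \<Rightarrow> complex^'a^'a \<Rightarrow> (int^2^2 \<Rightarrow> complex^'a^'a) \<Rightarrow> bool" where
  "modular_representation S T \<rho> \<longleftrightarrow>
     \<rho> (mat 1) = mat 1 \<and>
     (\<forall>A\<in>SL2Z. \<forall>B\<in>SL2Z. \<rho> (A ** B) = \<rho> A ** \<rho> B) \<and>
     \<rho> (vector [vector [0, 1], vector [- 1, 0]]) = S \<and>
     \<rho> (vector [vector [1, 1], vector [0, 1]]) = T"

definition congruence_property ::
    "(int^2^2 \<Rightarrow> complex^'a::finite^'a) \<Rightarrow> nat \<Rightarrow> bool" where
  "congruence_property \<rho> N \<longleftrightarrow> (\<forall>A\<in>principal_congruence_subgroup N. \<rho> A = mat 1)"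

end

theory Submission
  imports Defs "HOL-Computational_Algebra.Fundamental_Theorem_Algebra"
begin

text \<open>The identity for \<open>T\<close> is decisive because it lets \<open>Gm x\<close>
  conjugate powers of \<open>T\<close> exactly as the diagonal matrix with entries
  \<open>1/x\<close>, \<open>x\<close> conjugates upper unipotent matrices. Together with
  \<open>S\<close> and the fractional powers of \<open>T\<close>, these matrices then obey the
  multiplication rules of SL2 over the integers modulo \<open>N\<close>. Oddness enters in two ways.
  Row \<open>z\<close> of \<open>S\<close> is real and nowhere zero, while the entries of
  \<open>T\<close> are roots of unity of odd order, so a phase that is forced to be real equals 1;
  this is how \<open>k\<close> pins down \<open>G\<close>. And 2 is a unit, which allows halving and
  makes the split 1 = 1/2 + 1/2 available. The recurring obstacle is to make several linear
  expressions in an auxiliary integer units at the same time. Large primes leave enough room. Modulo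
  3 the only units are 1 and -1, so that x + y = 1 forces x = y = -1; the constants are therefore
  controlled through classes modulo 9, and signs are used to normalize classes modulo 3. Modulo 5
  one class needs a detour.\<close>

text \<open>
  Let \<open>\<sigma>\<close> be an embedding of a field containing the entries of \<open>S\<close> and \<open>T\<close> that raises \<open>N\<close>-th roots
  of unity to the power \<open>k\<close>. By Verlinde's formula it permutes the columns of \<open>S\<close> up to signs,
  \<open>\<sigma>(S) = S G\<close>, and applying it to \<open>S T S = T\<^sup>-\<^sup>1 S\<^sup>-\<^sup>1 T\<^sup>-\<^sup>1\<close> expresses \<open>S T\<^sup>k S\<close> through \<open>G\<close> and the conjugate
  \<open>G T G\<^sup>-\<^sup>1\<close>. The theorem amounts to \<open>T = G T\<^sup>m G\<^sup>-\<^sup>1\<close> with \<open>m = k\<^sup>2\<close>. Write \<open>T\<close> as \<open>\<zeta>\<^sup>t\<close> with \<open>t : \<Phi> \<rightarrow> \<int>/N\<close> and let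
  \<open>F\<^sub>k = t \<circ> \<pi>\<^sub>k - k\<^sup>2 t\<close> be the deviation from this. Comparing \<open>S T S\<close> with \<open>S T\<^sup>x S\<close> and \<open>S T\<^sup>y S\<close> for
  units \<open>x + y = 1\<close> shows that \<open>F\<^sub>x - F\<^sub>y\<close> is constant. With \<open>F\<^sub>-\<^sub>x = F\<^sub>x\<close> and the cocycle rule this gives
  \<open>y\<^sup>2 F\<^sub>x = x\<^sup>2 F\<^sub>y\<close> up to constants whenever \<open>x\<close>, \<open>y\<close>, \<open>x + y\<close> are units, and as \<open>N\<close> is odd, every unit
  is linked to \<open>1\<close> in this way. The remaining constants are a homomorphism into the \<open>3\<close>-torsion,
  killed by the same relations. Then the big cell formula defines \<open>\<rho>\<close> on \<open>SL\<^sub>2(\<int>)\<close> in terms of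
  entries modulo \<open>N\<close> only.
\<close>

section \<open>Extending embeddings of subfields of the complex numbers\<close>

definition complex_subfield :: "complex set \<Rightarrow> bool" where
  "complex_subfield K \<longleftrightarrow> 1 \<in> K \<and> (\<forall>x\<in>K. \<forall>y\<in>K. x + y \<in> K \<and> x * y \<in> K) \<and>
     (\<forall>x\<in>K. - x \<in> K \<and> inverse x \<in> K)"

text \<open>The embedding is a total function of which only the values on \<open>K\<close> are
  constrained. Extending it means agreeing on the smaller set, and no Galois closure has to be
  formed.\<close>

definition field_embedding :: "complex set \<Rightarrow> (complex \<Rightarrow> complex) \<Rightarrow> bool" where
  "field_embedding K \<sigma> \<longleftrightarrow> complex_subfield K \<and> \<sigma> 1 = 1 \<and>
     (\<forall>x\<in>K. \<forall>y\<in>K. \<sigma> (x + y) = \<sigma> x + \<sigma> y \<and> \<sigma> (x * y) = \<sigma> x * \<sigma> y)"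

definition polys_over :: "complex set \<Rightarrow> complex poly set" where
  "polys_over K = {p. \<forall>i. coeff p i \<in> K}"

definition algebraic_over :: "complex set \<Rightarrow> complex \<Rightarrow> bool" where
  "algebraic_over K x \<longleftrightarrow> (\<exists>p\<in>polys_over K. p \<noteq> 0 \<and> poly p x = 0)"

lemma complex_subfieldD:
  assumes "complex_subfield K"
  shows "0 \<in> K" "1 \<in> K" "x \<in> K \<Longrightarrow> y \<in> K \<Longrightarrow> x + y \<in> K" "x \<in> K \<Longrightarrow> y \<in> K \<Longrightarrow> x * y \<in> K"
    "x \<in> K \<Longrightarrow> - x \<in> K" "x \<in> K \<Longrightarrow> inverse x \<in> K"
    "x \<in> K \<Longrightarrow> y \<in> K \<Longrightarrow> x - y \<in> K" "x \<in> K \<Longrightarrow> y \<in> K \<Longrightarrow> x / y \<in> K"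
proof -
  show one: "1 \<in> K" and add: "\<And>x y. x \<in> K \<Longrightarrow> y \<in> K \<Longrightarrow> x + y \<in> K"
    and mult: "\<And>x y. x \<in> K \<Longrightarrow> y \<in> K \<Longrightarrow> x * y \<in> K" and neg: "\<And>x. x \<in> K \<Longrightarrow> - x \<in> K"
    and inv: "\<And>x. x \<in> K \<Longrightarrow> inverse x \<in> K"
    using assms unfolding complex_subfield_def by auto
  show "0 \<in> K" using add[OF one neg[OF one]] by simp
  show "x \<in> K \<Longrightarrow> y \<in> K \<Longrightarrow> x - y \<in> K" using add[of x "- y"] neg by simp
  show "x \<in> K \<Longrightarrow> y \<in> K \<Longrightarrow> x / y \<in> K" using mult[of x "inverse y"] inv by (simp add: divide_inverse)
qed

lemma complex_subfield_sum: "complex_subfield K \<Longrightarrow> (\<And>i. i \<in> A \<Longrightarrow> f i \<in> K) \<Longrightarrow> sum f A \<in> K"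
  by (induction A rule: infinite_finite_induct) (auto intro: complex_subfieldD)

lemma complex_subfield_of_int: "complex_subfield K \<Longrightarrow> of_int k \<in> K"
proof (induction k rule: int_induct[where k = 0])
  case base then show ?case by (simp add: complex_subfieldD)
next
  case (step1 i) then show ?case by (simp add: complex_subfieldD)
next
  case (step2 i) then show ?case by (simp add: complex_subfieldD)
qed

lemma polys_overD: "p \<in> polys_over K \<Longrightarrow> coeff p i \<in> K"
  by (simp add: polys_over_def)

lemma polys_over_closed:
  assumes K: "complex_subfield K"
  shows "0 \<in> polys_over K" "1 \<in> polys_over K" "c \<in> K \<Longrightarrow> [:c:] \<in> polys_over K"
    "c \<in> K \<Longrightarrow> monom c n \<in> polys_over K"
    "p \<in> polys_over K \<Longrightarrow> q \<in> polys_over K \<Longrightarrow> p + q \<in> polys_over K"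
    "p \<in> polys_over K \<Longrightarrow> q \<in> polys_over K \<Longrightarrow> p - q \<in> polys_over K"
    "p \<in> polys_over K \<Longrightarrow> - p \<in> polys_over K"
    "p \<in> polys_over K \<Longrightarrow> q \<in> polys_over K \<Longrightarrow> p * q \<in> polys_over K"
    "c \<in> K \<Longrightarrow> p \<in> polys_over K \<Longrightarrow> pCons c p \<in> polys_over K"
  using complex_subfieldD[OF K]
  by (auto simp: polys_over_def coeff_mult coeff_pCons split: nat.split intro!: complex_subfield_sum[OF K])

lemma polys_over_sum:
  "complex_subfield K \<Longrightarrow> (\<And>i. i \<in> A \<Longrightarrow> f i \<in> polys_over K) \<Longrightarrow> sum f A \<in> polys_over K"
  by (induction A rule: infinite_finite_induct) (auto intro: polys_over_closed)

lemma polys_over_prod: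
  "complex_subfield K \<Longrightarrow> (\<And>i. i \<in> A \<Longrightarrow> f i \<in> polys_over K) \<Longrightarrow> prod f A \<in> polys_over K"
  by (induction A rule: infinite_finite_induct) (auto intro: polys_over_closed)

lemma algebraic_over_mono: "K \<subseteq> L \<Longrightarrow> algebraic_over K x \<Longrightarrow> algebraic_over L x"
  unfolding algebraic_over_def polys_over_def by blast

lemma field_embeddingD:
  assumes "field_embedding K \<sigma>"
  shows "complex_subfield K" "\<sigma> 0 = 0" "\<sigma> 1 = 1"
    "x \<in> K \<Longrightarrow> y \<in> K \<Longrightarrow> \<sigma> (x + y) = \<sigma> x + \<sigma> y"
    "x \<in> K \<Longrightarrow> y \<in> K \<Longrightarrow> \<sigma> (x * y) = \<sigma> x * \<sigma> y"
    "x \<in> K \<Longrightarrow> \<sigma> (- x) = - \<sigma> x"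
    "x \<in> K \<Longrightarrow> y \<in> K \<Longrightarrow> \<sigma> (x - y) = \<sigma> x - \<sigma> y"
    "x \<in> K \<Longrightarrow> \<sigma> x = 0 \<longleftrightarrow> x = 0"
    "x \<in> K \<Longrightarrow> \<sigma> (inverse x) = inverse (\<sigma> x)"
    "x \<in> K \<Longrightarrow> y \<in> K \<Longrightarrow> \<sigma> (x / y) = \<sigma> x / \<sigma> y"
proof -
  show K: "complex_subfield K" and one: "\<sigma> 1 = 1"
    and add: "\<And>x y. x \<in> K \<Longrightarrow> y \<in> K \<Longrightarrow> \<sigma> (x + y) = \<sigma> x + \<sigma> y"
    and mult: "\<And>x y. x \<in> K \<Longrightarrow> y \<in> K \<Longrightarrow> \<sigma> (x * y) = \<sigma> x * \<sigma> y"
    using assms unfolding field_embedding_def by auto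
  note KD = complex_subfieldD[OF K]
  show zero: "\<sigma> 0 = 0" using add[OF KD(1) KD(1)] by simp
  show neg: "\<And>x. x \<in> K \<Longrightarrow> \<sigma> (- x) = - \<sigma> x"
  proof -
    fix x assume "x \<in> K"
    then have "\<sigma> x + \<sigma> (- x) = 0" using add[of x "- x"] KD zero by simp
    then show "\<sigma> (- x) = - \<sigma> x" by (simp add: eq_neg_iff_add_eq_0 add.commute)
  qed
  show "x \<in> K \<Longrightarrow> y \<in> K \<Longrightarrow> \<sigma> (x - y) = \<sigma> x - \<sigma> y"
    using add[of x "- y"] neg KD by simp
  show nz: "\<And>x. x \<in> K \<Longrightarrow> \<sigma> x = 0 \<longleftrightarrow> x = 0"
  proof -
    fix x assume x: "x \<in> K"
    show "\<sigma> x = 0 \<longleftrightarrow> x = 0"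
    proof
      assume "\<sigma> x = 0"
      then have "\<sigma> (x * inverse x) = 0" using mult[of x "inverse x"] x KD by simp
      then show "x = 0" using one by (cases "x = 0") auto
    qed (simp add: zero)
  qed
  show inv: "\<And>x. x \<in> K \<Longrightarrow> \<sigma> (inverse x) = inverse (\<sigma> x)"
  proof -
    fix x assume x: "x \<in> K"
    show "\<sigma> (inverse x) = inverse (\<sigma> x)"
    proof (cases "x = 0")
      case False
      then have "\<sigma> x * \<sigma> (inverse x) = 1"
        using mult[of x "inverse x"] x KD one by simp
      then show ?thesis using inverse_unique by metis
    qed (simp add: zero)
  qed
  show "x \<in> K \<Longrightarrow> y \<in> K \<Longrightarrow> \<sigma> (x / y) = \<sigma> x / \<sigma> y"
    using mult[of x "inverse y"] inv KD by (simp add: divide_inverse)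
qed

lemma field_embedding_sum:
  assumes "field_embedding K \<sigma>" "\<And>i. i \<in> A \<Longrightarrow> f i \<in> K"
  shows "\<sigma> (sum f A) = (\<Sum>i\<in>A. \<sigma> (f i))"
  using assms(2)
proof (induction A rule: infinite_finite_induct)
  case (insert x F)
  then show ?case
    using field_embeddingD(4)[OF assms(1), of "f x" "sum f F"]
      complex_subfield_sum[OF field_embeddingD(1)[OF assms(1)], of F f] by simp
qed (use field_embeddingD[OF assms(1)] in simp_all)

lemma field_embedding_of_int:
  assumes "field_embedding K \<sigma>"
  shows "\<sigma> (of_int k) = of_int k"
proof (induction k rule: int_induct[where k = 0])
  case base then show ?case using field_embeddingD[OF assms] by simp
next
  case (step1 i)
  then show ?case
    using field_embeddingD(4)[OF assms complex_subfield_of_int complex_subfieldD(2), of i]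
      field_embeddingD[OF assms] by simp
next
  case (step2 i)
  then show ?case
    using field_embeddingD(7)[OF assms complex_subfield_of_int complex_subfieldD(2), of i]
      field_embeddingD[OF assms] by simp
qed

lemma field_embedding_power:
  assumes "field_embedding K \<sigma>" "x \<in> K"
  shows "x ^ n \<in> K \<and> \<sigma> (x ^ n) = \<sigma> x ^ n"
  using field_embeddingD[OF assms(1)] complex_subfieldD[OF field_embeddingD(1)[OF assms(1)]] assms(2)
  by (induction n) auto

lemma map_poly_embedding:
  assumes s: "field_embedding K \<sigma>" and pq: "p \<in> polys_over K" "q \<in> polys_over K"
  shows "map_poly \<sigma> (p + q) = map_poly \<sigma> p + map_poly \<sigma> q"
    "map_poly \<sigma> (p * q) = map_poly \<sigma> p * map_poly \<sigma> q"
proof -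
  note D = field_embeddingD[OF s] polys_overD[OF pq(1)] polys_overD[OF pq(2)]
  show "map_poly \<sigma> (p + q) = map_poly \<sigma> p + map_poly \<sigma> q"
    by (rule poly_eqI) (simp add: coeff_map_poly D)
  show "map_poly \<sigma> (p * q) = map_poly \<sigma> p * map_poly \<sigma> q"
  proof (rule poly_eqI)
    fix n
    have "\<sigma> (\<Sum>i\<le>n. coeff p i * coeff q (n - i)) = (\<Sum>i\<le>n. \<sigma> (coeff p i * coeff q (n - i)))"
      by (rule field_embedding_sum[OF s]) (use D complex_subfieldD[OF D(1)] in auto)
    then show "coeff (map_poly \<sigma> (p * q)) n = coeff (map_poly \<sigma> p * map_poly \<sigma> q) n"
      by (simp add: coeff_map_poly D coeff_mult)
  qed
qed

lemma polys_over_division: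
  assumes K: "complex_subfield K" and m: "m \<in> polys_over K" "m \<noteq> 0" and p: "p \<in> polys_over K"
  shows "\<exists>a\<in>polys_over K. \<exists>r\<in>polys_over K. p = a * m + r \<and> (r = 0 \<or> degree r < degree m)"
  using p
proof (induction "degree p" arbitrary: p rule: less_induct)
  case less
  show ?case
  proof (cases "p = 0 \<or> degree p < degree m")
    case True
    then show ?thesis
      using less(2) by (intro bexI[of _ 0] bexI[of _ p]) (auto intro: polys_over_closed[OF K])
  next
    case False
    define t where "t = monom (lead_coeff p / lead_coeff m) (degree p - degree m)"
    have lc: "lead_coeff m \<noteq> 0" using m by simp
    have t: "t \<in> polys_over K"
      unfolding t_def using m less(2) by (intro polys_over_closed[OF K] complex_subfieldD[OF K] polys_overD)
    define q where "q = p - t * m"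
    have q: "q \<in> polys_over K" unfolding q_def using t m less(2) by (intro polys_over_closed[OF K])
    have dt: "degree (t * m) = degree p"
      using False lc m unfolding t_def by (auto simp: degree_mult_eq monom_eq_0_iff degree_monom_eq)
    have "lead_coeff p / lead_coeff m \<noteq> 0" using False lc by auto
    then have "lead_coeff t = lead_coeff p / lead_coeff m" by (simp add: t_def degree_monom_eq)
    then have "lead_coeff (t * m) = lead_coeff p" unfolding lead_coeff_mult using lc by simp
    then have lt: "coeff (t * m) (degree p) = lead_coeff p" by (simp add: dt)
    show ?thesis
    proof (cases "q = 0")
      case True
      then have "p = t * m + 0" by (simp add: q_def)
      then show ?thesis using t polys_over_closed(1)[OF K] by blast
    next
      case q0: False
      have "coeff q (degree p) = 0" using dt lt by (simp add: q_def)
      moreover have "degree q \<le> degree p" unfolding q_def using dt by (simp add: degree_diff_le)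
      ultimately have dq: "degree q < degree p \<or> degree p = 0"
        using q0 leading_coeff_0_iff[of q] by (metis le_neq_implies_less)
      have "degree q < degree p"
      proof (rule ccontr)
        assume "\<not> degree q < degree p"
        with dq \<open>degree q \<le> degree p\<close> have "degree q = degree p" by simp
        with \<open>coeff q (degree p) = 0\<close> q0 show False by (metis leading_coeff_0_iff)
      qed
      then obtain a r where "a \<in> polys_over K" "r \<in> polys_over K" "q = a * m + r" "r = 0 \<or> degree r < degree m"
        using less(1)[OF _ q] by blast
      moreover have "p = (a + t) * m + r" using \<open>q = a * m + r\<close> by (simp add: q_def algebra_simps)
      ultimately show ?thesis using t polys_over_closed(5)[OF K] by blast
    qed
  qed
qed

lemma minimal_polynomial_exists:
  assumes "algebraic_over K x"
  obtains m where "m \<in> polys_over K" "m \<noteq> 0" "poly m x = 0"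
    "\<And>r. r \<in> polys_over K \<Longrightarrow> poly r x = 0 \<Longrightarrow> degree r < degree m \<Longrightarrow> r = 0"
proof -
  let ?P = "\<lambda>p. p \<in> polys_over K \<and> p \<noteq> 0 \<and> poly p x = 0"
  obtain p where "?P p" using assms unfolding algebraic_over_def by blast
  then obtain m where "?P m" "\<And>y. ?P y \<Longrightarrow> degree m \<le> degree y"
    using ex_has_least_nat[of ?P p degree] by blast
  then show ?thesis using that[of m] by (meson leD)
qed

text \<open>Euclid's algorithm at the point \<open>x\<close>: from \<open>m = a * p + r\<close>
  follows \<open>p(x) * (- a(x)) = r(x)\<close>, so inverting \<open>p(x)\<close> reduces to
  inverting a value of smaller degree. If \<open>r(x) = 0\<close>, minimality of \<open>m\<close>
  kills \<open>r\<close> and then \<open>a\<close>, which is absurd.\<close>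

lemma inverse_in_simple_extension:
  assumes K: "complex_subfield K" and alg: "algebraic_over K x"
    and p: "p \<in> polys_over K" "poly p x \<noteq> 0"
  shows "\<exists>q\<in>polys_over K. poly p x * poly q x = 1"
proof -
  obtain m where m: "m \<in> polys_over K" "m \<noteq> 0" "poly m x = 0"
    and min: "\<And>r. r \<in> polys_over K \<Longrightarrow> poly r x = 0 \<Longrightarrow> degree r < degree m \<Longrightarrow> r = 0"
    using minimal_polynomial_exists[OF alg] by metis
  have *: "\<exists>q\<in>polys_over K. poly p x * poly q x = 1"
    if "p \<in> polys_over K" "poly p x \<noteq> 0" "degree p < degree m" for p
    using that
  proof (induction "degree p" arbitrary: p rule: less_induct)
    case less
    show ?case
    proof (cases "degree p = 0")
      case True
      then obtain c where c: "p = [:c:]" using degree_eq_zeroE by blast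
      moreover have "c \<in> K" using less(2) c polys_overD[of p K 0] by simp
      ultimately show ?thesis
        using less(3) by (intro bexI[of _ "[:inverse c:]"]) (auto intro: polys_over_closed[OF K] complex_subfieldD[OF K])
    next
      case False
      then have "p \<noteq> 0" by auto
      then obtain a r where ar: "a \<in> polys_over K" "r \<in> polys_over K" "m = a * p + r" "r = 0 \<or> degree r < degree p"
        using polys_over_division[OF K less(2) _ m(1)] by blast
      have ev: "poly a x * poly p x + poly r x = 0" using m(3) ar(3) by simp
      show ?thesis
      proof (cases "poly r x = 0")
        case True
        with ev less(3) have a0: "poly a x = 0" by simp
        have "r = 0" using ar(4) less(4) min[OF ar(2) True] by auto
        then have "degree m = degree a + degree p" using ar(3) m(2) by (auto simp: degree_mult_eq)
        then have "a = 0" using min[OF ar(1) a0] False by simp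
        then show ?thesis using ar(3) m(2) \<open>r = 0\<close> by simp
      next
        case rx: False
        then have "degree r < degree p" using ar(4) by auto
        then obtain q where q: "q \<in> polys_over K" "poly r x * poly q x = 1"
          using less(1)[OF _ ar(2) rx] less(4) by auto
        have "poly p x * poly (- a * q) x = (poly r x - (poly a x * poly p x + poly r x)) * poly q x"
          by (simp add: algebra_simps)
        then have "poly p x * poly (- a * q) x = 1" using q(2) ev by simp
        then show ?thesis using q(1) ar(1) by (intro bexI[of _ "- a * q"]) (auto intro!: polys_over_closed[OF K])
      qed
    qed
  qed
  obtain a r where ar: "a \<in> polys_over K" "r \<in> polys_over K" "p = a * m + r" "r = 0 \<or> degree r < degree m"
    using polys_over_division[OF K m(1,2) p(1)] by blast
  have "poly p x = poly r x" using ar(3) m(3) by simp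
  moreover from this have "degree r < degree m" using p(2) ar(4) by auto
  ultimately show ?thesis using *[OF ar(2)] p(2) by simp
qed

text \<open>As \<open>x\<close> is algebraic, the polynomial values at \<open>x\<close> already form
  a field, and \<open>H\<close> is exactly the well-definedness of sending \<open>p(x)\<close> to
  the value at \<open>y\<close> of the transported polynomial. The target \<open>y\<close> is left
  free: it is a prescribed power of a root of unity in one application and an arbitrary root in the
  other.\<close>

lemma embedding_simple_extension:
  assumes s: "field_embedding K \<sigma>" and alg: "algebraic_over K x"
    and H: "\<And>p. p \<in> polys_over K \<Longrightarrow> poly p x = 0 \<Longrightarrow> poly (map_poly \<sigma> p) y = 0"
  shows "\<exists>L \<tau>. field_embedding L \<tau> \<and> K \<subseteq> L \<and> (\<forall>u\<in>K. \<tau> u = \<sigma> u) \<and> x \<in> L \<and> \<tau> x = y"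
proof -
  note D = field_embeddingD[OF s]
  note K = D(1)
  define L where "L = (\<lambda>p. poly p x) ` polys_over K"
  define \<tau> where "\<tau> u = poly (map_poly \<sigma> (SOME p. p \<in> polys_over K \<and> poly p x = u)) y" for u
  have \<tau>: "\<tau> (poly p x) = poly (map_poly \<sigma> p) y" if p: "p \<in> polys_over K" for p
  proof -
    define q where "q = (SOME q. q \<in> polys_over K \<and> poly q x = poly p x)"
    have q: "q \<in> polys_over K" "poly q x = poly p x"
      using someI[of "\<lambda>q. q \<in> polys_over K \<and> poly q x = poly p x" p] p unfolding q_def by auto
    have "poly (map_poly \<sigma> (q - p)) y = 0"
      using q p by (intro H polys_over_closed[OF K]) auto
    moreover have "map_poly \<sigma> q = map_poly \<sigma> (q - p) + map_poly \<sigma> p"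
      using map_poly_embedding(1)[OF s polys_over_closed(6)[OF K q(1) p] p] by simp
    ultimately show ?thesis by (simp add: \<tau>_def q_def[symmetric])
  qed
  have Lsub: "complex_subfield L"
    unfolding complex_subfield_def
  proof (intro conjI ballI)
    show "1 \<in> L" unfolding L_def using polys_over_closed(2)[OF K] by (metis image_eqI poly_1)
  next
    fix u v assume "u \<in> L" "v \<in> L"
    then obtain p q where pq: "p \<in> polys_over K" "q \<in> polys_over K" "u = poly p x" "v = poly q x"
      unfolding L_def by auto
    show "u + v \<in> L" unfolding L_def pq using polys_over_closed(5)[OF K pq(1,2)] by (metis image_eqI poly_add)
    show "u * v \<in> L" unfolding L_def pq using polys_over_closed(8)[OF K pq(1,2)] by (metis image_eqI poly_mult)
  next
    fix u assume "u \<in> L"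
    then obtain p where p: "p \<in> polys_over K" "u = poly p x" unfolding L_def by auto
    show "- u \<in> L" unfolding L_def p using polys_over_closed(7)[OF K p(1)] by (metis image_eqI poly_minus)
    show "inverse u \<in> L"
    proof (cases "u = 0")
      case True
      then show ?thesis unfolding L_def using p by auto
    next
      case False
      then obtain q where "q \<in> polys_over K" "u * poly q x = 1"
        using inverse_in_simple_extension[OF K alg p(1)] p(2) by auto
      then show ?thesis unfolding L_def by (metis image_eqI inverse_unique)
    qed
  qed
  have KL: "u \<in> L \<and> \<tau> u = \<sigma> u" if "u \<in> K" for u
  proof -
    have "[:u:] \<in> polys_over K" using that by (rule polys_over_closed[OF K])
    then have "poly [:u:] x \<in> L" "\<tau> (poly [:u:] x) = poly (map_poly \<sigma> [:u:]) y"
      unfolding L_def by (rule imageI, rule \<tau>)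
    then show ?thesis by (simp add: map_poly_pCons D(2))
  qed
  have X: "monom 1 1 \<in> polys_over K" by (intro polys_over_closed[OF K] complex_subfieldD[OF K])
  have "poly (monom 1 1) x \<in> L" unfolding L_def using X by (rule imageI)
  then have "x \<in> L" by (simp add: poly_monom)
  moreover have "\<tau> x = y"
    using \<tau>[OF X] by (simp add: map_poly_monom D(2,3) poly_monom)
  moreover have "field_embedding L \<tau>"
    unfolding field_embedding_def
  proof (intro conjI ballI Lsub)
    show "\<tau> 1 = 1" using KL[OF complex_subfieldD(2)[OF K]] D by simp
  next
    fix u v assume "u \<in> L" "v \<in> L"
    then obtain p q where pq: "p \<in> polys_over K" "q \<in> polys_over K" "u = poly p x" "v = poly q x"
      unfolding L_def by auto
    show "\<tau> (u + v) = \<tau> u + \<tau> v"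
      using \<tau>[OF polys_over_closed(5)[OF K pq(1,2)]] \<tau>[OF pq(1)] \<tau>[OF pq(2)] map_poly_embedding(1)[OF s pq(1,2)]
      by (simp add: pq)
    show "\<tau> (u * v) = \<tau> u * \<tau> v"
      using \<tau>[OF polys_over_closed(8)[OF K pq(1,2)]] \<tau>[OF pq(1)] \<tau>[OF pq(2)] map_poly_embedding(2)[OF s pq(1,2)]
      by (simp add: pq)
  qed
  ultimately show ?thesis using KL by blast
qed

text \<open>Any root \<open>y\<close> of the transported minimal polynomial is a legitimate target,
  because every polynomial over \<open>K\<close> vanishing at \<open>x\<close> is a multiple of
  \<open>m\<close>. Such a root exists since \<open>\<sigma>\<close> does not kill the leading
  coefficient.\<close>

lemma embedding_extends_algebraic:
  assumes s: "field_embedding K \<sigma>" and alg: "algebraic_over K x"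
  shows "\<exists>L \<tau>. field_embedding L \<tau> \<and> K \<subseteq> L \<and> (\<forall>u\<in>K. \<tau> u = \<sigma> u) \<and> x \<in> L"
proof -
  note D = field_embeddingD[OF s]
  note K = D(1)
  obtain m where m: "m \<in> polys_over K" "m \<noteq> 0" "poly m x = 0"
    and min: "\<And>r. r \<in> polys_over K \<Longrightarrow> poly r x = 0 \<Longrightarrow> degree r < degree m \<Longrightarrow> r = 0"
    using minimal_polynomial_exists[OF alg] by metis
  have "degree m \<noteq> 0"
  proof
    assume "degree m = 0"
    then obtain c where "m = [:c:]" using degree_eq_zeroE by blast
    with m(2,3) show False by simp
  qed
  moreover have "degree m \<le> degree (map_poly \<sigma> m)"
    by (rule le_degree) (use m D polys_overD[OF m(1)] in \<open>simp add: coeff_map_poly\<close>)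
  ultimately have "\<not> constant (poly (map_poly \<sigma> m))" by (simp add: constant_degree)
  then obtain y where y: "poly (map_poly \<sigma> m) y = 0" using fundamental_theorem_of_algebra by blast
  have "poly (map_poly \<sigma> p) y = 0" if p: "p \<in> polys_over K" "poly p x = 0" for p
  proof -
    obtain a r where ar: "a \<in> polys_over K" "r \<in> polys_over K" "p = a * m + r" "r = 0 \<or> degree r < degree m"
      using polys_over_division[OF K m(1,2) p(1)] by blast
    have "poly r x = 0" using ar(3) m(3) p(2) by simp
    then have "r = 0" using ar min by auto
    then show ?thesis using map_poly_embedding(2)[OF s ar(1) m(1)] y ar(3) by simp
  qed
  from embedding_simple_extension[OF s alg this] show ?thesis by blast
qed

lemma embedding_extends_finite:
  assumes "finite X" "field_embedding K \<sigma>" "\<And>x. x \<in> X \<Longrightarrow> algebraic_over K x"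
  shows "\<exists>L \<tau>. field_embedding L \<tau> \<and> K \<subseteq> L \<and> (\<forall>u\<in>K. \<tau> u = \<sigma> u) \<and> X \<subseteq> L"
  using assms
proof (induction X)
  case empty
  then show ?case by blast
next
  case (insert x X)
  then obtain L \<tau> where L: "field_embedding L \<tau>" "K \<subseteq> L" "\<forall>u\<in>K. \<tau> u = \<sigma> u" "X \<subseteq> L" by blast
  have "algebraic_over L x" using insert(5)[of x] L(2) by (auto intro: algebraic_over_mono)
  from embedding_extends_algebraic[OF L(1) this] show ?case
    using L(2,3,4) by (metis insert_subset subset_iff)
qed

section \<open>Irreducibility of cyclotomic polynomials\<close>

definition ipoly :: "int poly \<Rightarrow> complex \<Rightarrow> complex" where
  "ipoly P x = poly (map_poly of_int P) x"

lemma ipoly_simps: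
  "ipoly 0 x = 0" "ipoly 1 x = 1" "ipoly [:c:] x = of_int c"
  "ipoly (pCons c P) x = of_int c + x * ipoly P x"
  "ipoly (smult c P) x = of_int c * ipoly P x" "ipoly (monom c n) x = of_int c * x ^ n"
  by (simp_all add: ipoly_def map_poly_pCons map_poly_smult map_poly_monom poly_monom)

lemma ipoly_add: "ipoly (P + Q) x = ipoly P x + ipoly Q x"
proof -
  have "map_poly of_int (P + Q) = (map_poly of_int P + map_poly of_int Q :: complex poly)"
    by (rule poly_eqI) (simp add: coeff_map_poly)
  then show ?thesis by (simp add: ipoly_def)
qed

lemma ipoly_mult: "ipoly (P * Q) x = ipoly P x * ipoly Q x"
proof -
  have "map_poly of_int (P * Q) = (map_poly of_int P * map_poly of_int Q :: complex poly)"
    by (rule poly_eqI) (simp add: coeff_map_poly coeff_mult of_int_sum)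
  then show ?thesis by (simp add: ipoly_def)
qed

lemma ipoly_diff: "ipoly (P - Q) x = ipoly P x - ipoly Q x"
  using ipoly_add[of "P - Q" Q x] by simp

lemma ipoly_power: "ipoly (P ^ n) x = ipoly P x ^ n"
  by (induction n) (simp_all add: ipoly_simps ipoly_mult)

lemma ipoly_pcompose: "ipoly (pcompose P Q) x = ipoly P (ipoly Q x)"
  by (induction P) (simp_all add: ipoly_simps ipoly_add ipoly_mult pcompose_pCons)

lemma ipoly_of_nat: "ipoly (of_nat n) x = of_nat n"
  by (simp add: of_nat_poly ipoly_simps)

text \<open>Kept over a general commutative ring because it serves twice: for integers it gives
  Fermat's congruence, for integer polynomials the Frobenius congruence.\<close>

lemma power_prime_add_mod:
  fixes a b :: "'b :: comm_ring_1"
  assumes "prime q"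
  shows "\<exists>g. (a + b) ^ q = a ^ q + b ^ q + of_nat q * g"
proof -
  have "q > 0" using assms prime_gt_0_nat by blast
  define c where "c k = (q choose k) div q" for k
  have c: "q choose k = q * c k" if "0 < k" "k < q" for k
    using dvd_choose_prime[of k q] that assms by (simp add: c_def)
  have "(a + b) ^ q = (\<Sum>k\<le>q. of_nat (q choose k) * a ^ k * b ^ (q - k))" by (rule binomial_ring)
  also have "{..q} = insert 0 (insert q {0<..<q})" using \<open>q > 0\<close> by auto
  also have "(\<Sum>k\<in>\<dots>. of_nat (q choose k) * a ^ k * b ^ (q - k)) =
      a ^ q + b ^ q + (\<Sum>k\<in>{0<..<q}. of_nat (q choose k) * a ^ k * b ^ (q - k))"
    using \<open>q > 0\<close> by simp
  also have "(\<Sum>k\<in>{0<..<q}. of_nat (q choose k) * a ^ k * b ^ (q - k)) =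
      (\<Sum>k\<in>{0<..<q}. of_nat q * (of_nat (c k) * a ^ k * b ^ (q - k)))"
    by (rule sum.cong) (auto simp: c mult.assoc)
  finally show ?thesis by (auto simp: sum_distrib_left[symmetric])
qed

lemma int_power_prime_mod:
  assumes "prime q"
  shows "\<exists>b. (a::int) ^ q = a + int q * b"
proof (induction a rule: int_induct[where k = 0])
  case base
  then show ?case using prime_gt_0_nat[OF assms] by (auto simp: zero_power)
next
  case (step1 i)
  obtain b where b: "i ^ q = i + int q * b" using step1 by blast
  obtain g where "(i + 1) ^ q = i ^ q + 1 ^ q + int q * g" using power_prime_add_mod[OF assms, of i 1] by auto
  then have "(i + 1) ^ q = i + 1 + int q * (b + g)" using b by (simp add: algebra_simps)
  then show ?case by blast
next
  case (step2 i)
  obtain b where b: "i ^ q = i + int q * b" using step2 by blast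
  obtain g where "(i - 1 + 1) ^ q = (i - 1) ^ q + 1 ^ q + int q * g"
    using power_prime_add_mod[OF assms, of "i - 1" 1] by auto
  then have "(i - 1) ^ q = i - 1 + int q * (b - g)" using b by (simp add: algebra_simps)
  then show ?case by blast
qed

lemma ipoly_frobenius:
  assumes "prime q"
  shows "\<exists>R. pcompose P (monom 1 q) = P ^ q + of_nat q * (R :: int poly)"
proof (induction P)
  case 0
  then show ?case using prime_gt_0_nat[OF assms] by (intro exI[of _ 0]) (simp add: zero_power)
next
  case (pCons a P)
  obtain R where R: "pcompose P (monom 1 q) = P ^ q + of_nat q * R" using pCons by blast
  obtain b where b: "a ^ q = a + int q * b" using int_power_prime_mod[OF assms] by blast
  obtain g where g: "([:a:] + monom 1 1 * P) ^ q = [:a:] ^ q + (monom 1 1 * P) ^ q + of_nat q * g"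
    using power_prime_add_mod[OF assms] by blast
  have 1: "pCons a P = [:a:] + monom 1 1 * P" by (simp add: monom_Suc monom_0)
  have 2: "[:a:] ^ q = [:a:] + of_nat q * [:b:]" using b by (simp add: poly_const_pow of_nat_poly)
  have 3: "(monom 1 1 * P) ^ q = monom 1 q * P ^ q" by (simp add: power_mult_distrib monom_power)
  have "pcompose (pCons a P) (monom 1 q) = [:a:] + monom 1 q * (P ^ q + of_nat q * R)"
    by (simp add: pcompose_pCons R)
  also have "\<dots> = pCons a P ^ q + of_nat q * (monom 1 q * R - [:b:] - g)"
    unfolding 1 g 2 3 by (simp add: algebra_simps)
  finally show ?case by blast
qed

context
  fixes \<zeta> :: complex and N :: nat
  assumes N: "N > 0" and root: "\<zeta> ^ N = 1"
begin

text \<open>An instance of Gauss's lemma. Pseudo-division by \<open>m\<close> introduces a power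
  \<open>c\<close> of its leading coefficient, and since \<open>m\<close> is primitive,
  \<open>c\<close> divides the content of the quotient and cancels. Dividing the monic polynomial
  \<open>X^N - 1\<close> then makes the leading coefficient of \<open>m\<close> a unit.\<close>

lemma minimal_int_polynomial:
  obtains m where "ipoly m \<zeta> = 0" "degree m > 0" "lead_coeff m dvd 1" "m dvd monom 1 N - 1"
    "\<And>P. ipoly P \<zeta> = 0 \<Longrightarrow> m dvd P" "\<And>P. ipoly P \<zeta> = 0 \<Longrightarrow> degree P < degree m \<Longrightarrow> P = 0"
proof -
  let ?I = "\<lambda>P. P \<noteq> 0 \<and> ipoly P \<zeta> = 0"
  define X where "X = monom 1 N - (1 :: int poly)"
  have cX: "coeff X N = 1" using N by (simp add: X_def)
  have "X \<noteq> 0" using cX by (metis coeff_0 zero_neq_one)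
  then have "?I X" using root by (simp add: X_def ipoly_diff ipoly_simps)
  then obtain m0 where m0: "?I m0" "\<And>P. ?I P \<Longrightarrow> degree m0 \<le> degree P"
    using ex_has_least_nat[of ?I X degree] by blast
  define m where "m = primitive_part m0"
  have "m0 = smult (content m0) m" by (simp add: m_def)
  then have m: "?I m" using m0(1) by (metis ipoly_simps(5) mult_eq_0_iff of_int_eq_0_iff smult_eq_0_iff)
  have dm: "degree m = degree m0" by (simp add: m_def)
  have cm: "content m = 1" using m0(1) by (simp add: m_def)
  have small: "P = 0" if "ipoly P \<zeta> = 0" "degree P < degree m" for P
    using m0(2)[of P] that dm by auto
  have dvd: "m dvd P" if P: "ipoly P \<zeta> = 0" for P
  proof -
    obtain u r where ur: "pseudo_divmod P m = (u, r)" by fastforce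
    define c where "c = coeff m (degree m) ^ (Suc (degree P) - degree m)"
    have c0: "c \<noteq> 0" using m by (simp add: c_def)
    have eq: "smult c P = m * u + r" and r: "r = 0 \<or> degree r < degree m"
      using pseudo_divmod[OF _ ur] m unfolding c_def by blast+
    have "ipoly (smult c P) \<zeta> = ipoly (m * u + r) \<zeta>" using eq by simp
    then have "ipoly r \<zeta> = 0" using P m by (simp add: ipoly_simps ipoly_add ipoly_mult)
    then have "r = 0" using r small by blast
    then have eq: "smult c P = m * u" using eq by simp
    then have "content (smult c P) = content u" by (simp add: content_mult cm)
    then have "c dvd content u" by (metis content_smult dvd_triv_left normalize_dvd_iff)
    then have "[:c:] dvd u" by (simp add: const_poly_dvd_iff_dvd_content)
    then obtain v where "u = smult c v" by (auto elim!: dvdE)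
    then have "smult c P = smult c (m * v)" using eq by simp
    then have "P = m * v" using c0 by (metis smult_cancel)
    then show ?thesis by simp
  qed
  have "m dvd X" using dvd \<open>?I X\<close> by blast
  then obtain h where h: "X = m * h" by (elim dvdE)
  have "degree X = N"
  proof (rule antisym)
    show "degree X \<le> N" unfolding X_def by (intro degree_diff_le) (auto simp: degree_monom_eq)
    show "N \<le> degree X" using cX by (intro le_degree) simp
  qed
  then have "lead_coeff m * lead_coeff h = 1" using cX h by (metis lead_coeff_mult)
  then have "lead_coeff m dvd 1" by (metis dvd_triv_left)
  moreover have "degree m > 0"
  proof (rule ccontr)
    assume "\<not> degree m > 0"
    then obtain c where "m = [:c:]" using degree_eq_zeroE by blast
    then show False using m by (simp add: ipoly_simps)
  qed
  ultimately show ?thesis using that[of m] m \<open>m dvd X\<close> dvd small unfolding X_def by blast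
qed

text \<open>This is the irreducibility of cyclotomic polynomials. If the minimal polynomial \<open>m\<close> did not
  vanish at \<open>\<zeta> ^ q\<close>, then the derivative of \<open>X ^ N - 1\<close> would show that \<open>m (\<zeta> ^ q)\<close> divides \<open>N\<close> in
  \<open>\<int>[\<zeta>]\<close>, although \<open>m (\<zeta> ^ q)\<close> is a multiple of \<open>q\<close>.\<close>
lemma ipoly_root_power:
  assumes q: "prime q" "\<not> q dvd N" and P: "ipoly P \<zeta> = 0"
  shows "ipoly P (\<zeta> ^ q) = 0"
proof -
  obtain m where m: "ipoly m \<zeta> = 0" "degree m > 0" "lead_coeff m dvd 1" "m dvd monom 1 N - 1"
    "\<And>P. ipoly P \<zeta> = 0 \<Longrightarrow> m dvd P" "\<And>P. ipoly P \<zeta> = 0 \<Longrightarrow> degree P < degree m \<Longrightarrow> P = 0"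
    using minimal_int_polynomial by metis
  have "ipoly m (\<zeta> ^ q) = 0"
  proof (rule ccontr)
    assume nz: "ipoly m (\<zeta> ^ q) \<noteq> 0"
    obtain h where h: "monom 1 N - 1 = m * h" using m(4) by (elim dvdE)
    have "ipoly (m * h) (\<zeta> ^ q) = 0"
      using h[symmetric] root by (simp add: ipoly_diff ipoly_simps power_mult[symmetric] mult.commute[of q])
        (simp add: power_mult)
    then have h0: "ipoly h (\<zeta> ^ q) = 0" using nz by (simp add: ipoly_mult)
    obtain R where R: "pcompose m (monom 1 q) = m ^ q + of_nat q * R"
      using ipoly_frobenius[OF q(1)] by blast
    have "ipoly (pcompose m (monom 1 q)) \<zeta> = ipoly (m ^ q + of_nat q * R) \<zeta>" using R by simp
    then have mq: "ipoly m (\<zeta> ^ q) = of_nat q * ipoly R \<zeta>"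
      using m(1) prime_gt_0_nat[OF q(1)] by (simp add: ipoly_pcompose ipoly_simps ipoly_add ipoly_mult ipoly_of_nat ipoly_power)
    have "monom (int N) (N - 1) = pderiv m * h + m * pderiv h"
      using arg_cong[OF h, of pderiv] by (simp add: pderiv_diff pderiv_monom pderiv_mult)
    then have "ipoly (monom (int N) (N - 1)) (\<zeta> ^ q) = ipoly (pderiv m * h + m * pderiv h) (\<zeta> ^ q)" by simp
    then have "of_nat N * (\<zeta> ^ q) ^ (N - 1) = of_nat q * ipoly R \<zeta> * ipoly (pderiv h) (\<zeta> ^ q)"
      using h0 mq by (simp add: ipoly_simps ipoly_add ipoly_mult)
    then have "of_nat N * (\<zeta> ^ q) ^ (N - 1) * \<zeta> ^ q = of_nat q * ipoly R \<zeta> * ipoly (pderiv h) (\<zeta> ^ q) * \<zeta> ^ q"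
      by (rule arg_cong)
    then have "of_nat N * ((\<zeta> ^ q) ^ (N - 1) * \<zeta> ^ q) = of_nat q * ipoly R \<zeta> * ipoly (pderiv h) (\<zeta> ^ q) * \<zeta> ^ q"
      by (simp only: mult.assoc)
    moreover have "(\<zeta> ^ q) ^ (N - 1) * \<zeta> ^ q = 1"
    proof -
      have "(\<zeta> ^ q) ^ (N - 1) * \<zeta> ^ q = (\<zeta> ^ q) ^ N" using N by (metis power_minus_mult)
      then show ?thesis using root by (metis mult.commute power_mult power_one)
    qed
    ultimately have *: "of_nat N = of_nat q * ipoly R \<zeta> * ipoly (pderiv h) (\<zeta> ^ q) * \<zeta> ^ q" by (metis mult.right_neutral)
    define s where "s = R * pcompose (pderiv h) (monom 1 q) * monom 1 q"
    have s: "of_nat N = of_nat q * ipoly s \<zeta>"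
      unfolding s_def ipoly_mult ipoly_simps ipoly_pcompose using * by (simp add: mult.assoc)
    obtain a r where ar: "pseudo_divmod s m = (a, r)" by fastforce
    define c where "c = coeff m (degree m) ^ (Suc (degree s) - degree m)"
    have c1: "c dvd 1" unfolding c_def using m(3) by (metis dvd_power_same power_one)
    have eq: "smult c s = m * a + r" and r: "r = 0 \<or> degree r < degree m"
      using pseudo_divmod[OF _ ar] m(2) unfolding c_def by force+
    have "ipoly (smult c s) \<zeta> = ipoly (m * a + r) \<zeta>" using eq by simp
    then have rs: "ipoly r \<zeta> = of_int c * ipoly s \<zeta>" using m(1) by (simp add: ipoly_simps ipoly_add ipoly_mult)
    \<comment> \<open>The equation \<open>N = q * s(\<zeta>)\<close> lives among algebraic numbers.
      Reducing \<open>s\<close> modulo \<open>m\<close> brings it below the degree of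
      \<open>m\<close>, where it has to hold coefficient by coefficient; the constant coefficient
      gives a divisibility of integers.\<close>
    define D where "D = [:c * int N:] - smult (int q) r"
    have "ipoly D \<zeta> = 0" by (simp add: D_def ipoly_diff ipoly_simps rs s)
    moreover have "degree D < degree m"
      unfolding D_def using r m(2) by (intro degree_diff_less) auto
    ultimately have "D = 0" using m(6) by blast
    then have "coeff D 0 = 0" by simp
    then have "c * int N = int q * coeff r 0" by (simp add: D_def)
    then have "int q dvd c * int N" by simp
    then have "int q dvd int N" using c1 by (metis dvd_mult_unit_iff mult.commute)
    then show False using q(2) by simp
  qed
  moreover obtain u where "P = m * u" using m(5)[OF P] by (elim dvdE)
  ultimately show ?thesis by (simp add: ipoly_mult)
qed

lemma rational_poly_root_power:
  assumes q: "prime q" "\<not> q dvd N" and p: "p \<in> polys_over \<rat>" "poly p \<zeta> = 0"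
  shows "poly p (\<zeta> ^ q) = 0"
proof -
  have "\<exists>f. \<forall>i. coeff p i = of_rat (f i)"
    using p(1) unfolding polys_over_def Rats_def by (intro choice) blast
  then obtain f where f: "\<And>i. coeff p i = of_rat (f i)" by blast
  define d where "d = (\<Prod>i\<le>degree p. snd (quotient_of (f i)))"
  have d0: "d \<noteq> 0" unfolding d_def using quotient_of_denom_pos' by (simp add: less_imp_neq[symmetric])
  have "coeff (smult (of_int d) p) i \<in> \<int>" for i
  proof (cases "i \<le> degree p")
    case True
    define b where "b = snd (quotient_of (f i))"
    have "b dvd d" unfolding d_def b_def using True by (intro dvd_prodI) auto
    then obtain e where e: "d = b * e" by (elim dvdE)
    have b0: "b \<noteq> 0" using d0 e by auto
    have "f i = of_int (fst (quotient_of (f i))) / of_int b"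
      unfolding b_def by (rule quotient_of_div) simp
    then have "of_rat (f i) = (of_int (fst (quotient_of (f i))) / of_int b :: complex)"
      by (metis of_rat_divide of_rat_of_int_eq)
    then have "of_int d * of_rat (f i) = (of_int (e * fst (quotient_of (f i))) :: complex)"
      using b0 e by simp
    then show ?thesis by (metis Ints_of_int coeff_smult f)
  next
    case False
    then show ?thesis by (simp add: coeff_eq_0)
  qed
  then obtain P where P: "smult (of_int d) p = map_poly of_int P" using intpolyE by blast
  have *: "ipoly P x = of_int d * poly p x" for x unfolding ipoly_def P[symmetric] by simp
  have "ipoly P (\<zeta> ^ q) = 0" using ipoly_root_power[OF q, of P] *[of \<zeta>] p(2) by simp
  then show ?thesis using * d0 by simp
qed

end

lemma complex_subfield_Rats: "complex_subfield \<rat>"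
  by (simp add: complex_subfield_def)

lemma cyclotomic_embedding:
  assumes "N > 0" "\<zeta> ^ N = 1" "prime q" "\<not> q dvd N"
  shows "\<exists>K \<sigma>. field_embedding K \<sigma> \<and> \<zeta> \<in> K \<and> \<sigma> \<zeta> = \<zeta> ^ q"
proof -
  have emb: "field_embedding \<rat> (\<lambda>x. x)" by (simp add: field_embedding_def complex_subfield_Rats)
  have "monom 1 N - 1 \<in> polys_over \<rat>"
    by (intro polys_over_closed[OF complex_subfield_Rats]) simp
  moreover have "coeff (monom 1 N - 1 :: complex poly) N = 1" using assms(1) by simp
  then have "monom 1 N - 1 \<noteq> (0 :: complex poly)" by (metis coeff_0 zero_neq_one)
  ultimately have alg: "algebraic_over \<rat> \<zeta>"
    unfolding algebraic_over_def using assms(2) by (intro bexI[of _ "monom 1 N - 1"]) (auto simp: poly_monom)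
  have "map_poly (\<lambda>x. x) p = p" for p :: "complex poly" by (rule poly_eqI) (simp add: coeff_map_poly)
  then show ?thesis
    using embedding_simple_extension[OF emb alg, of "\<zeta> ^ q"] rational_poly_root_power[OF assms] by auto
qed

section \<open>Signed permutation matrices and the fusion algebra\<close>

definition diag_matrix :: "('a \<Rightarrow> 'b::zero) \<Rightarrow> 'b^'a^'a" where
  "diag_matrix f = (\<chi> i j. if i = j then f i else 0)"

lemma diag_matrix_nth [simp]: "diag_matrix f $ i $ j = (if i = j then f i else 0)"
  by (simp add: diag_matrix_def)

lemma matrix_mult_nth: "(A ** B) $ i $ j = (\<Sum>k\<in>UNIV. A $ i $ k * B $ k $ j)"
  by (simp add: matrix_matrix_mult_def)

lemma diag_matrix_mult_left [simp]:
  fixes A :: "'b::semiring_1^'a::finite^'a"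
  shows "(diag_matrix f ** A) $ i $ j = f i * A $ i $ j"
proof -
  have "(diag_matrix f ** A) $ i $ j = (\<Sum>k\<in>UNIV. if k = i then f i * A $ i $ j else 0)"
    unfolding matrix_mult_nth by (rule sum.cong) auto
  then show ?thesis by simp
qed

lemma diag_matrix_mult_right [simp]:
  fixes A :: "'b::semiring_1^'a::finite^'a"
  shows "(A ** diag_matrix f) $ i $ j = A $ i $ j * f j"
proof -
  have "(A ** diag_matrix f) $ i $ j = (\<Sum>k\<in>UNIV. if k = j then A $ i $ j * f j else 0)"
    unfolding matrix_mult_nth by (rule sum.cong) auto
  then show ?thesis by simp
qed

lemma diag_matrix_mult:
  fixes f g :: "'a::finite \<Rightarrow> 'b::semiring_1"
  shows "diag_matrix f ** diag_matrix g = diag_matrix (\<lambda>i. f i * g i)"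
  by (simp add: vec_eq_iff)

lemma diag_matrix_1: "diag_matrix (\<lambda>_. 1) = mat 1"
  by (simp add: vec_eq_iff mat_def)

text \<open>The orientation fits the action of embeddings on the columns of \<open>S\<close>: column
  \<open>d\<close> of \<open>A ** G\<close> is, up to the sign \<open>e d\<close>, column
  \<open>p d\<close> of \<open>A\<close>.\<close>

definition signed_perm :: "('a \<Rightarrow> 'a) \<Rightarrow> complex^'a::finite^'a \<Rightarrow> bool" where
  "signed_perm p G \<longleftrightarrow> bij p \<and> (\<exists>e. (\<forall>d. e d = 1 \<or> e d = - 1) \<and> G = (\<chi> i d. if i = p d then e d else 0))"

lemma signed_perm_mult_right:
  fixes A :: "complex^'a::finite^'a"
  assumes "G = (\<chi> i d. if i = p d then e d else 0)"
  shows "(A ** G) $ a $ d = A $ a $ p d * e d"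
proof -
  have "(A ** G) $ a $ d = (\<Sum>k\<in>UNIV. if k = p d then A $ a $ k * e d else 0)"
    unfolding matrix_mult_nth assms by (rule sum.cong) auto
  then show ?thesis by simp
qed

lemma signed_perm_orthogonal:
  assumes "signed_perm p G"
  shows "G ** transpose G = mat 1" "transpose G ** G = mat 1"
proof -
  obtain e where e: "bij p" "\<And>d. e d = 1 \<or> e d = - 1" "G = (\<chi> i d. if i = p d then e d else 0)"
    using assms unfolding signed_perm_def by blast
  have "e d * e d = 1" for d using e(2)[of d] by auto
  then show *: "transpose G ** G = mat 1"
    using bij_is_inj[OF e(1)] by (simp add: vec_eq_iff signed_perm_mult_right[OF e(3)])
      (simp add: e(3) transpose_def mat_def inj_eq)
  show "G ** transpose G = mat 1"
    using * matrix_left_right_inverse by blast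
qed

lemma signed_perm_diag:
  fixes G :: "complex^'a::finite^'a"
  assumes "signed_perm p G"
  shows "diag_matrix f ** G = G ** diag_matrix (f \<circ> p)"
proof -
  obtain e where e: "G = (\<chi> i d. if i = p d then e d else 0)"
    using assms unfolding signed_perm_def by blast
  show ?thesis by (simp add: vec_eq_iff e)
qed

lemma signed_perm_conj_diag:
  assumes "signed_perm p G"
  shows "G ** diag_matrix f ** transpose G = diag_matrix (f \<circ> inv p)"
proof -
  have "bij p" using assms by (simp add: signed_perm_def)
  then have "f \<circ> inv p \<circ> p = f" by (simp add: fun_eq_iff bij_is_inj)
  then have "G ** diag_matrix f = diag_matrix (f \<circ> inv p) ** G"
    using signed_perm_diag[OF assms, of "f \<circ> inv p"] by simp
  then show ?thesis
    by (simp add: matrix_mul_assoc[symmetric] signed_perm_orthogonal[OF assms])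
qed

lemma signed_perm_unique:
  assumes "signed_perm p G" "signed_perm q G"
  shows "p = q"
proof
  fix d
  obtain e where e: "\<And>d. e d = 1 \<or> e d = - 1" "G = (\<chi> i d. if i = p d then e d else 0)"
    using assms unfolding signed_perm_def by blast
  obtain f where f: "G = (\<chi> i d. if i = q d then f d else 0)"
    using assms unfolding signed_perm_def by blast
  have "G $ p d $ d \<noteq> 0" using e(1)[of d] e(2) by auto
  then show "p d = q d" using f by (auto split: if_splits)
qed

lemma signed_perm_mult:
  assumes "signed_perm p G" "signed_perm q H"
  shows "signed_perm (p \<circ> q) (G ** H)"
proof -
  obtain e where e: "bij p" "\<And>d. e d = 1 \<or> e d = - 1" "G = (\<chi> i d. if i = p d then e d else 0)"
    using assms unfolding signed_perm_def by blast
  obtain f where f: "bij q" "\<And>d. f d = 1 \<or> f d = - 1" "H = (\<chi> i d. if i = q d then f d else 0)"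
    using assms unfolding signed_perm_def by blast
  have "(G ** H) $ i $ d = (if i = (p \<circ> q) d then e (q d) * f d else 0)" for i d
    unfolding signed_perm_mult_right[OF f(3)] e(3) by simp
  then have "G ** H = (\<chi> i d. if i = (p \<circ> q) d then e (q d) * f d else 0)"
    by (simp add: vec_eq_iff)
  moreover have "e (q d) * f d = 1 \<or> e (q d) * f d = - 1" for d
    using e(2)[of "q d"] f(2)[of d] by auto
  ultimately show ?thesis
    unfolding signed_perm_def using bij_comp[OF f(1) e(1)] by (intro conjI exI[of _ "\<lambda>d. e (q d) * f d"]) auto
qed

lemma field_embedding_matrix_mult:
  assumes "field_embedding K \<sigma>" "\<And>i j. A $ i $ j \<in> K" "\<And>i j. B $ i $ j \<in> K"
  shows "map_matrix \<sigma> (A ** B) = map_matrix \<sigma> A ** map_matrix \<sigma> B"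
  using assms field_embeddingD(5)[OF assms(1)] complex_subfieldD(4)[OF field_embeddingD(1)[OF assms(1)]]
  by (simp add: vec_eq_iff matrix_mult_nth map_matrix_def field_embedding_sum[OF assms(1)])

text \<open>The entries are 0, 1 and -1, which every embedding fixes. Hence composing embeddings
  multiplies the associated matrices without any twist.\<close>

lemma map_matrix_signed_perm:
  assumes "field_embedding K \<sigma>" "signed_perm p G"
  shows "G $ i $ j \<in> K" "map_matrix \<sigma> G = G"
proof -
  obtain e where e: "\<And>d. e d = 1 \<or> e d = - 1" "G = (\<chi> i d. if i = p d then e d else 0)"
    using assms unfolding signed_perm_def by blast
  note D = field_embeddingD[OF assms(1)] and KD = complex_subfieldD[OF field_embeddingD(1)[OF assms(1)]]
  have m: "- 1 \<in> K" "\<sigma> (- 1) = - 1" using KD(5)[OF KD(2)] D(6)[OF KD(2)] D(3) by simp_all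
  have *: "G $ i $ j = 0 \<or> G $ i $ j = 1 \<or> G $ i $ j = - 1" for i j
    using e by auto
  show "G $ i $ j \<in> K" using *[of i j] KD(1,2) m(1) by metis
  have "\<sigma> (G $ i $ j) = G $ i $ j" for i j
    using *[of i j] D(2,3) m(2) by metis
  then show "map_matrix \<sigma> G = G" by (simp add: map_matrix_def vec_eq_iff)
qed

lemma odd_root_of_unity_real:
  fixes x :: complex
  assumes "odd N" "x ^ N = 1" "x \<in> \<real>"
  shows "x = 1"
proof -
  obtain r where r: "x = of_real r" using assms(3) by (auto elim: Reals_cases)
  have "r ^ N = 1" using assms(2) r by (metis of_real_eq_1_iff of_real_power)
  then have "r = 1"
    using assms(1) by (metis odd_real_root_power_cancel power_one)
  then show ?thesis using r by simp
qed

lemma odd_root_of_unity_involution: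
  fixes x :: complex
  assumes "odd N" "x ^ N = 1" "x * x = 1"
  shows "x = 1"
proof -
  have "x = 1 \<or> x = - 1" using assms(3) by (simp add: square_eq_1_iff)
  then show ?thesis using odd_root_of_unity_real[OF assms(1,2)] by auto
qed

section \<open>Characters of the fusion algebra and their algebraicity\<close>

locale odd_level_data = rcft_modular_data z S T for z :: "'a::finite" and S T :: "complex^'a^'a" +
  fixes N :: nat
  assumes odd_N: "odd N" and T_pow_N: "matrix_pow T N = mat 1"
begin

definition C where "C = S ** S"

definition Cp :: "'a \<Rightarrow> 'a" where
  "Cp = (SOME p. bij p \<and> p z = z \<and> S ** S = (\<chi> a b. if b = p a then 1 else 0))"

lemma Cp: "bij Cp" "Cp z = z" "C = (\<chi> a b. if b = Cp a then 1 else 0)"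
  using someI_ex[OF charge_conjugation] unfolding Cp_def C_def by auto

text \<open>Because \<open>S\<close> has fourth power 1, this is the inverse of \<open>S\<close>; by
  unitarity and symmetry it is also the entrywise complex conjugate.\<close>

definition Si where "Si = S ** C"

lemma C_C: "C ** C = mat 1"
  using charge_conjugation_involution by (simp add: matrix_pow_def C_def numeral_2_eq_2)

lemma C_S: "C ** S = Si" "S ** C = Si"
  using charge_conjugation_commutes_S by (simp_all add: C_def Si_def)

lemma C_T: "C ** T = T ** C"
  using charge_conjugation_commutes_T by (simp add: C_def)

lemma S_Si: "S ** Si = mat 1" "Si ** S = mat 1"
proof -
  show "S ** Si = mat 1" unfolding Si_def by (simp add: matrix_mul_assoc C_def[symmetric] C_C)
  then show "Si ** S = mat 1" using matrix_left_right_inverse by blast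
qed

lemma conj_transpose_S: "conj_transpose S = Si"
proof -
  have "conj_transpose S ** (S ** Si) = Si"
    using S_unitary by (simp add: matrix_mul_assoc unitary_matrix_def)
  then show ?thesis by (simp add: S_Si)
qed

lemma S_sym: "S $ a $ b = S $ b $ a"
  using S_symmetric by (metis transpose_def vec_lambda_beta)

lemma Si_nth: "Si $ a $ b = cnj (S $ a $ b)" "Si $ a $ b = S $ Cp a $ b"
proof -
  show "Si $ a $ b = cnj (S $ a $ b)"
    using S_sym[of a b] by (simp add: conj_transpose_S[symmetric] conj_transpose_def transpose_def map_matrix_def)
  have "(C ** S) $ a $ b = (\<Sum>k\<in>UNIV. if k = Cp a then S $ Cp a $ b else 0)"
    unfolding matrix_mult_nth Cp(3) by (rule sum.cong) auto
  then show "Si $ a $ b = S $ Cp a $ b" by (simp add: C_S)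
qed

lemma cnj_S: "cnj (S $ a $ b) = S $ Cp a $ b"
  using Si_nth by metis

lemma Si_sym: "Si $ a $ b = Si $ b $ a"
  using S_sym by (simp add: Si_nth(1))

lemma S_vacuum_real: "S $ z $ b \<in> \<real>" "Si $ z $ b = S $ z $ b" "Si $ b $ z = S $ z $ b"
  using cnj_S[of z b] Cp(2) Si_nth(1)[of z b] Si_sym[of b z] by (simp_all add: Reals_cnj_iff)

lemma S_orth: "(\<Sum>c\<in>UNIV. S $ a $ c * cnj (S $ b $ c)) = (if a = b then 1 else 0)"
proof -
  have "(S ** Si) $ a $ b = (\<Sum>c\<in>UNIV. S $ a $ c * cnj (S $ b $ c))"
    unfolding matrix_mult_nth using S_sym by (simp add: Si_nth(1))
  then show ?thesis by (simp add: S_Si mat_def)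
qed

text \<open>For fixed \<open>d\<close> these numbers are a one-dimensional character of the fusion
  algebra, by Verlinde's formula. A field embedding must carry characters to characters, since
  structure constants are integers.\<close>

definition chi :: "'a \<Rightarrow> 'a \<Rightarrow> complex" where "chi a d = S $ a $ d / S $ z $ d"

lemma S_chi: "S $ a $ d = chi a d * S $ z $ d"
  using S_vacuum_nonzero by (simp add: chi_def)

lemma chi_z [simp]: "chi z d = 1"
  using S_vacuum_nonzero by (simp add: chi_def)

lemma sum_delta_right: "(\<Sum>e\<in>UNIV. f e * (if e = d then 1 else 0)) = (f d :: complex)" for d :: 'a
proof -
  have "(\<Sum>e\<in>UNIV. f e * (if e = d then 1 else 0)) = (\<Sum>e\<in>UNIV. if e = d then f e else 0)"
    by (rule sum.cong) auto
  then show ?thesis by simp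
qed

lemma chi_mult: "chi a d * chi b d = (\<Sum>c\<in>UNIV. fusion z S a b c * chi c d)"
proof -
  have "(\<Sum>c\<in>UNIV. fusion z S a b c * S $ c $ d) =
      (\<Sum>c\<in>UNIV. \<Sum>e\<in>UNIV. S $ a $ e * S $ b $ e / S $ z $ e * (S $ d $ c * cnj (S $ e $ c)))"
    unfolding fusion_def sum_distrib_right
    by (intro sum.cong refl) (simp add: S_sym[of d] S_sym[of _ "_::'a"] mult_ac)
  also have "\<dots> = (\<Sum>e\<in>UNIV. S $ a $ e * S $ b $ e / S $ z $ e * (\<Sum>c\<in>UNIV. S $ d $ c * cnj (S $ e $ c)))"
    by (subst sum.swap) (simp add: sum_distrib_left)
  also have "\<dots> = (\<Sum>e\<in>UNIV. S $ a $ e * S $ b $ e / S $ z $ e * (if e = d then 1 else 0))"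
    unfolding S_orth by (intro sum.cong) auto
  also have "\<dots> = S $ a $ d * S $ b $ d / S $ z $ d" by (rule sum_delta_right)
  finally have "(\<Sum>c\<in>UNIV. fusion z S a b c * S $ c $ d) / S $ z $ d = chi a d * chi b d"
    by (simp add: chi_def)
  then show ?thesis by (simp add: chi_def sum_divide_distrib)
qed

text \<open>The transposed companion of \<open>chi_mult\<close>: conjugate columns of
  \<open>S\<close> are eigenvectors of fusion by \<open>b\<close>, and pairing with them isolates
  one character at a time.\<close>

lemma fusion_eigen: "(\<Sum>a\<in>UNIV. fusion z S b a c * cnj (S $ a $ e)) = chi b e * cnj (S $ c $ e)"
proof -
  have "(\<Sum>a\<in>UNIV. fusion z S b a c * cnj (S $ a $ e)) =
      (\<Sum>a\<in>UNIV. \<Sum>d\<in>UNIV. chi b d * cnj (S $ c $ d) * (S $ d $ a * cnj (S $ e $ a)))"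
    unfolding fusion_def sum_distrib_right
    by (intro sum.cong refl) (simp add: S_sym[of e] S_sym[of _ "_::'a"] chi_def mult_ac)
  also have "\<dots> = (\<Sum>d\<in>UNIV. chi b d * cnj (S $ c $ d) * (\<Sum>a\<in>UNIV. S $ d $ a * cnj (S $ e $ a)))"
    by (subst sum.swap) (simp add: sum_distrib_left)
  also have "\<dots> = chi b e * cnj (S $ c $ e)"
    unfolding S_orth by (rule sum_delta_right)
  finally show ?thesis .
qed

text \<open>This puts the squares of the vacuum entries into the field generated by the characters.
  It makes the entries themselves algebraic and determines their conjugates up to sign, which is
  where the Galois signs come from.\<close>

lemma inverse_vacuum_square: "(\<Sum>a\<in>UNIV. chi a d * chi (Cp a) d) = 1 / (S $ z $ d * S $ z $ d)"
proof -
  have "(\<Sum>a\<in>UNIV. chi a d * chi (Cp a) d) = (\<Sum>a\<in>UNIV. S $ d $ a * cnj (S $ d $ a)) / (S $ z $ d * S $ z $ d)"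
    unfolding sum_divide_distrib
    by (intro sum.cong refl) (simp add: chi_def cnj_S[symmetric] S_sym[of d])
  then show ?thesis by (simp add: S_orth)
qed

text \<open>The values \<open>chi a d\<close> are the eigenvalues of the fusion matrix of
  \<open>a\<close>, whose entries are natural numbers; \<open>S\<close> diagonalizes it.\<close>

lemma chi_algebraic:
  assumes K: "complex_subfield K"
  shows "algebraic_over K (chi a d)"
proof -
  \<comment> \<open>The characteristic matrix of fusion by \<open>a\<close>, with polynomial
    entries, so that its determinant is visibly a polynomial over \<open>K\<close>.\<close>
  define M :: "complex poly^'a^'a" where
    "M = (\<chi> i j. [:- fusion z S a i j, if i = j then 1 else 0:])"
  have polyM: "poly (det M) y = (\<Prod>e\<in>UNIV. y - chi a e)" for y
  proof -
    have "poly (det M) y = det (\<chi> i j. poly (M $ i $ j) y)"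
      by (simp add: det_def poly_sum poly_prod)
    also have "(\<chi> i j. poly (M $ i $ j) y) = S ** diag_matrix (\<lambda>e. y - chi a e) ** Si"
    proof (subst vec_eq_iff, intro allI, subst vec_eq_iff, intro allI)
      fix i j
      have "(S ** diag_matrix (\<lambda>e. y - chi a e) ** Si) $ i $ j =
          (\<Sum>e\<in>UNIV. y * (S $ i $ e * cnj (S $ j $ e)) - chi a e * S $ i $ e * cnj (S $ j $ e))"
        unfolding matrix_mult_nth[of _ Si] using S_sym by (simp add: Si_nth(1) algebra_simps)
      also have "\<dots> = y * (if i = j then 1 else 0) - fusion z S a i j"
        by (simp add: sum_subtractf sum_distrib_left[symmetric] S_orth fusion_def chi_def)
      finally show "(\<chi> i j. poly (M $ i $ j) y) $ i $ j = (S ** diag_matrix (\<lambda>e. y - chi a e) ** Si) $ i $ j"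
        by (simp add: M_def)
    qed
    also have "det \<dots> = det (diag_matrix (\<lambda>e. y - chi a e)) * (det S * det Si)"
      by (simp add: det_mul)
    also have "det S * det Si = 1" by (simp add: det_mul[symmetric] S_Si)
    also have "det (diag_matrix (\<lambda>e. y - chi a e)) = (\<Prod>e\<in>UNIV. y - chi a e)"
      by (subst det_diagonal) auto
    finally show ?thesis by simp
  qed
  have "fusion z S a i j \<in> K" for i j
    using verlinde[of a i j] complex_subfield_of_int[OF K] by (auto elim!: Nats_cases) (metis of_int_of_nat_eq)
  then have "det M \<in> polys_over K"
    unfolding det_def M_def
    by (intro polys_over_sum polys_over_closed[OF K] polys_over_prod K)
       (auto simp: of_int_poly intro!: polys_over_closed[OF K] complex_subfieldD[OF K] complex_subfield_of_int[OF K])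
  moreover have "det M \<noteq> 0"
  proof
    assume "det M = 0"
    then have "(\<Prod>e\<in>UNIV. y - chi a e) = 0" for y using polyM[of y] by simp
    then have "y \<in> range (chi a)" for y by (auto simp: prod_zero_iff)
    then have "(UNIV :: complex set) \<subseteq> range (chi a)" by auto
    then show False using infinite_UNIV_char_0[where 'a = complex] finite_subset[OF _ finite_imageI[OF finite_class.finite_UNIV]]
      by metis
  qed
  moreover have "poly (det M) (chi a d) = 0" unfolding polyM by (auto simp: prod_zero_iff)
  ultimately show ?thesis unfolding algebraic_over_def by blast
qed

end

section \<open>Galois action on modular data\<close>

context odd_level_data
begin

lemma column_injective:
  assumes "\<And>b. chi b d = chi b e"
  shows "d = e"
proof (rule ccontr)
  assume "d \<noteq> e"
  define r where "r = S $ z $ d / S $ z $ e"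
  have "S $ b $ d = r * S $ b $ e" for b
    using assms[of b] S_chi[of b d] S_chi[of b e] S_vacuum_nonzero[of e] by (simp add: r_def)
  then have "(\<Sum>b\<in>UNIV. S $ d $ b * cnj (S $ e $ b)) = r * (\<Sum>b\<in>UNIV. S $ e $ b * cnj (S $ e $ b))"
    unfolding sum_distrib_left by (intro sum.cong refl) (simp add: S_sym[of d] S_sym[of e])
  then have "r = 0" using \<open>d \<noteq> e\<close> by (simp add: S_orth)
  then show False using S_vacuum_nonzero by (simp add: r_def)
qed

text \<open>The conjugated column \<open>\<psi>\<close> is again multiplicative on the fusion
  algebra. Expand it along the conjugate columns of \<open>S\<close>: a nonzero coefficient
  \<open>\<alpha> e\<close> is an eigenvector relation that forces \<open>\<psi>\<close> to be the
  character of \<open>e\<close>.\<close>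

lemma galois_column:
  assumes s: "field_embedding K \<sigma>" and SK: "\<And>a b. S $ a $ b \<in> K"
  shows "\<exists>e. \<forall>b. \<sigma> (chi b d) = chi b e"
proof -
  note D = field_embeddingD[OF s] and KD = complex_subfieldD[OF field_embeddingD(1)[OF s]]
  have chiK: "chi a b \<in> K" for a b unfolding chi_def using KD(8) SK by blast
  define \<psi> where "\<psi> a = \<sigma> (chi a d)" for a
  have fus: "fusion z S a b c \<in> K" "\<sigma> (fusion z S a b c) = fusion z S a b c" for a b c
  proof -
    obtain n where "fusion z S a b c = of_int (int n)" using verlinde[of a b c] by (auto elim!: Nats_cases)
    then show "fusion z S a b c \<in> K" "\<sigma> (fusion z S a b c) = fusion z S a b c"
      using complex_subfield_of_int[OF D(1), of "int n"] field_embedding_of_int[OF s, of "int n"] by simp_all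
  qed
  have mult: "\<psi> a * \<psi> b = (\<Sum>c\<in>UNIV. fusion z S a b c * \<psi> c)" for a b
  proof -
    have "\<sigma> (chi a d * chi b d) = (\<Sum>c\<in>UNIV. \<sigma> (fusion z S a b c * chi c d))"
      unfolding chi_mult by (rule field_embedding_sum[OF s]) (use KD(4) fus chiK in auto)
    then show ?thesis unfolding \<psi>_def using D(5) fus chiK by simp
  qed
  define \<alpha> where "\<alpha> e = (\<Sum>a\<in>UNIV. \<psi> a * cnj (S $ a $ e))" for e
  have eig: "\<psi> b * \<alpha> e = chi b e * \<alpha> e" for b e
  proof -
    have "\<psi> b * \<alpha> e = (\<Sum>a\<in>UNIV. \<Sum>c\<in>UNIV. \<psi> c * (fusion z S b a c * cnj (S $ a $ e)))"
      unfolding \<alpha>_def sum_distrib_left mult.assoc[symmetric] mult sum_distrib_right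
      by (intro sum.cong refl) (simp add: mult_ac)
    also have "\<dots> = (\<Sum>c\<in>UNIV. \<psi> c * (\<Sum>a\<in>UNIV. fusion z S b a c * cnj (S $ a $ e)))"
      by (subst sum.swap) (simp add: sum_distrib_left)
    also have "\<dots> = chi b e * \<alpha> e"
      unfolding fusion_eigen \<alpha>_def sum_distrib_left by (intro sum.cong refl) (simp add: mult_ac)
    finally show ?thesis .
  qed
  \<comment> \<open>If all coefficients vanished, the expansion would give
    \<open>\<psi> z = 0\<close>, but the character takes the value 1 at the unit
    \<open>z\<close>.\<close>
  have "\<exists>e. \<alpha> e \<noteq> 0"
  proof (rule ccontr)
    assume "\<not> ?thesis"
    then have "0 = (\<Sum>e\<in>UNIV. S $ z $ e * \<alpha> e)" by simp
    also have "\<dots> = (\<Sum>e\<in>UNIV. \<Sum>a\<in>UNIV. \<psi> a * (S $ z $ e * cnj (S $ a $ e)))"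
      unfolding \<alpha>_def sum_distrib_left by (intro sum.cong refl) (simp add: mult_ac)
    also have "\<dots> = (\<Sum>a\<in>UNIV. \<psi> a * (if z = a then 1 else 0))"
      by (subst sum.swap) (simp only: sum_distrib_left[symmetric] S_orth)
    also have "\<dots> = \<psi> z" using sum_delta_right[of \<psi> z] by (simp add: eq_commute[of z])
    also have "\<dots> = 1" by (simp add: \<psi>_def D(3))
    finally show False by simp
  qed
  then show ?thesis using eig unfolding \<psi>_def by (metis mult_right_cancel)
qed

text \<open>Characters separate columns and \<open>\<sigma>\<close> is injective, so the map on
  columns is injective on a finite set, hence a permutation. Passing from characters back to
  \<open>S\<close> costs a vacuum entry, whose conjugate is known up to sign by
  \<open>inverse_vacuum_square\<close>.\<close>

lemma galois_S:
  assumes s: "field_embedding K \<sigma>" and SK: "\<And>a b. S $ a $ b \<in> K"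
  shows "\<exists>p G. signed_perm p G \<and> map_matrix \<sigma> S = S ** G"
proof -
  note D = field_embeddingD[OF s] and KD = complex_subfieldD[OF field_embeddingD(1)[OF s]]
  have chiK: "chi a b \<in> K" for a b unfolding chi_def using KD(8) SK by blast
  obtain p where p: "\<And>b d. \<sigma> (chi b d) = chi b (p d)"
    using galois_column[OF s SK] by metis
  have "inj p"
  proof (rule injI)
    fix d e assume "p d = p e"
    then have eq: "\<sigma> (chi b d - chi b e) = 0" for b using p D(7)[OF chiK chiK] by simp
    have "chi b d = chi b e" for b
      using eq[of b] D(8)[OF KD(7)[OF chiK chiK]] by simp
    then show "d = e" by (rule column_injective)
  qed
  then have "bij p" by (simp add: bij_def finite_UNIV_inj_surj)
  have sq: "\<sigma> (S $ z $ d) * \<sigma> (S $ z $ d) = S $ z $ p d * S $ z $ p d" for d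
  proof -
    have "\<sigma> (1 / (S $ z $ d * S $ z $ d)) = (\<Sum>a\<in>UNIV. \<sigma> (chi a d * chi (Cp a) d))"
      unfolding inverse_vacuum_square[symmetric] by (rule field_embedding_sum[OF s]) (use KD(4) chiK in auto)
    also have "\<dots> = (\<Sum>a\<in>UNIV. chi a (p d) * chi (Cp a) (p d))"
      using D(5)[OF chiK chiK] p by simp
    also have "\<dots> = 1 / (S $ z $ p d * S $ z $ p d)" by (rule inverse_vacuum_square)
    finally have "1 / (\<sigma> (S $ z $ d) * \<sigma> (S $ z $ d)) = 1 / (S $ z $ p d * S $ z $ p d)"
      using D(10)[OF KD(2) KD(4)[OF SK SK]] D(5)[OF SK SK] D(3) by simp
    from arg_cong[OF this, of "\<lambda>x. 1 / x"] show ?thesis by simp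
  qed
  have "\<exists>c. (c = 1 \<or> c = - 1) \<and> \<sigma> (S $ z $ d) = c * S $ z $ p d" for d
  proof -
    have "\<sigma> (S $ z $ d) = S $ z $ p d \<or> \<sigma> (S $ z $ d) = - S $ z $ p d"
      using sq[of d] by (simp add: square_eq_iff)
    then show ?thesis by auto
  qed
  then obtain e where e: "\<And>d. e d = 1 \<or> e d = - 1" "\<And>d. \<sigma> (S $ z $ d) = e d * S $ z $ p d"
    by metis
  define G where "G = (\<chi> i d. if i = p d then e d else 0)"
  have "\<sigma> (S $ a $ d) = (S ** G) $ a $ d" for a d
  proof -
    have "\<sigma> (S $ a $ d) = \<sigma> (chi a d) * \<sigma> (S $ z $ d)"
      by (subst S_chi) (rule D(5)[OF chiK SK])
    then show ?thesis
      unfolding signed_perm_mult_right[OF G_def] p e(2) using S_chi[of a "p d"] by simp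
  qed
  then have "map_matrix \<sigma> S = S ** G" by (simp add: vec_eq_iff map_matrix_def)
  moreover have "signed_perm p G"
    unfolding signed_perm_def using \<open>bij p\<close> e(1) G_def by blast
  ultimately show ?thesis by blast
qed

section \<open>Existence and composition of the Galois matrices\<close>

lemma N_pos: "N > 0" using odd_N by (simp add: odd_pos)

definition zeta :: complex where "zeta = cis (2 * pi / real N)"

lemma zeta_pow_N: "zeta ^ N = 1"
proof -
  have "zeta ^ N = cis (real N * (2 * pi / real N))" unfolding zeta_def by (rule Complex.DeMoivre)
  then show ?thesis using N_pos by simp
qed

lemma zeta_nonzero: "zeta \<noteq> 0"
  by (simp add: zeta_def)

text \<open>The embedding is hidden existentially, because its effect on \<open>zeta\<close> need
  not determine it on the entries of \<open>S\<close>. That the matrix depends on \<open>k\<close>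
  alone is the content of \<open>gal_unique\<close>.\<close>

definition gal :: "int \<Rightarrow> complex^'a^'a \<Rightarrow> bool" where
  "gal k G \<longleftrightarrow> (\<exists>K \<sigma> p. field_embedding K \<sigma> \<and> zeta \<in> K \<and> \<sigma> zeta = zeta powi k \<and>
     (\<forall>a b. S $ a $ b \<in> K) \<and> signed_perm p G \<and> map_matrix \<sigma> S = S ** G)"

lemma zeta_powi_cong: "[k = l] (mod int N) \<Longrightarrow> zeta powi k = zeta powi l"
proof -
  assume "[k = l] (mod int N)"
  then obtain j where j: "l = k + int N * j" by (auto simp: cong_iff_lin)
  have "zeta powi (int N * j) = (zeta powi int N) powi j" by (simp add: power_int_mult)
  also have "\<dots> = 1" by (simp add: zeta_pow_N)
  finally show ?thesis unfolding j using zeta_nonzero by (simp add: power_int_add)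
qed

lemma gal_cong: "[k = l] (mod int N) \<Longrightarrow> gal k G \<Longrightarrow> gal l G"
  unfolding gal_def using zeta_powi_cong by metis

text \<open>The embedding is built along a tower: first the cyclotomic field, then the finitely many
  characters, finally the vacuum entries. The last two together contain all entries of
  \<open>S\<close>.\<close>

lemma gal_prime:
  assumes "prime q" "\<not> q dvd N"
  shows "\<exists>G. gal (int q) G"
proof -
  obtain K0 \<sigma>0 where 0: "field_embedding K0 \<sigma>0" "zeta \<in> K0" "\<sigma>0 zeta = zeta ^ q"
    using cyclotomic_embedding[OF N_pos zeta_pow_N assms] by blast
  define X where "X = range (\<lambda>(a, d). chi a d)"
  have "finite X" by (simp add: X_def)
  moreover have "\<And>x. x \<in> X \<Longrightarrow> algebraic_over K0 x"
    using chi_algebraic[OF field_embeddingD(1)[OF 0(1)]] by (auto simp: X_def)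
  ultimately obtain K1 \<sigma>1 where 1: "field_embedding K1 \<sigma>1" "K0 \<subseteq> K1" "\<forall>u\<in>K0. \<sigma>1 u = \<sigma>0 u" "X \<subseteq> K1"
    using embedding_extends_finite[OF _ 0(1)] by metis
  note KD = complex_subfieldD[OF field_embeddingD(1)[OF 1(1)]]
  have chi1: "chi a d \<in> K1" for a d using 1(4) by (auto simp: X_def)
  define Y where "Y = range (\<lambda>d. S $ z $ d)"
  have "algebraic_over K1 (S $ z $ d)" for d
  proof -
    \<comment> \<open>The double reciprocal exposes the sum of products of characters in
      \<open>inverse_vacuum_square\<close>, so \<open>S $ z $ d\<close> is a square root of an
      element of \<open>K1\<close>.\<close>
    have "1 / (1 / (S $ z $ d * S $ z $ d)) \<in> K1"
      unfolding inverse_vacuum_square[symmetric]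
      by (intro KD(2,4,8) complex_subfield_sum[OF field_embeddingD(1)[OF 1(1)]] chi1)
    then have "S $ z $ d * S $ z $ d \<in> K1" by simp
    then have "[:- (S $ z $ d * S $ z $ d), 0, 1:] \<in> polys_over K1"
      by (intro polys_over_closed(1,9)[OF field_embeddingD(1)[OF 1(1)]] KD(1,2) KD(5))
    then show ?thesis unfolding algebraic_over_def
      by (intro bexI[of _ "[:- (S $ z $ d * S $ z $ d), 0, 1:]"]) auto
  qed
  then have "\<And>x. x \<in> Y \<Longrightarrow> algebraic_over K1 x" by (auto simp: Y_def)
  moreover have "finite Y" by (simp add: Y_def)
  ultimately obtain K2 \<sigma>2 where 2: "field_embedding K2 \<sigma>2" "K1 \<subseteq> K2" "\<forall>u\<in>K1. \<sigma>2 u = \<sigma>1 u" "Y \<subseteq> K2"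
    using embedding_extends_finite[OF _ 1(1)] by metis
  have S2: "S $ a $ d \<in> K2" for a d
  proof -
    have "chi a d \<in> K2" "S $ z $ d \<in> K2" using chi1 2(2,4) by (auto simp: Y_def)
    then show ?thesis
      by (subst S_chi) (rule complex_subfieldD(4)[OF field_embeddingD(1)[OF 2(1)]])
  qed
  obtain p G where "signed_perm p G" "map_matrix \<sigma>2 S = S ** G" using galois_S[OF 2(1) S2] by blast
  moreover have "zeta \<in> K2" "\<sigma>2 zeta = zeta powi int q" using 0 1 2 by (auto simp: subset_iff)
  ultimately show ?thesis unfolding gal_def using 2(1) S2 by blast
qed

lemma gal_1: "gal 1 (mat 1)"
proof -
  have "field_embedding UNIV (\<lambda>x. x)" by (simp add: field_embedding_def complex_subfield_def)
  moreover have "signed_perm (\<lambda>x. x) (mat 1 :: complex^'a^'a)"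
    unfolding signed_perm_def by (auto simp: mat_def bij_id[unfolded id_def] intro!: exI[of _ "\<lambda>_. 1"])
  ultimately show ?thesis unfolding gal_def
    by (intro exI[of _ UNIV] exI[of _ "\<lambda>x. x"] exI[of _ "\<lambda>x. x"]) (simp add: map_matrix_def vec_eq_iff)
qed

lemma signed_perm_C: "signed_perm (inv Cp) C"
proof -
  have "bij (inv Cp)" using Cp(1) by (rule bij_imp_bij_inv)
  moreover have "C = (\<chi> i d. if i = inv Cp d then 1 else 0)"
    unfolding Cp(3) using Cp(1) by (auto simp: vec_eq_iff bij_inv_eq_iff)
  ultimately show ?thesis unfolding signed_perm_def by (intro conjI exI[of _ "\<lambda>_. 1"]) auto
qed

text \<open>Realized by complex conjugation, which inverts \<open>zeta\<close> and turns
  \<open>S\<close> into its inverse.\<close>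

lemma gal_minus_1: "gal (- 1) C"
proof -
  have "field_embedding UNIV cnj" by (simp add: field_embedding_def complex_subfield_def)
  moreover have "map_matrix cnj S = S ** C"
    unfolding C_S by (simp add: map_matrix_def vec_eq_iff Si_nth(1))
  moreover have "cnj zeta = zeta powi (- 1)"
    by (simp add: zeta_def cis_cnj cis_inverse)
  ultimately show ?thesis unfolding gal_def using signed_perm_C by blast
qed

text \<open>The image of \<open>\<sigma>\<close> need not lie in the domain of
  \<open>\<tau>\<close>, so the composite is restricted to the preimage \<open>M\<close>. It
  contains \<open>zeta\<close> and the entries of \<open>S\<close>, whose images are a power of
  \<open>zeta\<close> and entries of \<open>S ** G\<close>. As \<open>\<tau>\<close> fixes
  \<open>G\<close>, the new matrix lands on the left.\<close>

lemma gal_mult: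
  assumes "gal k G" "gal l H"
  shows "gal (k * l) (H ** G)"
proof -
  obtain K \<sigma> p where 1: "field_embedding K \<sigma>" "zeta \<in> K" "\<sigma> zeta = zeta powi k"
    "\<And>a b. S $ a $ b \<in> K" "signed_perm p G" "map_matrix \<sigma> S = S ** G"
    using assms(1) unfolding gal_def by blast
  obtain L \<tau> q where 2: "field_embedding L \<tau>" "zeta \<in> L" "\<tau> zeta = zeta powi l"
    "\<And>a b. S $ a $ b \<in> L" "signed_perm q H" "map_matrix \<tau> S = S ** H"
    using assms(2) unfolding gal_def by blast
  note D1 = field_embeddingD[OF 1(1)] and KD = complex_subfieldD[OF field_embeddingD(1)[OF 1(1)]]
  note D2 = field_embeddingD[OF 2(1)] and LD = complex_subfieldD[OF field_embeddingD(1)[OF 2(1)]]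
  define M where "M = {x \<in> K. \<sigma> x \<in> L}"
  have emb: "field_embedding M (\<tau> \<circ> \<sigma>)"
    unfolding field_embedding_def complex_subfield_def
    by (auto simp: M_def KD LD D1 D2)
  have pw: "x powi j \<in> L \<and> \<tau> (x powi j) = \<tau> x powi j" if "x \<in> L" for x j
    using field_embedding_power[OF 2(1) that] LD D2 by (auto simp: power_int_def power_inverse[symmetric] LD D2)
      (simp_all add: power_inverse LD D2)
  have "zeta \<in> M" using 1 2 pw by (auto simp: M_def)
  moreover have "(\<tau> \<circ> \<sigma>) zeta = zeta powi (k * l)"
    using 1(3) 2(3) pw[OF 2(2), of k] by (simp add: power_int_mult mult.commute[of k])
  moreover have SG: "(S ** G) $ a $ b \<in> L" for a b
  proof -
    have "(S ** G) $ a $ b = (\<Sum>c\<in>UNIV. S $ a $ c * G $ c $ b)" by (rule matrix_mult_nth)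
    also have "\<dots> \<in> L"
      by (intro complex_subfield_sum[OF D2(1)] LD(4) 2(4) map_matrix_signed_perm(1)[OF 2(1) 1(5)])
    finally show ?thesis .
  qed
  moreover have S1: "\<sigma> (S $ a $ b) = (S ** G) $ a $ b" for a b
    using arg_cong[OF 1(6), of "\<lambda>A. A $ a $ b"] by (simp add: map_matrix_def)
  ultimately have "S $ a $ b \<in> M" for a b using 1(4) by (simp add: M_def)
  moreover have "map_matrix (\<tau> \<circ> \<sigma>) S = map_matrix \<tau> (S ** G)"
    by (simp add: map_matrix_def vec_eq_iff S1)
  then have "map_matrix (\<tau> \<circ> \<sigma>) S = S ** (H ** G)"
    unfolding field_embedding_matrix_mult[OF 2(1) 2(4) map_matrix_signed_perm(1)[OF 2(1) 1(5)]]
      2(6) map_matrix_signed_perm(2)[OF 2(1) 1(5)] by (simp add: matrix_mul_assoc)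
  ultimately show ?thesis
    unfolding gal_def using emb \<open>zeta \<in> M\<close> \<open>(\<tau> \<circ> \<sigma>) zeta = _\<close> signed_perm_mult[OF 2(5) 1(5)] by blast
qed

lemma gal_nat: "coprime n N \<Longrightarrow> n > 0 \<Longrightarrow> \<exists>G. gal (int n) G"
proof (induction n rule: less_induct)
  case (less n)
  show ?case
  proof (cases "n = 1")
    case True
    then show ?thesis using gal_1 by auto
  next
    case False
    then obtain q where q: "prime q" "q dvd n" using prime_factor_nat by blast
    then obtain m where m: "n = q * m" by (elim dvdE)
    have "m > 0" "m < n" using less(3) m prime_gt_1_nat[OF q(1)] by auto
    moreover have "coprime m N" using less(2) m by simp
    ultimately obtain G where G: "gal (int m) G" using less(1) by blast
    have "\<not> q dvd N"
      using less(2) q by (meson coprime_common_divisor not_prime_unit)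
    then obtain H where H: "gal (int q) H" using gal_prime[OF q(1)] by blast
    show ?thesis using gal_mult[OF H G] m by auto
  qed
qed

lemma gal_exists: "coprime k (int N) \<Longrightarrow> \<exists>G. gal k G"
proof -
  assume k: "coprime k (int N)"
  \<comment> \<open>Adding \<open>N\<close> makes the representative positive, also when
    \<open>N = 1\<close> and the remainder is 0.\<close>
  define n where "n = nat (k mod int N) + N"
  have n: "int n = k mod int N + int N" using N_pos by (simp add: n_def)
  have c: "[int n = k] (mod int N)" unfolding n by (simp add: cong_def)
  then have "coprime (int n) (int N)" using k by (metis cong_imp_coprime cong_sym)
  then have "coprime n N" by simp
  then obtain G where "gal (int n) G" using gal_nat[of n] N_pos by (auto simp: n_def)
  then show ?thesis using gal_cong[OF c] by blast
qed

end

section \<open>Residues modulo N\<close>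

text \<open>Residues modulo \<open>N\<close> are represented by rational numbers with denominator prime to \<open>N\<close>, so that
  inverses of units are honest quotients.\<close>
locale localization =
  fixes N :: nat
  assumes N_positive: "N > 0"
begin

definition loc :: "rat set" where
  "loc = {of_int a / of_int b | a b. b \<noteq> 0 \<and> coprime b (int N)}"

definition lcong :: "rat \<Rightarrow> rat \<Rightarrow> bool" where
  "lcong q r \<longleftrightarrow> (\<exists>s\<in>loc. q - r = of_nat N * s)"

text \<open>Being nonzero is demanded explicitly: in HOL \<open>1 / 0\<close> is 0 and lies in
  \<open>loc\<close>. For \<open>N = 1\<close> a coprime residue does not exclude the rational 0,
  and this explains the nonvanishing side conditions below.\<close>

definition units :: "rat set" where
  "units = {q. q \<noteq> 0 \<and> q \<in> loc \<and> 1 / q \<in> loc}"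

text \<open>An arbitrary integer in the class of \<open>q\<close>, not a reduced one; only its class
  modulo \<open>N\<close> is meaningful, so all its properties are congruences.\<close>

definition res :: "rat \<Rightarrow> int" where
  "res q = (SOME k. lcong q (of_int k))"

lemma loc_of_int [simp]: "of_int k \<in> loc"
  unfolding loc_def by (intro CollectI exI[of _ k] exI[of _ 1]) simp

lemma loc_numeral [simp]: "0 \<in> loc" "1 \<in> loc" "numeral n \<in> loc" "of_nat m \<in> loc"
  using loc_of_int[of 0] loc_of_int[of 1] loc_of_int[of "numeral n"] loc_of_int[of "int m"] by simp_all

lemma loc_add [intro]: assumes "q \<in> loc" "r \<in> loc" shows "q + r \<in> loc"
proof -
  obtain a b c d where "q = of_int a / of_int b" "b \<noteq> 0" "coprime b (int N)"
    "r = of_int c / of_int d" "d \<noteq> 0" "coprime d (int N)"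
    using assms unfolding loc_def by blast
  then show ?thesis unfolding loc_def
    by (intro CollectI exI[of _ "a * d + c * b"] exI[of _ "b * d"]) (simp add: field_simps)
qed

lemma loc_mult [intro]: assumes "q \<in> loc" "r \<in> loc" shows "q * r \<in> loc"
proof -
  obtain a b c d where "q = of_int a / of_int b" "b \<noteq> 0" "coprime b (int N)"
    "r = of_int c / of_int d" "d \<noteq> 0" "coprime d (int N)"
    using assms unfolding loc_def by blast
  then show ?thesis unfolding loc_def
    by (intro CollectI exI[of _ "a * c"] exI[of _ "b * d"]) (simp add: field_simps)
qed

lemma loc_minus [intro]: "q \<in> loc \<Longrightarrow> - q \<in> loc"
  using loc_mult[OF loc_of_int[of "- 1"]] by simp

lemma loc_diff [intro]: "q \<in> loc \<Longrightarrow> r \<in> loc \<Longrightarrow> q - r \<in> loc"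
  using loc_add[of q "- r"] loc_minus[of r] by simp

lemma loc_power [intro]: "q \<in> loc \<Longrightarrow> q ^ n \<in> loc"
  by (induction n) auto

lemma lcong_refl [simp]: "lcong q q"
  unfolding lcong_def by (intro bexI[of _ 0]) simp_all

lemma lcong_sym: "lcong q r \<Longrightarrow> lcong r q"
  unfolding lcong_def using loc_minus by (metis minus_diff_eq mult_minus_right)

lemma lcong_add: "lcong a b \<Longrightarrow> lcong c d \<Longrightarrow> lcong (a + c) (b + d)"
  unfolding lcong_def by (metis add_diff_add distrib_left loc_add)

lemma lcong_scale: "q \<in> loc \<Longrightarrow> lcong a b \<Longrightarrow> lcong (q * a) (q * b)"
  unfolding lcong_def by (metis loc_mult mult.left_commute right_diff_distrib)

lemma lcong_trans: "lcong a b \<Longrightarrow> lcong b c \<Longrightarrow> lcong a c"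
  using lcong_add[of a b b c] unfolding lcong_def by (simp add: algebra_simps)

lemma lcong_minus: "lcong a b \<Longrightarrow> lcong (- a) (- b)"
  using lcong_scale[OF loc_of_int[of "- 1"]] by simp

lemma lcong_diff: "lcong a b \<Longrightarrow> lcong c d \<Longrightarrow> lcong (a - c) (b - d)"
  using lcong_add[of a b "- c" "- d"] lcong_minus by simp

lemma lcong_mult: "a \<in> loc \<Longrightarrow> d \<in> loc \<Longrightarrow> lcong a b \<Longrightarrow> lcong c d \<Longrightarrow> lcong (a * c) (b * d)"
  by (metis lcong_scale lcong_trans mult.commute)

lemma lcong_iff_0: "lcong a b \<longleftrightarrow> lcong (a - b) 0"
  by (simp add: lcong_def)

lemma lcong_of_int: "lcong (of_int k) (of_int l) \<longleftrightarrow> [k = l] (mod int N)"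
proof
  assume "lcong (of_int k) (of_int l)"
  then obtain a b where ab: "b \<noteq> 0" "coprime b (int N)" "of_int k - of_int l = (of_nat N * (of_int a / of_int b) :: rat)"
    unfolding lcong_def loc_def by blast
  then have "of_int (b * (k - l)) = (of_int (int N * a) :: rat)" by (simp add: field_simps)
  then have "int N dvd b * (k - l)" by (metis dvd_triv_left of_int_eq_iff)
  then have "int N dvd k - l" using ab(2) by (simp add: coprime_commute coprime_dvd_mult_right_iff)
  then show "[k = l] (mod int N)" by (simp add: cong_iff_dvd_diff)
next
  assume "[k = l] (mod int N)"
  then obtain j where "k - l = int N * j" by (auto simp: cong_iff_dvd_diff elim: dvdE)
  then have "of_int (k - l) = (of_int (int N * j) :: rat)" by (rule arg_cong)
  then have "of_int k - of_int l = (of_nat N * of_int j :: rat)" by simp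
  then show "lcong (of_int k) (of_int l)" unfolding lcong_def by (intro bexI[of _ "of_int j"]) simp_all
qed

lemma lcong_res: assumes "q \<in> loc" shows "lcong q (of_int (res q))"
proof -
  obtain a b where q: "q = of_int a / of_int b" "b \<noteq> 0" "coprime b (int N)"
    using assms unfolding loc_def by blast
  obtain c where "[b * c = 1] (mod int N)" using q(3) cong_solve_coprime_int by blast
  then have "lcong (of_int (b * c)) (of_int 1)" by (simp only: lcong_of_int)
  then have "lcong (q * of_int (b * c)) (q * of_int 1)" by (rule lcong_scale[OF assms])
  moreover have "q * of_int (b * c) = of_int (a * c)" "q * of_int 1 = q" using q by simp_all
  ultimately have "lcong q (of_int (a * c))" by (metis lcong_sym)
  then show ?thesis unfolding res_def by (rule someI)
qed

lemma res_cong: "q \<in> loc \<Longrightarrow> r \<in> loc \<Longrightarrow> lcong q r \<longleftrightarrow> [res q = res r] (mod int N)"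
  using lcong_res lcong_sym lcong_trans lcong_of_int by metis

lemma res_add: "q \<in> loc \<Longrightarrow> r \<in> loc \<Longrightarrow> [res (q + r) = res q + res r] (mod int N)"
  unfolding lcong_of_int[symmetric] of_int_add
  using lcong_trans[OF lcong_sym[OF lcong_res[OF loc_add]]] lcong_add[OF lcong_res lcong_res] by blast

lemma res_mult: "q \<in> loc \<Longrightarrow> r \<in> loc \<Longrightarrow> [res (q * r) = res q * res r] (mod int N)"
  unfolding lcong_of_int[symmetric] of_int_mult
  using lcong_trans[OF lcong_sym[OF lcong_res[OF loc_mult]]] lcong_mult[OF _ loc_of_int lcong_res lcong_res] by blast

lemma res_of_int: "[res (of_int k) = k] (mod int N)"
  unfolding lcong_of_int[symmetric] by (rule lcong_sym[OF lcong_res]) simp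

lemma unitsD: assumes "x \<in> units" shows "x \<noteq> 0" "x \<in> loc" "1 / x \<in> loc" "q \<in> loc \<Longrightarrow> q / x \<in> loc"
  using assms loc_mult[of q "1 / x"] by (auto simp: units_def)

lemma units_mult [intro]: "x \<in> units \<Longrightarrow> y \<in> units \<Longrightarrow> x * y \<in> units"
  using loc_mult[of x y] loc_mult[of "1 / x" "1 / y"] by (simp add: units_def)

lemma units_inverse [intro]: "x \<in> units \<Longrightarrow> 1 / x \<in> units"
  by (simp add: units_def)

lemma units_divide [intro]: "x \<in> units \<Longrightarrow> y \<in> units \<Longrightarrow> x / y \<in> units"
  using units_mult[of x "1 / y"] by (simp add: units_inverse)

lemma units_minus [intro]: "x \<in> units \<Longrightarrow> - x \<in> units"
  using loc_minus[of x] loc_minus[of "1 / x"] by (simp add: units_def)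

lemma units_1 [simp]: "1 \<in> units" "- 1 \<in> units"
  using units_minus[of 1] by (simp_all add: units_def)

lemma coprime_res: assumes "x \<in> units" shows "coprime (res x) (int N)"
proof -
  have "[res (x * (1 / x)) = res x * res (1 / x)] (mod int N)"
    using assms by (intro res_mult) (auto simp: units_def)
  moreover have "x * (1 / x) = of_int 1" using assms by (simp add: units_def)
  ultimately have "[res x * res (1 / x) = 1] (mod int N)"
    using res_of_int[of 1] by (metis cong_sym cong_trans)
  then show ?thesis using coprime_iff_invertible_int by blast
qed

lemma units_of_int: "of_int k \<in> units \<longleftrightarrow> k \<noteq> 0 \<and> coprime k (int N)"
proof
  assume k: "of_int k \<in> units"
  have "coprime (res (of_int k)) (int N)" using k by (rule coprime_res)
  then have "coprime k (int N)" using res_of_int[of k] cong_imp_coprime by blast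
  then show "k \<noteq> 0 \<and> coprime k (int N)" using k by (auto simp: units_def)
next
  assume k: "k \<noteq> 0 \<and> coprime k (int N)"
  then have "1 / of_int k \<in> loc"
    unfolding loc_def by (intro CollectI exI[of _ 1] exI[of _ k]) simp
  then show "of_int k \<in> units" using k by (simp add: units_def)
qed

lemma units_representative:
  assumes "x \<in> units"
  obtains k where "k > 0" "coprime k (int N)" "lcong x (of_int k)"
proof
  let ?k = "res x mod int N + int N"
  show "?k > 0" using N_positive by (simp add: add_nonneg_pos)
  have c: "[?k = res x] (mod int N)" by (simp add: cong_def)
  then show "coprime ?k (int N)" using coprime_res[OF assms] by (metis cong_imp_coprime cong_sym)
  show "lcong x (of_int ?k)" using lcong_trans[OF lcong_res] c assms lcong_of_int cong_sym unitsD(2) by metis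
qed

lemma loc_lcong_unit: assumes "x \<in> units" "lcong x y" "y \<in> loc" "y \<noteq> 0" shows "y \<in> units"
proof -
  obtain a b where y: "y = of_int a / of_int b" "b \<noteq> 0" "coprime b (int N)"
    using assms(3) unfolding loc_def by blast
  have a0: "a \<noteq> 0" using y assms(4) by auto
  have "[res y = res x] (mod int N)" using assms unitsD(2) by (metis res_cong lcong_sym)
  then have ry: "coprime (res y) (int N)" using coprime_res[OF assms(1)] by (metis cong_imp_coprime cong_sym)
  have "of_int b * y = of_int a" using y by simp
  then have "[res (of_int a) = res (of_int b) * res y] (mod int N)"
    using res_mult[OF loc_of_int[of b] assms(3)] by simp
  then have "[a = b * res y] (mod int N)"
    by (meson cong_mult cong_refl cong_sym cong_trans res_of_int)
  then have "coprime a (int N)" using ry y(3) by (metis cong_imp_coprime cong_sym coprime_mult_left_iff)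
  then have "1 / y \<in> loc" unfolding loc_def y(1) using a0 by (intro CollectI exI[of _ b] exI[of _ a]) auto
  then show ?thesis using assms by (simp add: units_def)
qed

end

section \<open>Integers with prescribed residues at the primes dividing \<open>N\<close>\<close>

lemma prime_moduli_coprime:
  assumes "prime p" "prime q" "p \<noteq> (q::nat)"
  shows "coprime (if p = 3 then 9 else p) (if q = 3 then 9 else q)"
proof -
  have *: "coprime p q" using assms primes_coprime by blast
  have "coprime (3 * 3) q" if "p = 3" using * that by (metis coprime_mult_left_iff)
  moreover have "coprime p (3 * 3)" if "q = 3" using * that by (metis coprime_mult_right_iff)
  ultimately show ?thesis using * assms(3) by auto
qed

text \<open>The prime 3 receives the modulus 9, whether or not 9 divides \<open>N\<close>, because
  the vanishing of the constants is decided by classes modulo 9.\<close>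

lemma simultaneous_residues:
  fixes r :: "nat \<Rightarrow> int"
  assumes "N > (0::nat)"
  obtains w :: int where "\<And>p. prime p \<Longrightarrow> p dvd N \<Longrightarrow> [w = r p] (mod int (if p = 3 then 9 else p))"
proof -
  let ?m = "\<lambda>p::nat. if p = 3 then 9 else p"
  have "finite {p. prime p \<and> p dvd N}" using assms by (intro finite_subset[OF _ finite_divisors_nat[of N]]) auto
  then obtain x where x: "\<forall>p\<in>{p. prime p \<and> p dvd N}. [x = nat (r p mod int (?m p))] (mod ?m p)"
    using chinese_remainder_nat[of "{p. prime p \<and> p dvd N}" ?m "\<lambda>p. nat (r p mod int (?m p))"] prime_moduli_coprime
    by auto
  have "[int x = r p] (mod int (?m p))" if "prime p" "p dvd N" for p
  proof -
    have m0: "?m p > 0" using prime_gt_0_nat[OF that(1)] by simp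
    have "[int x = int (nat (r p mod int (?m p)))] (mod int (?m p))"
      using x that cong_int_iff by blast
    also have "int (nat (r p mod int (?m p))) = r p mod int (?m p)"
      using m0 by (metis nat_0_le of_nat_0_less_iff pos_mod_sign)
    also have "[\<dots> = r p] (mod int (?m p))" by simp
    finally show ?thesis .
  qed
  then show ?thesis using that by blast
qed

lemma coprime_int_iff_prime:
  assumes "N > (0::nat)"
  shows "coprime k (int N) \<longleftrightarrow> (\<forall>p. prime p \<longrightarrow> p dvd N \<longrightarrow> \<not> int p dvd k)"
proof
  assume "coprime k (int N)"
  then show "\<forall>p. prime p \<longrightarrow> p dvd N \<longrightarrow> \<not> int p dvd k"
    by (metis coprime_common_divisor int_dvd_int_iff not_prime_unit prime_nat_int_transfer)
next
  assume *: "\<forall>p. prime p \<longrightarrow> p dvd N \<longrightarrow> \<not> int p dvd k"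
  show "coprime k (int N)"
  proof (rule ccontr)
    assume "\<not> coprime k (int N)"
    then have "\<bar>gcd k (int N)\<bar> \<noteq> 1" by (simp add: coprime_iff_gcd_eq_1)
    then obtain p where p: "prime p" "p dvd gcd k (int N)" using prime_factor_int by blast
    obtain n where n: "p = int n" using prime_ge_0_int[OF p(1)] nonneg_int_cases by blast
    have "int n dvd k" "int n dvd int N" using p(2) n by simp_all
    moreover have "prime n" using p(1) n by simp
    ultimately show False using * by (metis int_dvd_int_iff)
  qed
qed

section \<open>The Galois relation\<close>

lemma signed_perm_transpose:
  assumes "signed_perm p G"
  shows "signed_perm (inv p) (transpose G)"
proof -
  obtain e where e: "bij p" "\<And>d. e d = 1 \<or> e d = - 1" "G = (\<chi> i d. if i = p d then e d else 0)"
    using assms unfolding signed_perm_def by blast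
  have "transpose G $ i $ d = (if i = inv p d then e (inv p d) else 0)" for i d
  proof -
    have iff: "d = p i \<longleftrightarrow> i = inv p d" using bij_inv_eq_iff[OF e(1), of i d] by auto
    have "transpose G $ i $ d = (if d = p i then e i else 0)" by (simp add: e(3) transpose_def)
    also have "\<dots> = (if i = inv p d then e (inv p d) else 0)" unfolding iff by simp
    finally show ?thesis .
  qed
  then have "transpose G = (\<chi> i d. if i = inv p d then e (inv p d) else 0)"
    by (simp add: vec_eq_iff)
  then show ?thesis
    unfolding signed_perm_def using e(2) bij_imp_bij_inv[OF e(1)]
    by (intro conjI exI[of _ "\<lambda>d. e (inv p d)"] allI) simp_all
qed

lemma matrix_pow_diag:
  fixes f :: "'a::finite \<Rightarrow> complex"
  shows "matrix_pow (diag_matrix f) n = diag_matrix (\<lambda>e. f e ^ n)"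
proof (induction n)
  case 0
  then show ?case by (simp add: matrix_pow_def diag_matrix_1)
next
  case (Suc n)
  then show ?case by (simp add: matrix_pow_def diag_matrix_mult)
qed

context odd_level_data
begin

sublocale localization N
  by unfold_locales (rule N_pos)

lemma zeta_powi_eq_1_iff: "zeta powi k = 1 \<longleftrightarrow> [k = 0] (mod int N)"
proof
  assume z1: "zeta powi k = 1"
  define m where "m = nat (k mod int N)"
  have m: "int m = k mod int N" "m < N" using N_pos by (simp_all add: m_def nat_less_iff)
  have "zeta powi (int m) = zeta powi k" by (rule zeta_powi_cong) (simp add: m cong_def)
  then have "zeta ^ m = 1" using z1 by simp
  then have "cis (2 * pi * real m / real N) = 1"
    by (simp add: zeta_def Complex.DeMoivre mult.commute)
  then have "cis (2 * pi * real m / real N) = cis (2 * pi * real 0 / real N)" by simp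
  then have "m = 0"
    using Complex.bij_betw_roots_unity[OF N_pos] m(2) N_pos unfolding bij_betw_def inj_on_def
    by (metis lessThan_iff)
  then show "[k = 0] (mod int N)" using m by (simp add: cong_def)
next
  assume "[k = 0] (mod int N)"
  then show "zeta powi k = 1" using zeta_powi_cong[of k 0] by simp
qed

definition zpow :: "rat \<Rightarrow> complex" where "zpow q = zeta powi res q"

lemma zpow_cong: "q \<in> loc \<Longrightarrow> r \<in> loc \<Longrightarrow> lcong q r \<Longrightarrow> zpow q = zpow r"
  unfolding zpow_def using res_cong zeta_powi_cong by blast

lemma zpow_add: "q \<in> loc \<Longrightarrow> r \<in> loc \<Longrightarrow> zpow (q + r) = zpow q * zpow r"
  unfolding zpow_def using zeta_powi_cong[OF res_add] zeta_nonzero by (simp add: power_int_add)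

lemma zpow_of_int: "zpow (of_int k) = zeta powi k"
  unfolding zpow_def by (rule zeta_powi_cong[OF res_of_int])

lemma zpow_0 [simp]: "zpow 0 = 1"
  using zpow_of_int[of 0] by simp

lemma zpow_nonzero [simp]: "zpow q \<noteq> 0"
  using zeta_nonzero by (simp add: zpow_def)

lemma zpow_minus: "q \<in> loc \<Longrightarrow> zpow (- q) = inverse (zpow q)"
  using zpow_add[of q "- q"] loc_minus[of q] by (simp add: inverse_unique)

lemma zpow_diff: "q \<in> loc \<Longrightarrow> r \<in> loc \<Longrightarrow> zpow (q - r) = zpow q / zpow r"
  using zpow_add[of q "- r"] zpow_minus[of r] by (simp add: loc_minus divide_inverse)

lemma zpow_pow_N: "zpow q ^ N = 1"
proof -
  have "zpow q ^ N = (zeta powi int N) powi res q"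
    by (simp add: zpow_def power_int_power power_int_power' mult.commute)
  then show ?thesis by (simp add: zeta_pow_N)
qed

lemma zpow_eq_iff: assumes "q \<in> loc" "r \<in> loc" shows "zpow q = zpow r \<longleftrightarrow> lcong q r"
proof
  assume "zpow q = zpow r"
  then have "zpow (q - r) = 1" using assms by (simp add: zpow_diff)
  then have "[res (q - r) = 0] (mod int N)" by (simp add: zpow_def zeta_powi_eq_1_iff)
  then have "lcong (of_int (res (q - r))) (of_int 0)" by (simp only: lcong_of_int)
  then have "lcong (q - r) (of_int 0)" using lcong_trans lcong_res[OF loc_diff[OF assms]] by blast
  then show "lcong q r" using lcong_iff_0 by simp
qed (use assms zpow_cong in blast)

definition D :: "('a \<Rightarrow> rat) \<Rightarrow> complex^'a^'a" where
  "D f = diag_matrix (\<lambda>e. zpow (f e))"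

lemma D_nth [simp]: "D f $ i $ j = (if i = j then zpow (f i) else 0)"
  "(D f ** A) $ i $ j = zpow (f i) * A $ i $ j" "(A ** D f) $ i $ j = A $ i $ j * zpow (f j)"
  by (simp_all add: D_def)

lemma D_mult: "(\<And>e. f e \<in> loc) \<Longrightarrow> (\<And>e. g e \<in> loc) \<Longrightarrow> D f ** D g = D (\<lambda>e. f e + g e)"
  by (simp add: D_def diag_matrix_mult zpow_add)

lemma D_cong: "(\<And>e. f e \<in> loc) \<Longrightarrow> (\<And>e. g e \<in> loc) \<Longrightarrow> (\<And>e. lcong (f e) (g e)) \<Longrightarrow> D f = D g"
  by (simp add: vec_eq_iff zpow_cong)

lemma D_0 [simp]: "D (\<lambda>_. 0) = mat 1"
  by (simp add: D_def diag_matrix_1)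

text \<open>The exponent is chosen from the value \<open>T $ e $ e\<close> alone. Equal eigenvalues
  thus get literally equal exponents, which yields equalities instead of congruences when charge
  conjugation acts.\<close>

definition t :: "'a \<Rightarrow> rat" where "t e = of_nat (SOME k. T $ e $ e = zeta ^ k)"

lemma T_diag: "T = diag_matrix (\<lambda>e. T $ e $ e)"
  using T_diagonal by (auto simp: vec_eq_iff)

lemma T_zeta: "\<exists>k. T $ e $ e = zeta ^ k"
proof -
  have "matrix_pow T N = diag_matrix (\<lambda>e. T $ e $ e ^ N)"
    by (subst T_diag) (rule matrix_pow_diag)
  then have "diag_matrix (\<lambda>e. T $ e $ e ^ N) $ e $ e = (mat 1 :: complex^'a^'a) $ e $ e"
    using T_pow_N by simp
  then have "T $ e $ e ^ N = 1" by (simp add: mat_def)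
  then obtain k where "T $ e $ e = cis (2 * pi * real k / real N)"
    using Complex.bij_betw_roots_unity[OF N_pos] unfolding bij_betw_def by blast
  then have "T $ e $ e = zeta ^ k" by (simp add: zeta_def Complex.DeMoivre mult.commute)
  then show ?thesis by blast
qed

lemma t_nat: obtains n where "t e = of_nat n" "T $ e $ e = zeta ^ n"
  using someI_ex[OF T_zeta] unfolding t_def by blast

lemma t_loc [simp]: "t e \<in> loc"
  by (simp add: t_def)

lemma T_zpow: "T $ e $ e = zpow (t e)"
proof -
  obtain n where "t e = of_int (int n)" "T $ e $ e = zeta powi int n" using t_nat[of e] by auto
  then show ?thesis using zpow_of_int by metis
qed

lemma T_D: "T = D t"
  using T_diagonal by (auto simp: vec_eq_iff T_zpow)

lemma t_eqI: "T $ a $ a = T $ b $ b \<Longrightarrow> t a = t b"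
  by (simp add: t_def)

lemma STS: "S ** T ** S = D (\<lambda>e. - t e) ** Si ** D (\<lambda>e. - t e)"
proof -
  let ?U = "D (\<lambda>e. - t e)"
  have "D t ** ?U = mat 1" "?U ** D t = mat 1" by (simp_all add: D_mult loc_minus)
  then have TU: "T ** ?U = mat 1" "?U ** T = mat 1" by (simp_all only: T_D[symmetric])
  have 1: "(S ** T ** S) ** (T ** S ** T) = mat 1"
    using ST_cubed by (simp add: matrix_pow_def numeral_3_eq_3 matrix_mul_assoc)
  have "(T ** S ** T) ** (?U ** Si ** ?U) = T ** S ** (T ** ?U) ** Si ** ?U" by (simp only: matrix_mul_assoc)
  also have "\<dots> = T ** (S ** Si) ** ?U" by (simp only: TU matrix_mul_rid matrix_mul_assoc)
  also have "\<dots> = mat 1" by (simp add: S_Si TU)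
  finally have 2: "(T ** S ** T) ** (?U ** Si ** ?U) = mat 1" .
  have "(S ** T ** S) ** ((T ** S ** T) ** (?U ** Si ** ?U)) = (S ** T ** S) ** (T ** S ** T) ** (?U ** Si ** ?U)"
    by (rule matrix_mul_assoc)
  then show ?thesis unfolding 1 2 by simp
qed

lemma gal_signed_perm: "gal k G \<Longrightarrow> \<exists>p. signed_perm p G"
  unfolding gal_def by blast

text \<open>The conjugate of \<open>S\<close> is again symmetric, so the action on columns and the
  action on rows coincide. All three identities are forms of this.\<close>

lemma gal_S:
  assumes "gal k G"
  shows "transpose G ** S = S ** G" "G ** S ** G = S" "Si ** transpose G = G ** Si"
proof -
  obtain K \<sigma> p where g: "signed_perm p G" "map_matrix \<sigma> S = S ** G"
    using assms unfolding gal_def by blast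
  have "transpose (map_matrix \<sigma> S) = map_matrix \<sigma> S"
    using S_sym by (simp add: transpose_def map_matrix_def vec_eq_iff)
  then show 1: "transpose G ** S = S ** G"
    unfolding g(2) by (simp add: matrix_transpose_mul S_symmetric)
  have "G ** S ** G = G ** (transpose G ** S)" unfolding 1 by (simp add: matrix_mul_assoc)
  then show "G ** S ** G = S" by (simp add: matrix_mul_assoc signed_perm_orthogonal[OF g(1)])
  have "Si ** transpose G = Si ** transpose G ** (S ** Si)" by (simp add: S_Si)
  also have "\<dots> = Si ** (transpose G ** S) ** Si" by (simp only: matrix_mul_assoc)
  also have "\<dots> = (Si ** S) ** G ** Si" unfolding 1 by (simp only: matrix_mul_assoc)
  also have "\<dots> = G ** Si" by (simp add: S_Si)
  finally show "Si ** transpose G = G ** Si" .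
qed

lemma gal_relation:
  assumes g: "gal k G" and p: "signed_perm p G"
  shows "S ** D (\<lambda>e. of_int k * t e) ** S =
    D (\<lambda>e. - (of_int k * t (inv p e))) ** (Si ** transpose G) ** D (\<lambda>e. - (of_int k * t (inv p e)))"
proof -
  obtain K \<sigma> q where K: "field_embedding K \<sigma>" "zeta \<in> K" "\<sigma> zeta = zeta powi k"
    "\<And>a b. S $ a $ b \<in> K" "signed_perm q G" "map_matrix \<sigma> S = S ** G"
    using g unfolding gal_def by blast
  note E = field_embeddingD[OF K(1)] and KD = complex_subfieldD[OF field_embeddingD(1)[OF K(1)]]
  have TK: "T $ a $ b \<in> K" for a b
  proof (cases "a = b")
    case True
    obtain n where "T $ a $ a = zeta ^ n" using t_nat by blast
    then show ?thesis using field_embedding_power[OF K(1,2)] True by simp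
  qed (simp add: T_diagonal KD)
  let ?k = "\<lambda>e. of_int k * t e"
  let ?U = "D (\<lambda>e. - t e)"
  let ?V = "D (\<lambda>e. - ?k e)" and ?G' = "transpose G"
  have kt: "?k e \<in> loc" for e by (intro loc_mult) simp_all
  have sT: "\<sigma> (T $ e $ e) = zpow (?k e)" for e
  proof -
    obtain n where n: "t e = of_nat n" "T $ e $ e = zeta ^ n" using t_nat by blast
    have "?k e = of_int (k * int n)" by (simp add: n)
    then have "zpow (?k e) = zeta powi (k * int n)" using zpow_of_int by metis
    then show ?thesis using field_embedding_power[OF K(1,2), of n] K(3) n
      by (simp add: power_int_mult)
  qed
  have "map_matrix \<sigma> T = D ?k"
    using sT T_diagonal by (auto simp: vec_eq_iff map_matrix_def E(2))
  have UT: "?U $ e $ e = inverse (T $ e $ e)" for e by (simp add: T_zpow zpow_minus)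
  have UK: "?U $ a $ b \<in> K" for a b
    using UT[of a] TK[of a a] KD(1,6) by (cases "a = b") auto
  have sU: "map_matrix \<sigma> ?U = ?V"
  proof -
    have "\<sigma> (?U $ e $ e) = zpow (- ?k e)" for e
      unfolding UT E(9)[OF TK] sT zpow_minus[OF kt] ..
    then show ?thesis by (auto simp: vec_eq_iff map_matrix_def E(2))
  qed
  have CK: "C $ a $ b \<in> K" for a b using map_matrix_signed_perm(1)[OF K(1) signed_perm_C] .
  have SiK: "Si $ a $ b \<in> K" for a b unfolding Si_nth(2) by (rule K(4))
  have tGS: "map_matrix \<sigma> S = ?G' ** S" using K(6) gal_S(1)[OF g] by simp
  have sSi: "map_matrix \<sigma> Si = ?G' ** Si"
    unfolding Si_def field_embedding_matrix_mult[OF K(1,4) CK] tGS map_matrix_signed_perm(2)[OF K(1) signed_perm_C]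
    by (simp add: matrix_mul_assoc)
  have mK: "(A ** B) $ a $ b \<in> K" if "\<And>i j. A $ i $ j \<in> K" "\<And>i j. B $ i $ j \<in> K" for A B :: "complex^'a^'a" and a b
    unfolding matrix_mult_nth by (intro complex_subfield_sum[OF E(1)] KD(4) that)
  have "map_matrix \<sigma> (S ** T ** S) = ?G' ** S ** D ?k ** (S ** G)"
    unfolding field_embedding_matrix_mult[OF K(1) mK[OF K(4) TK] K(4)] field_embedding_matrix_mult[OF K(1,4) TK]
      \<open>map_matrix \<sigma> T = D ?k\<close> by (simp add: tGS gal_S(1)[OF g])
  moreover have "map_matrix \<sigma> (?U ** Si ** ?U) = ?V ** (?G' ** Si) ** ?V"
    unfolding field_embedding_matrix_mult[OF K(1) mK[OF UK SiK] UK] field_embedding_matrix_mult[OF K(1) UK SiK]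
      sU sSi ..
  ultimately have eq: "?G' ** S ** D ?k ** (S ** G) =
      ?V ** (?G' ** Si) ** ?V"
    using STS by simp
  note o = signed_perm_orthogonal[OF p]
  let ?E = "D (\<lambda>e. - (of_int k * t (inv p e)))"
  have conj: "G ** ?V ** ?G' = ?E"
    unfolding D_def signed_perm_conj_diag[OF p] by (simp add: comp_def)
  have "S ** D ?k ** S = (G ** ?G') ** (S ** D ?k ** S) ** (G ** ?G')" by (simp add: o)
  also have "\<dots> = G ** (?G' ** S ** D ?k ** (S ** G)) ** ?G'" by (simp only: matrix_mul_assoc)
  also have "\<dots> = (G ** ?V ** ?G') ** Si ** (mat 1) ** ?V ** ?G'"
    unfolding eq by (simp add: matrix_mul_assoc)
  \<comment> \<open>Inserting this product in the middle lets the second \<open>?V\<close> be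
    conjugated by \<open>G\<close> as well, and leaves one transposed \<open>G\<close> next to
    \<open>Si\<close>.\<close>
  also have "mat 1 = ?G' ** G" by (simp add: o)
  finally show ?thesis unfolding conj[symmetric] by (simp only: matrix_mul_assoc)
qed

lemma vacuum_row:
  assumes g: "gal k G" and p: "signed_perm p G"
  shows "(Si ** transpose G) $ z $ b \<in> \<real>" "(Si ** transpose G) $ z $ b \<noteq> 0"
proof -
  obtain e where e: "\<And>d. e d = 1 \<or> e d = - 1" "transpose G = (\<chi> i d. if i = inv p d then e d else 0)"
    using signed_perm_transpose[OF p] unfolding signed_perm_def by blast
  have "(Si ** transpose G) $ z $ b = S $ z $ inv p b * e b"
    unfolding signed_perm_mult_right[OF e(2)] by (simp add: S_vacuum_real)
  then show "(Si ** transpose G) $ z $ b \<in> \<real>" "(Si ** transpose G) $ z $ b \<noteq> 0"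
    using e(1)[of b] S_vacuum_real(1)[of "inv p b"] S_vacuum_nonzero[of "inv p b"] by auto
qed

text \<open>Row \<open>z\<close> of the two sides of the relation for \<open>S ** D (k t) ** S\<close> is real up to the diagonal
  factors, which are roots of unity of odd order; this leaves no freedom for \<open>G\<close>.\<close>
lemma gal_unique:
  assumes G: "gal k G" and H: "gal k H"
  shows "G = H"
proof -
  obtain p q where p: "signed_perm p G" and q: "signed_perm q H"
    using gal_signed_perm G H by blast
  define f where "f e = - (of_int k * t (inv p e))" for e
  define g where "g e = - (of_int k * t (inv q e))" for e
  have loc: "f e \<in> loc" "g e \<in> loc" for e unfolding f_def g_def by (intro loc_minus loc_mult; simp)+
  define v where "v e = zpow (f e - g e)" for e
  have eq: "D f ** (Si ** transpose G) ** D f = D g ** (Si ** transpose H) ** D g"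
    using gal_relation[OF G p] gal_relation[OF H q] unfolding f_def g_def by simp
  have v: "v a * (Si ** transpose G) $ a $ b * v b = (Si ** transpose H) $ a $ b" for a b
  proof -
    have "zpow (f a) * (Si ** transpose G) $ a $ b * zpow (f b) = zpow (g a) * (Si ** transpose H) $ a $ b * zpow (g b)"
      using arg_cong[OF eq, of "\<lambda>A. A $ a $ b"] by simp
    then show ?thesis unfolding v_def zpow_diff[OF loc] by (simp add: field_simps)
  qed
  have vz: "v z * v b = 1" for b
  proof -
    have "v z * v b = (Si ** transpose H) $ z $ b / (Si ** transpose G) $ z $ b"
      using v[of z b] vacuum_row(2)[OF G p, of b] by (simp add: field_simps)
    then have "v z * v b \<in> \<real>" using vacuum_row(1)[OF G p] vacuum_row(1)[OF H q] by simp
    then show ?thesis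
      using odd_root_of_unity_real[OF odd_N] zpow_pow_N by (simp add: v_def power_mult_distrib)
  qed
  then have "v z = 1" using odd_root_of_unity_involution[OF odd_N] zpow_pow_N unfolding v_def by blast
  then have "v b = 1" for b using vz[of b] by simp
  then have "Si ** transpose G = Si ** transpose H" using v by (simp add: vec_eq_iff)
  then have "S ** Si ** transpose G = S ** Si ** transpose H" by (simp add: matrix_mul_assoc[symmetric])
  then show ?thesis by (simp add: S_Si)
qed

text \<open>Under the factorization through SL2 modulo \<open>N\<close> that is eventually proved,
  this is the image of the diagonal matrix with entries \<open>1/x\<close>, \<open>x\<close>; in
  particular -1 corresponds to \<open>C\<close>.\<close>

definition Gm :: "rat \<Rightarrow> complex^'a^'a" where "Gm x = (THE G. gal (res x) G)"

definition pm :: "rat \<Rightarrow> 'a \<Rightarrow> 'a" where "pm x = (THE p. signed_perm p (Gm x))"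

lemma gal_Gm: assumes "x \<in> units" shows "gal (res x) (Gm x)"
  unfolding Gm_def using gal_exists[OF coprime_res[OF assms]] gal_unique by (metis theI)

lemma Gm_eqI: "x \<in> units \<Longrightarrow> gal k G \<Longrightarrow> [k = res x] (mod int N) \<Longrightarrow> Gm x = G"
  using gal_Gm gal_unique gal_cong by blast

lemma pm: assumes "x \<in> units" shows "signed_perm (pm x) (Gm x)"
  unfolding pm_def using gal_signed_perm[OF gal_Gm[OF assms]] signed_perm_unique by (metis theI)

lemma pm_eqI: "x \<in> units \<Longrightarrow> signed_perm p (Gm x) \<Longrightarrow> pm x = p"
  using pm signed_perm_unique by blast

lemma Gm_mult: "x \<in> units \<Longrightarrow> y \<in> units \<Longrightarrow> Gm (x * y) = Gm x ** Gm y"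
proof -
  assume x: "x \<in> units" and y: "y \<in> units"
  have "[res y * res x = res (x * y)] (mod int N)"
    using res_mult[of x y] unitsD(2) x y by (simp add: cong_sym mult.commute)
  then show ?thesis using Gm_eqI[OF units_mult[OF x y] gal_mult[OF gal_Gm[OF y] gal_Gm[OF x]]] by simp
qed

lemma Gm_1 [simp]: "Gm 1 = mat 1"
  using Gm_eqI[OF units_1(1) gal_1] res_of_int[of 1] by (simp add: cong_sym)

lemma Gm_minus_1: "Gm (- 1) = C"
  using Gm_eqI[OF units_1(2) gal_minus_1] res_of_int[of "- 1"] by (simp add: cong_sym)

lemma pm_mult: "x \<in> units \<Longrightarrow> y \<in> units \<Longrightarrow> pm (x * y) = pm x \<circ> pm y"
  by (rule pm_eqI) (auto simp: Gm_mult intro: signed_perm_mult pm)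

lemma pm_1 [simp]: "pm 1 e = e"
proof -
  have "signed_perm (\<lambda>x. x) (mat 1 :: complex^'a^'a)"
    unfolding signed_perm_def by (auto simp: mat_def bij_id[unfolded id_def] intro!: exI[of _ "\<lambda>_. 1"])
  then show ?thesis using pm_eqI[of 1 "\<lambda>x. x"] by simp
qed

lemma Gm_transpose: assumes x: "x \<in> units" shows "transpose (Gm x) = Gm (1 / x)"
proof -
  have "Gm (1 / x) ** Gm x = mat 1"
    using Gm_mult[OF units_inverse[OF x] x] unitsD(1)[OF x] by simp
  then have "Gm (1 / x) ** (Gm x ** transpose (Gm x)) = transpose (Gm x)"
    by (simp add: matrix_mul_assoc)
  then show ?thesis by (simp add: signed_perm_orthogonal[OF pm[OF x]])
qed

lemma pm_inverse: assumes x: "x \<in> units" shows "inv (pm x) = pm (1 / x)"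
proof -
  have "pm (1 / x) \<circ> pm x = pm 1" "pm x \<circ> pm (1 / x) = pm 1"
    using pm_mult[OF units_inverse[OF x] x] pm_mult[OF x units_inverse[OF x]] unitsD(1)[OF x] by simp_all
  then show ?thesis by (intro inv_equality) (auto simp: fun_eq_iff)
qed

lemma pm_minus_1: "t (pm (- 1) e) = t e"
proof -
  have "T ** C = C ** T" using C_T by simp
  then have "C ** diag_matrix (\<lambda>e. T $ e $ e) = C ** diag_matrix ((\<lambda>e. T $ e $ e) \<circ> pm (- 1))"
    using signed_perm_diag[OF pm[OF units_1(2)], of "\<lambda>e. T $ e $ e"] T_diag by (simp add: Gm_minus_1)
  then have "C ** C ** diag_matrix (\<lambda>e. T $ e $ e) = C ** C ** diag_matrix ((\<lambda>e. T $ e $ e) \<circ> pm (- 1))"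
    by (simp add: matrix_mul_assoc[symmetric])
  then have "diag_matrix (\<lambda>e. T $ e $ e) = diag_matrix ((\<lambda>e. T $ e $ e) \<circ> pm (- 1))"
    by (simp add: C_C)
  from arg_cong[OF this, of "\<lambda>A. A $ e $ e"] show ?thesis
    by (intro t_eqI) simp
qed

lemma Gm_S: assumes "x \<in> units" shows "Gm x ** S = S ** Gm (1 / x)" "Gm x ** Si = Si ** Gm (1 / x)"
proof -
  have "Gm (1 / (1 / x)) = Gm x" by simp
  then show "Gm x ** S = S ** Gm (1 / x)"
    using gal_S(1)[OF gal_Gm[OF units_inverse[OF assms]]] Gm_transpose[OF units_inverse[OF assms]] by simp
  show "Gm x ** Si = Si ** Gm (1 / x)"
    using gal_S(3)[OF gal_Gm[OF assms]] Gm_transpose[OF assms] by simp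
qed

lemma Gm_D: assumes "x \<in> units" shows "Gm x ** D f = D (\<lambda>e. f (pm (1 / x) e)) ** Gm x"
proof -
  have "pm (1 / x) (pm x e) = e" for e
    using pm_mult[OF units_inverse[OF assms] assms] unitsD(1)[OF assms] by (simp add: fun_eq_iff)
  then show ?thesis
    unfolding D_def signed_perm_diag[OF pm[OF assms]] by (simp add: comp_def)
qed

lemma S_D_S:
  assumes x: "x \<in> units"
  shows "S ** D (\<lambda>e. x * t e) ** S =
    D (\<lambda>e. - (x * t (pm (1 / x) e))) ** (Si ** Gm (1 / x)) ** D (\<lambda>e. - (x * t (pm (1 / x) e)))"
proof -
  have c: "lcong (of_int (res x) * t e) (x * t e)" for e
    using lcong_sym[OF lcong_res[OF unitsD(2)[OF x]]] lcong_scale[OF t_loc] by (simp add: mult.commute)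
  have l: "of_int (res x) * t e \<in> loc" "x * t e \<in> loc" for e
    using unitsD(2)[OF x] by (auto intro!: loc_mult)
  have "D (\<lambda>e. of_int (res x) * t e) = D (\<lambda>e. x * t e)" using l c by (intro D_cong) auto
  moreover have "D (\<lambda>e. - (of_int (res x) * t (pm (1 / x) e))) = D (\<lambda>e. - (x * t (pm (1 / x) e)))"
    using l c by (intro D_cong loc_minus lcong_minus) auto
  ultimately show ?thesis
    using gal_relation[OF gal_Gm[OF x] pm[OF x]] pm_inverse[OF x] Gm_transpose[OF x] by simp
qed

end

section \<open>Deviation from the Galois symmetry\<close>

context odd_level_data
begin

lemma two_unit: "2 \<in> units"
  using units_of_int[of 2] odd_N by simp

definition near_const :: "('a \<Rightarrow> rat) \<Rightarrow> bool" where
  "near_const u \<longleftrightarrow> (\<exists>c\<in>loc. \<forall>e. lcong (u e) c)"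

lemma near_const_add: "near_const u \<Longrightarrow> near_const v \<Longrightarrow> near_const (\<lambda>e. u e + v e)"
  unfolding near_const_def using lcong_add loc_add by meson

lemma near_const_scale: "q \<in> loc \<Longrightarrow> near_const u \<Longrightarrow> near_const (\<lambda>e. q * u e)"
  unfolding near_const_def using lcong_scale loc_mult by meson

lemma near_const_diff: "near_const u \<Longrightarrow> near_const v \<Longrightarrow> near_const (\<lambda>e. u e - v e)"
  unfolding near_const_def using lcong_diff loc_diff by meson

lemma near_const_comp: "near_const u \<Longrightarrow> near_const (\<lambda>e. u (p e))"
  unfolding near_const_def by blast

definition dev :: "rat \<Rightarrow> 'a \<Rightarrow> rat" where "dev x e = t (pm x e) - x^2 * t e"

lemma dev_loc: "x \<in> units \<Longrightarrow> dev x e \<in> loc"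
  unfolding dev_def using unitsD(2) by (intro loc_diff loc_mult loc_power) simp_all

lemma dev_mult: "x \<in> units \<Longrightarrow> y \<in> units \<Longrightarrow> dev (x * y) e = dev x (pm y e) + x^2 * dev y e"
  by (simp add: dev_def pm_mult algebra_simps power_mult_distrib)

lemma dev_1: "dev 1 e = 0"
  by (simp add: dev_def)

lemma dev_minus: "x \<in> units \<Longrightarrow> dev (- x) e = dev x e"
  using pm_mult[of "- 1" x] pm_minus_1 by (simp add: dev_def)

lemma Gm_cong: "x \<in> units \<Longrightarrow> y \<in> units \<Longrightarrow> lcong x y \<Longrightarrow> Gm x = Gm y"
  using Gm_eqI[OF _ gal_Gm, of x y] res_cong[of x y] unitsD(2) cong_sym by blast

lemma dev_cong: assumes "x \<in> units" "y \<in> units" "lcong x y" shows "lcong (dev x e) (dev y e)"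
proof -
  have "pm x = pm y" using Gm_cong[OF assms] by (simp add: pm_def)
  moreover have "lcong (x^2 * t e) (y^2 * t e)"
    using assms unitsD(2) by (simp add: power2_eq_square) (intro lcong_mult loc_mult lcong_refl t_loc)
  ultimately show ?thesis unfolding dev_def by (simp add: lcong_diff)
qed

text \<open>Up to sign, the exponents of the outer diagonal factors in \<open>S_D_S\<close>.\<close>

definition gal_exp :: "rat \<Rightarrow> 'a \<Rightarrow> rat" where "gal_exp x e = x * t (pm (1 / x) e)"

text \<open>What \<open>gal_exp x e - t e\<close> becomes when \<open>e\<close> is replaced by
  \<open>pm x e\<close>, that is, when \<open>Gm (1 / x)\<close> is moved past it.\<close>

definition dev_exp :: "rat \<Rightarrow> 'a \<Rightarrow> rat" where "dev_exp x e = x * t e - t (pm x e)"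

lemma exp_loc: "x \<in> units \<Longrightarrow> gal_exp x e \<in> loc" "x \<in> units \<Longrightarrow> dev_exp x e \<in> loc"
  unfolding gal_exp_def dev_exp_def using unitsD(2) by (auto intro!: loc_mult loc_diff)

lemma C_gal_exp: assumes x: "x \<in> units" shows "C ** D (\<lambda>e. - gal_exp x e) = D (\<lambda>e. - gal_exp x e) ** C"
proof -
  have "pm (1 / x) \<circ> pm (- 1) = pm (- 1) \<circ> pm (1 / x)"
    using pm_mult[OF units_inverse[OF x] units_1(2)] pm_mult[OF units_1(2) units_inverse[OF x]] by (simp add: mult.commute)
  then have "gal_exp x (pm (- 1) e) = gal_exp x e" for e
    by (simp add: gal_exp_def fun_eq_iff pm_minus_1)
  then show ?thesis
    using Gm_D[OF units_1(2), of "\<lambda>e. - gal_exp x e"] by (simp add: Gm_minus_1)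
qed

lemma C_comm: "C ** S = S ** C" "C ** Si = S" "Si ** C = S"
proof -
  show "C ** S = S ** C" by (simp add: C_S)
  show "C ** Si = S" using C_S(1) C_C by (metis matrix_mul_assoc matrix_mul_lid)
  show "Si ** C = S" using C_S(2) C_C by (metis matrix_mul_assoc matrix_mul_rid)
qed

text \<open>Multiplicativity of \<open>k \<mapsto> S ** D (k t) ** S\<close>, applied to \<open>1 = x + y\<close>.\<close>
lemma sum_relation:
  assumes x: "x \<in> units" and y: "y \<in> units" and xy: "x + y = 1"
  shows "D (dev_exp x) ** (Si ** Gm (x * y)) ** D (dev_exp y) = C ** (S ** D (\<lambda>e. - (gal_exp x e + gal_exp y e)) ** S)"
proof -
  have l: "x * t e \<in> loc" "y * t e \<in> loc" for e using x y unitsD(2) by (auto intro!: loc_mult)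
  note gal_exp = exp_loc(1)[OF x] exp_loc(1)[OF y]
  let ?X = "D (\<lambda>e. - gal_exp x e)" and ?Y = "D (\<lambda>e. - gal_exp y e)"
  let ?A = "D (\<lambda>e. gal_exp x e - t e)" and ?B = "D (\<lambda>e. gal_exp y e - t e)"
    and ?Gx = "Gm (1 / x)" and ?Gy = "Gm (1 / y)" and ?U = "D (\<lambda>e. - t e)"
    and ?TX = "D (\<lambda>e. x * t e)" and ?TY = "D (\<lambda>e. y * t e)"
  have inv: "D (gal_exp x) ** ?X = mat 1" "?Y ** D (gal_exp y) = mat 1"
    by (simp_all add: D_mult gal_exp loc_minus)
  have "(S ** ?TX ** S) ** C ** (S ** ?TY ** S) =
      S ** ?TX ** ((S ** C) ** S) ** ?TY ** S"
    by (simp only: matrix_mul_assoc)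
  also have "\<dots> = S ** (?TX ** ?TY) ** S"
    by (simp add: C_S S_Si matrix_mul_assoc)
  also have "\<dots> = S ** T ** S"
    using xy by (simp add: D_mult l distrib_right[symmetric] T_D[symmetric])
  finally have "?X ** (Si ** ?Gx) ** ?X ** C ** (?Y ** (Si ** ?Gy) ** ?Y) =
      ?U ** Si ** ?U"
    using S_D_S[OF x] S_D_S[OF y] STS unfolding gal_exp_def by simp
  \<comment> \<open>Multiplying by the inverse outer phases isolates the two phases that meet in the
    middle; they commute with \<open>C\<close>.\<close>
  then have "D (gal_exp x) ** (?X ** (Si ** ?Gx) ** ?X ** C ** (?Y ** (Si ** ?Gy) ** ?Y)) ** D (gal_exp y) =
      D (gal_exp x) ** (?U ** Si ** ?U) ** D (gal_exp y)" by simp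
  then have "(D (gal_exp x) ** ?X) ** Si ** ?Gx ** ?X ** (C ** ?Y) ** Si ** ?Gy ** (?Y ** D (gal_exp y)) =
      (D (gal_exp x) ** ?U) ** Si ** (?U ** D (gal_exp y))" by (simp only: matrix_mul_assoc)
  then have eq: "Si ** ?Gx ** ?X ** (?Y ** C) ** Si ** ?Gy =
      ?A ** Si ** ?B"
    unfolding inv C_gal_exp[OF y] by (simp add: D_mult gal_exp loc_minus)
  have gx: "?Gx ** Gm x = mat 1" and gy: "?Gy ** Gm y = mat 1"
    using Gm_mult[OF units_inverse[OF x] x] Gm_mult[OF units_inverse[OF y] y] unitsD(1) x y by simp_all
  have pmi: "pm (1 / u) (pm u e) = e" if "u \<in> units" for u e
    using pm_mult[OF units_inverse[OF that] that] unitsD(1)[OF that] by (simp add: fun_eq_iff)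
  have dx: "?Gx ** ?A = D (dev_exp x) ** ?Gx"
    using Gm_D[OF units_inverse[OF x]] pmi[OF x] by (simp add: gal_exp_def dev_exp_def[abs_def])
  have dy: "?B ** Gm y = Gm y ** D (dev_exp y)"
    unfolding D_def signed_perm_diag[OF pm[OF y]] using pmi[OF y] by (simp add: comp_def gal_exp_def dev_exp_def[abs_def])
  \<comment> \<open>The outer factors \<open>?Gx\<close> and \<open>Gm y\<close> cancel the Galois
    matrices around the middle phases and leave an expression symmetric in \<open>x\<close> and
    \<open>y\<close>. On the other side of \<open>eq\<close> they convert the remaining phases into
    \<open>dev_exp\<close>.\<close>
  have "?Gx ** (Si ** ?Gx ** ?X ** (?Y ** C) ** Si ** ?Gy) ** Gm y =
      (?Gx ** Si) ** ?Gx ** (?X ** ?Y) ** (C ** Si) ** (?Gy ** Gm y)"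
    by (simp only: matrix_mul_assoc)
  also have "\<dots> = Si ** (Gm x ** ?Gx) ** (?X ** ?Y) ** S"
    unfolding gy C_comm Gm_S(2)[OF units_inverse[OF x]] by (simp add: matrix_mul_assoc)
  also have "Gm x ** ?Gx = mat 1" using gx matrix_left_right_inverse by blast
  also have "Si ** mat 1 ** (?X ** ?Y) ** S = C ** (S ** D (\<lambda>e. - (gal_exp x e + gal_exp y e)) ** S)"
    by (simp add: D_mult gal_exp loc_minus C_S[symmetric] matrix_mul_assoc)
  finally have r: "?Gx ** (Si ** ?Gx ** ?X ** (?Y ** C) ** Si ** ?Gy) ** Gm y =
      C ** (S ** D (\<lambda>e. - (gal_exp x e + gal_exp y e)) ** S)" .
  have "?Gx ** (?A ** Si ** ?B) ** Gm y =
      (?Gx ** ?A) ** Si ** (?B ** Gm y)"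
    by (simp only: matrix_mul_assoc)
  also have "\<dots> = D (dev_exp x) ** (?Gx ** Si) ** Gm y ** D (dev_exp y)"
    unfolding dx dy by (simp only: matrix_mul_assoc)
  also have "\<dots> = D (dev_exp x) ** (Si ** Gm (x * y)) ** D (dev_exp y)"
    unfolding Gm_S(2)[OF units_inverse[OF x]] Gm_mult[OF x y] by (simp add: matrix_mul_assoc)
  finally show ?thesis using r eq by simp
qed

lemma vacuum_row_nonzero: "x \<in> units \<Longrightarrow> (Si ** Gm x) $ z $ b \<noteq> 0"
  using vacuum_row(2)[OF gal_Gm pm, of "1 / x" b] Gm_transpose[of "1 / x"] by (simp add: units_inverse)

text \<open>The point is that \<open>x - x^2 = x * y\<close> is symmetric: exchanging
  \<open>x\<close> and \<open>y\<close> changes the exponent through the deviations only.\<close>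

lemma dev_exp_eq: "x + y = 1 \<Longrightarrow> dev_exp x e = x * y * t e - dev x e"
proof -
  assume "x + y = 1"
  then have "y = 1 - x" by simp
  then have "x * y * t e = x * (1 - x) * t e" by (simp only:)
  also have "\<dots> = x * t e - x^2 * t e" by (simp add: algebra_simps power2_eq_square)
  finally show ?thesis by (simp add: dev_exp_def dev_def)
qed

text \<open>The right side of \<open>sum_relation\<close> is symmetric in \<open>x\<close> and
  \<open>y\<close>, hence so is the left side. In row \<open>z\<close> the common matrix
  \<open>Q\<close> has no zero entry and cancels, and the variable \<open>e\<close> separates from
  \<open>z\<close>.\<close>

lemma dev_reflect:
  assumes x: "x \<in> units" and y: "y \<in> units" and xy: "x + y = 1"
  shows "near_const (\<lambda>e. dev x e - dev y e)"
proof -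
  define A where "A = S ** D (\<lambda>e. - (gal_exp x e + gal_exp y e)) ** S"
  define Q where "Q = Si ** Gm (x * y)"
  have A1: "D (dev_exp x) ** Q ** D (dev_exp y) = C ** A" and A2: "D (dev_exp y) ** Q ** D (dev_exp x) = C ** A"
    using sum_relation[OF x y xy] sum_relation[OF y x] xy unfolding A_def Q_def
    by (simp_all add: add.commute mult.commute[of y])
  have "lcong (dev x e - dev y e) (dev x z - dev y z)" for e
  proof -
    have "zpow (dev_exp x z) * Q $ z $ e * zpow (dev_exp y e) = zpow (dev_exp y z) * Q $ z $ e * zpow (dev_exp x e)"
      using arg_cong[OF trans[OF A1 A2[symmetric]], of "\<lambda>M. M $ z $ e"] by simp
    moreover have "Q $ z $ e \<noteq> 0" unfolding Q_def by (rule vacuum_row_nonzero) (intro units_mult x y)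
    ultimately have "zpow (dev_exp x z) * zpow (dev_exp y e) = zpow (dev_exp y z) * zpow (dev_exp x e)" by simp
    then have "zpow (dev_exp x z + dev_exp y e) = zpow (dev_exp y z + dev_exp x e)"
      using exp_loc x y by (simp add: zpow_add)
    then have "lcong (dev_exp x z + dev_exp y e) (dev_exp y z + dev_exp x e)"
      by (subst (asm) zpow_eq_iff) (auto intro!: loc_add exp_loc x y)
    from lcong_diff[OF this lcong_refl[of "dev_exp y z + dev_exp x z"]]
    have "lcong (dev_exp y e - dev_exp y z) (dev_exp x e - dev_exp x z)" by simp
    from lcong_diff[OF this lcong_refl[of "dev_exp x e - dev_exp y z"]] have "lcong (dev_exp y e - dev_exp x e) (dev_exp y z - dev_exp x z)" by simp
    then show ?thesis
      using dev_exp_eq[OF xy] dev_exp_eq[of y x] xy by (simp add: add.commute mult.commute[of y])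
  qed
  then show ?thesis unfolding near_const_def using dev_loc x y by (intro bexI[of _ "dev x z - dev y z"]) auto
qed

text \<open>With \<open>w = x / y\<close>, the units \<open>w + 1\<close> and \<open>- w\<close> add
  up to 1, and the sign is invisible to \<open>dev\<close>. Scaling by \<open>y\<close> through the
  cocycle rule produces the factor \<open>2 * w + 1\<close>, the difference of the squares of
  \<open>w + 1\<close> and \<open>w\<close>.\<close>

lemma dev_sum:
  assumes x: "x \<in> units" and y: "y \<in> units" and s: "x + y \<in> units"
  shows "near_const (\<lambda>e. dev (x + y) e - dev x e - (2 * (x / y) + 1) * dev y e)"
proof -
  define w where "w = x / y"
  have y0: "y \<noteq> 0" by (rule unitsD(1)[OF y])
  have "w + 1 = (x + y) / y" using y0 by (simp add: w_def add_divide_distrib)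
  then have w: "w \<in> units" "w + 1 \<in> units" "x = w * y" "x + y = (w + 1) * y"
    using units_divide[OF x y] units_divide[OF s y] y0 by (simp_all add: w_def)
  have "near_const (\<lambda>e. dev (w + 1) e - dev w e)"
    using dev_reflect[OF w(2) units_minus[OF w(1)]] by (simp add: dev_minus w(1))
  then have "near_const (\<lambda>e. dev (w + 1) (pm y e) - dev w (pm y e))" by (rule near_const_comp)
  moreover have "dev (x + y) e - dev x e - (2 * w + 1) * dev y e = dev (w + 1) (pm y e) - dev w (pm y e)" for e
    unfolding w(4) unfolding w(3) dev_mult[OF w(2) y] dev_mult[OF w(1) y] by (simp add: algebra_simps power2_eq_square)
  ultimately show ?thesis unfolding w_def by simp
qed

lemma dev_proportional:
  assumes x: "x \<in> units" and y: "y \<in> units" and s: "x + y \<in> units"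
  shows "near_const (\<lambda>e. y^2 * dev x e - x^2 * dev y e)"
proof -
  have s': "y + x \<in> units" using s by (simp add: add.commute)
  have n: "near_const (\<lambda>e. (dev (x + y) e - dev x e - (2 * (x / y) + 1) * dev y e) - (dev (y + x) e - dev y e - (2 * (y / x) + 1) * dev x e))"
    by (rule near_const_diff[OF dev_sum[OF x y s] dev_sum[OF y x s']])
  \<comment> \<open>After \<open>dev (x + y)\<close> is eliminated,
    \<open>2 * (y / x) * dev x - 2 * (x / y) * dev y\<close> remains; this factor clears it.\<close>
  have "x * y / 2 \<in> loc" using unitsD(2,4) two_unit x y by (auto intro!: loc_mult)
  from near_const_scale[OF this n] show ?thesis
  proof (rule back_subst[of near_const])
    show "(\<lambda>e. x * y / 2 * ((dev (x + y) e - dev x e - (2 * (x / y) + 1) * dev y e) - (dev (y + x) e - dev y e - (2 * (y / x) + 1) * dev x e))) =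
        (\<lambda>e. y^2 * dev x e - x^2 * dev y e)"
    proof
      fix e
      have "x \<noteq> 0" "y \<noteq> 0" using unitsD(1) x y by auto
      then show "x * y / 2 * ((dev (x + y) e - dev x e - (2 * (x / y) + 1) * dev y e) - (dev (y + x) e - dev y e - (2 * (y / x) + 1) * dev x e)) =
          y^2 * dev x e - x^2 * dev y e"
        by (simp add: field_simps power2_eq_square add.commute[of y x])
    qed
  qed
qed

lemma near_const_unit_cancel: "q \<in> units \<Longrightarrow> near_const (\<lambda>e. q * u e) \<Longrightarrow> near_const u"
  using near_const_scale[of "1 / q" "\<lambda>e. q * u e"] by (simp add: unitsD)

text \<open>The unit \<open>y\<close> is an intermediate stop between 1, where the deviation is 0,
  and \<open>x\<close>.\<close>

lemma dev_chain:
  assumes x: "x \<in> units" and y: "y \<in> units" and "1 + y \<in> units" "x + y \<in> units"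
  shows "near_const (dev x)"
proof -
  have "near_const (\<lambda>e. y^2 * dev 1 e - 1^2 * dev y e)" by (rule dev_proportional) (use assms in auto)
  then have "near_const (\<lambda>e. - 1 * dev y e)" by (simp add: dev_1)
  then have "near_const (dev y)" by (rule near_const_unit_cancel[rotated]) simp
  then have "near_const (\<lambda>e. x^2 * dev y e)" using unitsD(2)[OF x] by (intro near_const_scale loc_power)
  then have "near_const (\<lambda>e. (y^2 * dev x e - x^2 * dev y e) + x^2 * dev y e)"
    using dev_proportional[OF x y] assms(4) by (intro near_const_add)
  then have "near_const (\<lambda>e. y^2 * dev x e)" by simp
  then show ?thesis by (rule near_const_unit_cancel[rotated]) (simp add: power2_eq_square y units_mult)
qed

end

section \<open>Choosing auxiliary integers that avoid given residues\<close>

lemma simultaneous_residues_large: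
  fixes r :: "nat \<Rightarrow> int"
  assumes "N > (0::nat)"
  obtains w :: int where "w > B" "\<And>p. prime p \<Longrightarrow> p dvd N \<Longrightarrow> [w = r p] (mod int p)"
    "3 dvd N \<Longrightarrow> [w = r 3] (mod 9)"
proof -
  obtain w0 :: int where w0: "\<And>p. prime p \<Longrightarrow> p dvd N \<Longrightarrow> [w0 = r p] (mod int (if p = 3 then 9 else p))"
    using simultaneous_residues[OF assms] by metis
  \<comment> \<open>Divisible by 9 and by all primes of \<open>N\<close>, so adding it preserves
    every prescribed residue; the last factor makes it large.\<close>
  define m where "m = 9 * int N * (\<bar>w0\<bar> + \<bar>B\<bar> + 1)"
  define w where "w = w0 + m"
  have "1 * (\<bar>w0\<bar> + \<bar>B\<bar> + 1) \<le> (9 * int N) * (\<bar>w0\<bar> + \<bar>B\<bar> + 1)"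
    using assms by (intro mult_right_mono) auto
  then have "\<bar>w0\<bar> + \<bar>B\<bar> + 1 \<le> m" by (simp add: m_def)
  then have "w > B" unfolding w_def by linarith
  moreover have *: "[w = r p] (mod int (if p = 3 then 9 else p))" if p: "prime p" "p dvd N" for p
  proof -
    have "int (if p = 3 then 9 else p) dvd m" using p(2) by (auto simp: m_def)
    then have "[w = w0] (mod int (if p = 3 then 9 else p))" by (simp add: w_def cong_iff_dvd_diff)
    then show ?thesis using w0[OF p] cong_trans by blast
  qed
  moreover have "[w = r p] (mod int p)" if "prime p" "p dvd N" for p
    by (rule cong_dvd_modulus[OF *[OF that]]) auto
  moreover have "[w = r 3] (mod 9)" if "3 dvd N" using *[of 3] that by simp
  ultimately show ?thesis using that by blast
qed

lemma not_dvd_cong: "[a = b] (mod m) \<Longrightarrow> \<not> m dvd b \<Longrightarrow> \<not> m dvd (a::int)"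
  using cong_dvd_iff by blast

lemma prime_ge_5:
  assumes "prime p" "p dvd N" "odd (N::nat)" "p \<noteq> 3"
  shows "p \<ge> 5"
proof -
  have "odd p" using assms(2,3) dvd_trans by blast
  then have "p \<noteq> 2" "p \<noteq> 4" by auto
  then show ?thesis using prime_ge_2_nat[OF assms(1)] assms(4) by linarith
qed

text \<open>A count of candidates. Each condition excludes at most one residue; for the linear one
  this holds because \<open>c\<close> and \<open>d\<close> are not both 0 modulo \<open>p\<close>.
  For \<open>p\<close> at least 5 the four candidates 0 to 3 suffice. For \<open>p = 3\<close> the
  first two conditions coincide and three candidates suffice.\<close>

lemma avoid_three_residues:
  fixes \<sigma> \<tau> c d :: int
  assumes p: "prime p" "odd p" and \<sigma>: "\<not> int p dvd d + \<sigma> * c" and 3: "p = 3 \<Longrightarrow> int p dvd \<sigma> - \<tau>"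
  shows "\<exists>r. \<not> int p dvd r - \<sigma> \<and> \<not> int p dvd r - \<tau> \<and> \<not> int p dvd d + r * c"
proof -
  have prime_p: "prime (int p)" using p(1) by simp
  have p3: "p \<ge> 3" using p prime_ge_2_nat[OF p(1)] by (cases "p = 2") auto
  have small: "\<not> int p dvd j" if "0 < j" "j < int p" for j using zdvd_imp_le[of "int p" j] that by auto
  have 1: "\<not> (int p dvd x - y \<and> int p dvd x' - y)" if "0 < x' - x" "x' - x < int p" for x x' y
  proof
    assume *: "int p dvd x - y \<and> int p dvd x' - y"
    have "int p dvd (x' - y) - (x - y)" by (rule dvd_diff) (use * in blast)+
    then show False using small[OF that] by simp
  qed
  have 2: "\<not> (int p dvd d + x * c \<and> int p dvd d + x' * c)" if "0 < x' - x" "x' - x < int p" for x x'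
  proof
    assume *: "int p dvd d + x * c \<and> int p dvd d + x' * c"
    have "int p dvd (d + x' * c) - (d + x * c)" by (rule dvd_diff) (use * in blast)+
    then have "int p dvd (x' - x) * c" by (simp add: algebra_simps)
    then have "int p dvd c" using small[OF that] prime_dvd_mult_iff[OF prime_p] by blast
    then have "int p dvd d" using * by (metis dvd_add_left_iff dvd_mult)
    then show False using \<sigma> \<open>int p dvd c\<close> by simp
  qed
  show ?thesis
  proof (cases "p = 3")
    case True
    then have eq: "int p dvd r - \<tau> \<longleftrightarrow> int p dvd r - \<sigma>" for r
    proof -
      have "r - \<tau> = (r - \<sigma>) + (\<sigma> - \<tau>)" by simp
      then show ?thesis using 3[OF True] by (metis dvd_add_left_iff)
    qed
    show ?thesis
      unfolding eq using 1[of 1 0 \<sigma>] 1[of 2 0 \<sigma>] 1[of 2 1 \<sigma>] 2[of 1 0] 2[of 2 0] 2[of 2 1] True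
      by (auto intro: exI[of _ 0] exI[of _ 1] exI[of _ 2])
  next
    case False
    then have "p \<noteq> 4" "p > 3" using p p3 by auto
    then have "int p > 4" by simp
    then have *: "\<exists>r\<in>{0, 1, 2, 3}. \<not> P r \<and> \<not> Q r \<and> \<not> R r"
      if "\<And>x x'. x' - x > 0 \<Longrightarrow> x' - x < int p \<Longrightarrow> \<not> (P x \<and> P x')"
        "\<And>x x'. x' - x > 0 \<Longrightarrow> x' - x < int p \<Longrightarrow> \<not> (Q x \<and> Q x')"
        "\<And>x x'. x' - x > 0 \<Longrightarrow> x' - x < int p \<Longrightarrow> \<not> (R x \<and> R x')" for P Q R :: "int \<Rightarrow> bool"
      using that(1)[of 1 0] that(1)[of 2 0] that(1)[of 3 0] that(1)[of 2 1] that(1)[of 3 1] that(1)[of 3 2]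
        that(2)[of 1 0] that(2)[of 2 0] that(2)[of 3 0] that(2)[of 2 1] that(2)[of 3 1] that(2)[of 3 2]
        that(3)[of 1 0] that(3)[of 2 0] that(3)[of 3 0] that(3)[of 2 1] that(3)[of 3 1] that(3)[of 3 2]
      by simp blast
    show ?thesis
      using *[of "\<lambda>r. int p dvd r - \<sigma>" "\<lambda>r. int p dvd r - \<tau>" "\<lambda>r. int p dvd d + r * c", OF 1 1 2] by blast
  qed
qed

text \<open>At 3 the hypothesis makes \<open>1 + y\<close> and \<open>k + y\<close> congruent. For
  \<open>k\<close> congruent to 2 the three conditions would exhaust all residues modulo 3.\<close>

lemma coprime_chain_exists:
  fixes k :: int
  assumes N: "odd N" and k: "coprime k (int N)" and k3: "3 dvd N \<Longrightarrow> [k = 1] (mod 3)"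
  obtains y :: int where "y > 0" "k + y > 0" "coprime y (int N)" "coprime (1 + y) (int N)" "coprime (k + y) (int N)"
proof -
  have N0: "N > 0" using N by (simp add: odd_pos)
  have ex: "\<exists>r. \<not> int p dvd r \<and> \<not> int p dvd 1 + r \<and> \<not> int p dvd k + r" if p: "prime p" "p dvd N" for p
  proof (cases "p = 3")
    case True
    then have "[k = 1] (mod 3)" using k3 p(2) by simp
    then have "[k + 1 = 1 + 1] (mod 3)" by (rule cong_add) simp
    then have "\<not> 3 dvd k + 1" by (rule not_dvd_cong) simp
    then show ?thesis using True by (intro exI[of _ 1]) simp
  next
    case False
    have "odd p" using N p(2) dvd_trans by blast
    moreover have "\<not> int p dvd k" using k p unfolding coprime_int_iff_prime[OF N0] by blast
    ultimately show ?thesis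
      using avoid_three_residues[OF p(1), of k 0 1 "- 1"] False by (simp add: add.commute)
  qed
  define r where "r p = (SOME r. \<not> int p dvd r \<and> \<not> int p dvd 1 + r \<and> \<not> int p dvd k + r)" for p
  obtain w where w: "w > \<bar>k\<bar>" "\<And>p. prime p \<Longrightarrow> p dvd N \<Longrightarrow> [w = r p] (mod int p)"
    using simultaneous_residues_large[OF N0] by metis
  have "\<not> int p dvd w \<and> \<not> int p dvd 1 + w \<and> \<not> int p dvd k + w" if p: "prime p" "p dvd N" for p
    using someI_ex[OF ex[OF p]] not_dvd_cong[OF w(2)[OF p]] not_dvd_cong[OF cong_add[OF cong_refl w(2)[OF p]]]
    unfolding r_def by blast
  then have "coprime w (int N)" "coprime (1 + w) (int N)" "coprime (k + w) (int N)"
    unfolding coprime_int_iff_prime[OF N0] by blast+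
  then show ?thesis using that[of w] w(1) by linarith
qed

context odd_level_data
begin

lemma dev_near_constant:
  assumes x: "x \<in> units"
  shows "near_const (dev x)"
proof -
  obtain k where k: "k > 0" "coprime k (int N)" "lcong x (of_int k)"
    using units_representative[OF x] by metis
  have ku: "of_int k \<in> units" using k by (simp add: units_of_int)
  have red: "near_const (dev (of_int j))" if j: "coprime j (int N)" "j \<noteq> 0" "3 dvd N \<Longrightarrow> [j = 1] (mod 3)" for j
  proof -
    obtain y where y: "y > 0" "j + y > 0" "coprime y (int N)" "coprime (1 + y) (int N)" "coprime (j + y) (int N)"
      using coprime_chain_exists[OF odd_N j(1,3)] by metis
    have "of_int j \<in> units" "of_int y \<in> units" "of_int (1 + y) \<in> units" "of_int (j + y) \<in> units"
      using j y unfolding units_of_int by auto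
    then show ?thesis by (intro dev_chain[of "of_int j" "of_int y"]) simp_all
  qed
  have "near_const (dev (of_int k))"
  proof (cases "3 dvd N \<longrightarrow> [k = 1] (mod 3)")
    case True
    then show ?thesis using red[of k] k by auto
  next
    case False
    have "prime (3::nat)" by simp
    then have "\<not> int 3 dvd k" using k(2) False unfolding coprime_int_iff_prime[OF N_pos] by blast
    then have "\<not> 3 dvd k" by simp
    then have "[- k = 1] (mod 3)" using False by (simp add: cong_def) presburger
    \<comment> \<open>A unit is 1 or -1 modulo 3, and \<open>dev\<close> is blind to the sign, so
      \<open>- k\<close> can take the place of \<open>k\<close>.\<close>
    then have "near_const (dev (of_int (- k)))" using red[of "- k"] k by simp
    then show ?thesis using dev_minus[OF ku] by (simp add: near_const_def)
  qed
  then obtain c where "c \<in> loc" "\<And>e. lcong (dev (of_int k) e) c" unfolding near_const_def by blast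
  then show ?thesis unfolding near_const_def using dev_cong[OF x ku k(3)] lcong_trans by blast
qed

section \<open>The remaining constants and their vanishing\<close>

definition dev0 :: "rat \<Rightarrow> rat" where "dev0 x = dev x z"

lemma dev0_loc: "x \<in> units \<Longrightarrow> dev0 x \<in> loc"
  by (simp add: dev0_def dev_loc)

lemma dev_dev0: "x \<in> units \<Longrightarrow> lcong (dev x e) (dev0 x)"
  using dev_near_constant[of x] lcong_sym lcong_trans unfolding near_const_def dev0_def by blast

lemma dev0_cong: "x \<in> units \<Longrightarrow> y \<in> units \<Longrightarrow> lcong x y \<Longrightarrow> lcong (dev0 x) (dev0 y)"
  unfolding dev0_def by (rule dev_cong)

lemma t_pm: assumes "x \<in> units" shows "lcong (t (pm x e)) (x^2 * t e + dev0 x)"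
  using lcong_add[OF dev_dev0[OF assms, of e] lcong_refl[of "x^2 * t e"]] by (simp add: dev_def add.commute)

lemma dev0_mult: assumes "x \<in> units" "y \<in> units" shows "lcong (dev0 (x * y)) (dev0 x + x^2 * dev0 y)"
  unfolding dev0_def[of "x * y"] dev_mult[OF assms] using dev_dev0[OF assms(1), of "pm y z"]
  unfolding dev0_def[of y] by (intro lcong_add lcong_refl)

lemma dev0_1: "dev0 1 = 0" by (simp add: dev0_def dev_1)

lemma dev0_minus: "x \<in> units \<Longrightarrow> dev0 (- x) = dev0 x" by (simp add: dev0_def dev_minus)

lemma dev0_inverse: assumes x: "x \<in> units" shows "lcong (dev0 (1 / x)) (- dev0 x / x^2)"
proof -
  have "lcong 0 (dev0 x + x^2 * dev0 (1 / x))"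
    using dev0_mult[OF x units_inverse[OF x]] unitsD(1)[OF x] by (simp add: dev0_1)
  then have "lcong (1 / x^2 * 0) (1 / x^2 * (dev0 x + x^2 * dev0 (1 / x)))"
    using x by (intro lcong_scale) (auto simp: power_one_over[symmetric] unitsD intro!: loc_power)
  then have "lcong (0 - dev0 x / x^2) ((dev0 x / x^2 + dev0 (1 / x)) - dev0 x / x^2)"
    using unitsD(1)[OF x] by (intro lcong_diff) (simp_all add: distrib_left)
  then show ?thesis by (simp add: lcong_sym)
qed

text \<open>Once deviations are constants, the sum of phases on the right of
  \<open>sum_relation\<close> is \<open>r * t e + \<kappa>\<close> with a unit \<open>r\<close>, so
  \<open>S_D_S\<close> evaluates that side once more. The entry at \<open>z\<close>,
  \<open>z\<close> compares all exponents.\<close>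

lemma dev0_sum_relation:
  assumes x: "x \<in> units" and y: "y \<in> units" and xy: "x + y = 1"
  shows "lcong (dev0 x / x + dev0 y / y + 2 * (dev0 (x * y) / (x * y)) + dev0 x + dev0 y) 0"
proof -
  note x0 = unitsD(1)[OF x] and y0 = unitsD(1)[OF y]
  have xyu: "x * y \<in> units" using x y by blast
  \<comment> \<open>The coefficient of \<open>t e\<close> is \<open>- (1 / x + 1 / y)\<close>, and
    \<open>x + y = 1\<close> turns it into this unit.\<close>
  define r where "r = - 1 / (x * y)"
  have r: "r \<in> units" unfolding r_def using units_divide[OF units_1(2) xyu] by simp
  have ir: "1 / r = - (x * y)" by (simp add: r_def)
  have inv_sum: "1 / x + 1 / y = 1 / (x * y)" using x0 y0 xy by (simp add: field_simps)
  define \<kappa> where "\<kappa> = dev0 x / x + dev0 y / y"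
  define \<delta> where "\<delta> = dev0 (x * y) / (x * y)"
  let ?A = "S ** D (\<lambda>e. - (gal_exp x e + gal_exp y e)) ** S" and ?m = "x * y * t z + \<delta>"
    and ?q = "(Si ** Gm (x * y)) $ z $ z" and ?R = "D (\<lambda>e. r * t e)"
  have loc: "\<kappa> \<in> loc" "\<delta> \<in> loc" "r * t e \<in> loc" "x * y * t e \<in> loc" for e
    unfolding \<kappa>_def \<delta>_def using unitsD x y xyu r dev0_loc by (auto intro!: loc_add loc_mult)
  have gal_exp: "lcong (gal_exp u e) (t e / u - dev0 u / u)" if u: "u \<in> units" for u e
  proof -
    have "lcong (t (pm (1 / u) e)) ((1 / u)^2 * t e + (- dev0 u / u^2))"
      using t_pm[OF units_inverse[OF u]] lcong_add[OF lcong_refl dev0_inverse[OF u]] lcong_trans by blast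
    then have "lcong (u * t (pm (1 / u) e)) (u * ((1 / u)^2 * t e + (- dev0 u / u^2)))"
      using unitsD(2)[OF u] by (rule lcong_scale[rotated])
    moreover have "u * ((1 / u)^2 * t e + (- dev0 u / u^2)) = t e / u - dev0 u / u"
      using unitsD(1)[OF u] by (simp add: field_simps power2_eq_square)
    ultimately show ?thesis by (simp add: gal_exp_def)
  qed
  have "lcong (- (gal_exp x e + gal_exp y e)) (r * t e + \<kappa>)" for e
  proof -
    have "lcong (- (gal_exp x e + gal_exp y e)) (- ((t e / x - dev0 x / x) + (t e / y - dev0 y / y)))"
      by (intro lcong_minus lcong_add gal_exp x y)
    moreover have "- ((t e / x - dev0 x / x) + (t e / y - dev0 y / y)) = - (1 / x + 1 / y) * t e + \<kappa>"
      by (simp add: \<kappa>_def algebra_simps)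
    ultimately show ?thesis unfolding inv_sum by (simp add: r_def)
  qed
  then have "D (\<lambda>e. - (gal_exp x e + gal_exp y e)) = D (\<lambda>e. r * t e + \<kappa>)"
    by (intro D_cong) (auto intro!: loc_add loc_minus exp_loc x y loc)
  also have "\<dots> = (\<chi> i j. zpow \<kappa> * ?R $ i $ j)"
    by (simp add: vec_eq_iff zpow_add loc)
  finally have DD: "D (\<lambda>e. - (gal_exp x e + gal_exp y e)) = (\<chi> i j. zpow \<kappa> * ?R $ i $ j)" .
  have "(?A) $ z $ z = zpow \<kappa> * (S ** ?R ** S) $ z $ z"
    unfolding DD by (simp add: matrix_mult_nth sum_distrib_left sum_distrib_right mult_ac)
  also have "(S ** ?R ** S) $ z $ z = zpow (- gal_exp r z) * (Si ** Gm (1 / r)) $ z $ z * zpow (- gal_exp r z)"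
    unfolding S_D_S[OF r] by (simp add: gal_exp_def)
  also have "lcong (- gal_exp r z) (?m)"
  proof -
    have "lcong (dev0 r) (- dev0 (x * y) / (x * y)^2)"
      using dev0_inverse[OF xyu] dev0_minus[OF units_inverse[OF xyu]] by (simp add: r_def)
    then have "lcong ((1 / r) * dev0 r) (- (x * y) * (- dev0 (x * y) / (x * y)^2))"
      unfolding ir[symmetric] using unitsD(3)[OF r] by (rule lcong_scale[rotated])
    moreover have "- (x * y) * (- dev0 (x * y) / (x * y)^2) = \<delta>"
      using x0 y0 by (simp add: \<delta>_def power2_eq_square)
    ultimately have "lcong (dev0 r / r) \<delta>" by simp
    then have "lcong (- (t z / r - dev0 r / r)) (- (t z / r - \<delta>))" by (intro lcong_minus lcong_diff lcong_refl)
    then have "lcong (- gal_exp r z) (- (t z / r - \<delta>))" by (rule lcong_trans[OF lcong_minus[OF gal_exp[OF r]]])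
    moreover have "t z / r = - (x * y) * t z" using ir by (metis divide_inverse inverse_eq_divide mult.commute)
    then have "- (t z / r - \<delta>) = ?m" by simp
    ultimately show ?thesis by (simp only:)
  qed
  then have "zpow (- gal_exp r z) = zpow (?m)"
    by (intro zpow_cong loc_minus loc_add exp_loc r loc)
  also have "(Si ** Gm (1 / r)) $ z $ z = ?q"
  proof -
    \<comment> \<open>The sign of \<open>r\<close> contributes a \<open>C\<close>, which turns
      \<open>Si\<close> into \<open>S\<close>; their rows at \<open>z\<close> agree because they are
      real.\<close>
    have "Gm (1 / r) = C ** Gm (x * y)" unfolding ir using Gm_mult[OF units_1(2) xyu] by (simp add: Gm_minus_1)
    then have "Si ** Gm (1 / r) = S ** Gm (x * y)" by (simp add: matrix_mul_assoc C_comm)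
    then show ?thesis unfolding matrix_mult_nth[of S] matrix_mult_nth[of Si "Gm (x * y)"] by (simp add: matrix_mult_nth S_vacuum_real)
  qed
  finally have 1: "(?A) $ z $ z =
      zpow \<kappa> * (zpow (?m) * ?q * zpow (?m))" .
  have "(C ** A) $ z $ z = A $ z $ z" for A :: "complex^'a^'a"
  proof -
    have "(C ** A) $ z $ z = (\<Sum>k\<in>UNIV. if k = z then A $ z $ z else 0)"
      unfolding matrix_mult_nth by (rule sum.cong) (auto simp: Cp)
    then show ?thesis by simp
  qed
  then have "zpow (dev_exp x z) * ?q * zpow (dev_exp y z) = (?A) $ z $ z"
    using arg_cong[OF sum_relation[OF x y xy], of "\<lambda>M. M $ z $ z"] by simp
  then have e: "zpow (dev_exp x z) * zpow (dev_exp y z) = zpow \<kappa> * (zpow (?m) * zpow (?m))"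
    unfolding 1 using vacuum_row_nonzero[OF xyu, of z] by simp
  have M: "?m \<in> loc" using loc by blast
  have "zpow (dev_exp x z + dev_exp y z) = zpow (\<kappa> + ((?m) + (?m)))"
    unfolding zpow_add[OF exp_loc(2)[OF x] exp_loc(2)[OF y]] zpow_add[OF loc(1) loc_add[OF M M]] zpow_add[OF M M] by (rule e)
  then have "lcong (dev_exp x z + dev_exp y z) (\<kappa> + ((?m) + (?m)))"
    by (subst (asm) zpow_eq_iff) (intro loc_add exp_loc(2) x y loc(1) M)+
  then have "lcong ((\<kappa> + ((?m) + (?m))) - (dev_exp x z + dev_exp y z)) 0"
    using lcong_sym lcong_iff_0 by blast
  moreover have "dev_exp x z = x * y * t z - dev0 x" "dev_exp y z = x * y * t z - dev0 y"
    using dev_exp_eq[OF xy, of z] dev_exp_eq[of y x z] xy by (simp_all add: dev0_def add.commute mult.commute[of y])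
  ultimately show ?thesis unfolding \<kappa>_def \<delta>_def by (simp add: algebra_simps)
qed

lemma lcong_unit_cancel: "q \<in> units \<Longrightarrow> lcong (q * a) 0 \<Longrightarrow> lcong a 0"
  using lcong_scale[of "1 / q" "q * a" 0] by (simp add: unitsD)

text \<open>Take \<open>x = y = 1/2\<close>. The cocycle rule makes \<open>dev0 (1/4)\<close> equal
  to 5/4 of \<open>dev0 (1/2)\<close>, and the relation collapses to \<open>16 * dev0 (1/2)\<close>,
  with 16 a unit.\<close>

lemma dev0_2: "lcong (dev0 2) 0"
proof -
  have h: "1 / 2 \<in> units" using two_unit by blast
  have q: "lcong (dev0 (1 / 4)) (dev0 (1 / 2) + (1 / 2)^2 * dev0 (1 / 2))" using dev0_mult[OF h h] by simp
  have e: "lcong (dev0 (1 / 2) / (1 / 2) + dev0 (1 / 2) / (1 / 2) + 2 * (dev0 (1 / 4) / (1 / 4)) + dev0 (1 / 2) + dev0 (1 / 2)) 0"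
    using dev0_sum_relation[OF h h] by simp
  have "lcong (8 * dev0 (1 / 4)) (8 * (dev0 (1 / 2) + (1 / 2)^2 * dev0 (1 / 2)))"
    using q by (rule lcong_scale[rotated]) simp
  from lcong_diff[OF e this]
  have "lcong (6 * dev0 (1 / 2)) (- 10 * dev0 (1 / 2))" by (simp add: power2_eq_square algebra_simps)
  then have "lcong (6 * dev0 (1 / 2) - (- 10 * dev0 (1 / 2))) 0" using lcong_iff_0 by blast
  then have "lcong (16 * dev0 (1 / 2)) 0" by simp
  moreover have "2 * (2 * (2 * 2)) \<in> units" using two_unit by blast
  then have "16 \<in> units" by simp
  ultimately have half: "lcong (dev0 (1 / 2)) 0" using lcong_unit_cancel by blast
  have "lcong 0 (dev0 2 + 2^2 * dev0 (1 / 2))" using dev0_mult[OF two_unit h] by (simp add: dev0_1)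
  moreover have "lcong (dev0 2 + 2^2 * dev0 (1 / 2)) (dev0 2 + 2^2 * 0)"
    by (intro lcong_add lcong_scale half) simp_all
  ultimately have "lcong 0 (dev0 2)" using lcong_trans by fastforce
  then show ?thesis by (rule lcong_sym)
qed

text \<open>Expanding \<open>dev0 (2 * x)\<close> by the cocycle rule in both orders and dropping
  \<open>dev0 2\<close> leaves \<open>4 * dev0 x\<close> on one side and \<open>dev0 x\<close> on
  the other.\<close>

lemma dev0_three_torsion: assumes x: "x \<in> units" shows "lcong (3 * dev0 x) 0"
proof -
  have "lcong (dev0 (2 * x)) (dev0 2 + 2^2 * dev0 x)" "lcong (dev0 (2 * x)) (dev0 x + x^2 * dev0 2)"
    using dev0_mult[OF two_unit x] dev0_mult[OF x two_unit] by (simp_all add: mult.commute)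
  then have "lcong (dev0 2 + 2^2 * dev0 x) (dev0 x + x^2 * dev0 2)" using lcong_sym lcong_trans by blast
  moreover have "lcong (dev0 x + x^2 * dev0 2) (dev0 x + x^2 * 0)"
    using unitsD(2)[OF x] by (intro lcong_add lcong_scale dev0_2 loc_power) simp_all
  ultimately have "lcong (dev0 2 + 2^2 * dev0 x) (dev0 x)" using lcong_trans by fastforce
  from lcong_diff[OF this dev0_2] have "lcong (4 * dev0 x) (dev0 x)" by simp
  then have "lcong (4 * dev0 x - dev0 x) 0" using lcong_iff_0 by blast
  then show ?thesis by simp
qed

lemma cong_res_3: "3 dvd N \<Longrightarrow> [a = b] (mod int N) \<Longrightarrow> [a = b] (mod 3)"
  using cong_dvd_modulus[of a b "int N" 3] int_dvd_int_iff[of 3 N] by simp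

text \<open>By 3-torsion, a coefficient of \<open>dev0 x\<close> matters only modulo 3.\<close>

lemma lcong_mod_3:
  assumes "3 dvd N" "q \<in> loc" "[res q = j] (mod 3)" "x \<in> units"
  shows "lcong (q * dev0 x) (of_int j * dev0 x)"
proof -
  obtain i where i: "res q = j + 3 * i" using assms(3) by (metis cong_iff_lin cong_sym)
  have "lcong (q * dev0 x) (of_int (res q) * dev0 x)"
    using lcong_mult[OF assms(2) dev0_loc[OF assms(4)] lcong_res[OF assms(2)] lcong_refl] .
  moreover have "of_int (res q) * dev0 x = of_int j * dev0 x + of_int i * (3 * dev0 x)"
    by (simp add: i algebra_simps)
  moreover have "lcong (of_int j * dev0 x + of_int i * (3 * dev0 x)) (of_int j * dev0 x + of_int i * 0)"
    by (intro lcong_add lcong_refl lcong_scale loc_of_int dev0_three_torsion assms)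
  ultimately show ?thesis using lcong_trans by fastforce
qed

lemma res_unit_3: "3 dvd N \<Longrightarrow> x \<in> units \<Longrightarrow> \<not> [res x = 0] (mod 3)"
proof
  assume N3: "3 dvd N" and x: "x \<in> units" and c: "[res x = 0] (mod 3)"
  have "prime (3::nat)" by simp
  then have "\<not> int 3 dvd res x"
    using coprime_res[OF x] N3 unfolding coprime_int_iff_prime[OF N_pos] by blast
  then show False using c by (simp add: cong_0_iff)
qed

text \<open>Squares of units are 1 modulo 3, so the twist in the cocycle rule disappears.\<close>

lemma dev0_additive:
  assumes N3: "3 dvd N" and x: "x \<in> units" and y: "y \<in> units"
  shows "lcong (dev0 (x * y)) (dev0 x + dev0 y)"
proof -
  have "[res (x^2) = res x * res x] (mod 3)"
    unfolding power2_eq_square by (rule cong_res_3[OF N3 res_mult]) (use x unitsD in auto)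
  moreover have "[res x * res x = 1] (mod 3)"
  proof -
    have "res x mod 3 = 1 \<or> res x mod 3 = 2" using res_unit_3[OF N3 x] unfolding cong_def by presburger
    then show ?thesis unfolding cong_def by (auto simp: mod_mult_eq[of "res x" 3 "res x", symmetric])
  qed
  ultimately have "[res (x^2) = 1] (mod 3)" by (rule cong_trans)
  then have "lcong (x^2 * dev0 y) (of_int 1 * dev0 y)"
    using unitsD(2)[OF x] by (intro lcong_mod_3 N3 y loc_power)
  then have "lcong (dev0 x + x^2 * dev0 y) (dev0 x + dev0 y)" by (intro lcong_add lcong_refl) simp
  then show ?thesis using dev0_mult[OF x y] lcong_trans by blast
qed

text \<open>Two units with sum 1 are both -1 modulo 3. All coefficients in
  \<open>dev0_sum_relation\<close> then become signs, and twice the claimed sum is left.\<close>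

lemma dev0_reflect:
  assumes N3: "3 dvd N" and x: "x \<in> units" and y: "y \<in> units" and xy: "x + y = 1"
  shows "lcong (dev0 x + dev0 y) 0"
proof -
  have "[res (x + y) = res x + res y] (mod int N)" using x y unitsD by (intro res_add)
  then have s: "[1 = res x + res y] (mod 3)"
    using xy res_of_int[of 1] by (intro cong_res_3[OF N3]) (metis cong_sym cong_trans of_int_1)
  have m: "res x mod 3 = 2" "res y mod 3 = 2"
    using s res_unit_3[OF N3 x] res_unit_3[OF N3 y] unfolding cong_def by presburger+
  have inv: "[res (1 / u) * res u = 1] (mod 3)" if "u \<in> units" for u
  proof -
    have "[res (1 / u) * res u = res (1 / u * u)] (mod int N)"
      using unitsD that by (intro cong_sym[OF res_mult]) auto
    moreover have "1 / u * u = of_int 1" using unitsD(1)[OF that] by simp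
    ultimately show ?thesis using res_of_int[of 1] by (intro cong_res_3[OF N3]) (metis cong_trans)
  qed
  have i: "[res (1 / x) = - 1] (mod 3)" "[res (1 / y) = - 1] (mod 3)"
  proof -
    have *: "[a = - 1] (mod 3)" if "[a * b = 1] (mod 3)" "b mod 3 = 2" for a b :: int
    proof -
      have "[a * b = a * 2] (mod 3)" using that(2) by (intro cong_mult) (simp_all add: cong_def)
      then have "[a * 2 = 1] (mod 3)" using that(1) cong_sym cong_trans by blast
      then obtain j where "a * 2 - 1 = 3 * j" by (auto simp: cong_iff_dvd_diff elim: dvdE)
      then have "a - (- 1) = 3 * (a - j)" by presburger
      then show ?thesis by (metis cong_iff_dvd_diff dvd_triv_left)
    qed
    show "[res (1 / x) = - 1] (mod 3)" "[res (1 / y) = - 1] (mod 3)"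
      using *[OF inv[OF x] m(1)] *[OF inv[OF y] m(2)] .
  qed
  have xyu: "x * y \<in> units" using x y by blast
  have "[res (1 / (x * y)) = res (1 / x) * res (1 / y)] (mod 3)"
    using res_mult[of "1 / x" "1 / y"] unitsD x y by (intro cong_res_3[OF N3]) simp
  then have ixy: "[res (1 / (x * y)) = 1] (mod 3)"
    using cong_mult[OF i] by (metis cong_trans minus_mult_minus mult_1)
  have 1: "lcong (dev0 x / x) (- dev0 x)" "lcong (dev0 y / y) (- dev0 y)"
    using lcong_mod_3[OF N3 _ i(1) x] lcong_mod_3[OF N3 _ i(2) y] unitsD(3) x y by simp_all
  have "lcong (dev0 (x * y) / (x * y)) (dev0 (x * y))"
    using lcong_mod_3[OF N3 _ ixy xyu] unitsD(3)[OF xyu] by simp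
  then have "lcong (dev0 (x * y) / (x * y)) (dev0 x + dev0 y)" using dev0_additive[OF N3 x y] lcong_trans by blast
  then have 2: "lcong (2 * (dev0 (x * y) / (x * y))) (2 * (dev0 x + dev0 y))" by (intro lcong_scale) simp_all
  have e: "lcong (dev0 x / x + dev0 y / y + 2 * (dev0 (x * y) / (x * y)) + dev0 x + dev0 y)
      (- dev0 x + - dev0 y + 2 * (dev0 x + dev0 y) + dev0 x + dev0 y)"
    by (intro lcong_add 1 2 lcong_refl)
  have eq: "- dev0 x + - dev0 y + 2 * (dev0 x + dev0 y) + dev0 x + dev0 y = 2 * (dev0 x + dev0 y)" by simp
  have "lcong (2 * (dev0 x + dev0 y)) 0"
    using lcong_trans[OF lcong_sym[OF e] dev0_sum_relation[OF x y xy]] unfolding eq .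
  then show ?thesis using lcong_unit_cancel[OF two_unit] by blast
qed

text \<open>If \<open>w = 1 + 3 n\<close> then \<open>w\<close> is reached from \<open>n\<close> by two additions, \<open>n + 1\<close> and
  \<open>(n + 1) + 2 n\<close>, and the resulting signs cancel.\<close>
lemma dev0_4_mod_9:
  fixes w :: int
  assumes N3: "3 dvd N" and w: "[w = 4] (mod 9)"
    and p: "\<And>p. prime p \<Longrightarrow> p dvd N \<Longrightarrow> p \<noteq> 3 \<Longrightarrow> \<not> int p dvd w \<and> \<not> int p dvd w - 1 \<and> \<not> int p dvd w + 2"
  shows "lcong (dev0 (of_int w)) 0"
proof -
  obtain j where j: "w - 4 = 9 * j" using w by (auto simp: cong_iff_dvd_diff elim: dvdE)
  \<comment> \<open>The class 4 modulo 9 makes \<open>n\<close> congruent to 1 modulo 3, so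
    \<open>n\<close>, \<open>n + 1\<close> and \<open>w\<close> are all prime to 3.\<close>
  define n where "n = 1 + 3 * j"
  have n: "w = 3 * n + 1" using j by (simp add: n_def)
  have three: "\<not> 3 dvd n" "\<not> 3 dvd n + 1" "\<not> 3 dvd w" unfolding n n_def by presburger+
  then have n0: "n \<noteq> 0" "n + 1 \<noteq> 0" "w \<noteq> 0" by auto
  have "\<not> int q dvd n \<and> \<not> int q dvd n + 1 \<and> \<not> int q dvd w" if q: "prime q" "q dvd N" for q
  proof (cases "q = 3")
    case True
    then show ?thesis using three by simp
  next
    case False
    have "w - 1 = 3 * n" "w + 2 = 3 * (n + 1)" using n by simp_all
    then show ?thesis using p[OF q False] by (metis dvd_mult)
  qed
  then have "coprime n (int N)" "coprime (n + 1) (int N)" "coprime w (int N)"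
    unfolding coprime_int_iff_prime[OF N_pos] by blast+
  then have u: "of_int n \<in> units" "of_int (n + 1) \<in> units" "of_int w \<in> units"
    unfolding units_of_int using n0 by auto
  define m :: rat where "m = of_int n"
  have m: "m \<in> units" "m + 1 \<in> units" "of_int w = 3 * m + 1" "3 * m + 1 \<in> units"
    using u n by (simp_all add: m_def)
  have m0: "m \<noteq> 0" by (rule unitsD(1)[OF m(1)])
  \<comment> \<open>Dividing the second addition by \<open>2 * m\<close> turns it into the step from
    \<open>v\<close> to \<open>v + 1\<close>, to which \<open>dev0_reflect\<close> applies.\<close>
  define v where "v = (m + 1) / (2 * m)"
  have m2: "2 * m \<in> units" using two_unit m(1) by blast
  have v: "v \<in> units" unfolding v_def by (rule units_divide[OF m(2) m2])
  have "v + 1 = (3 * m + 1) / (2 * m)" unfolding v_def using m0 by (simp add: field_simps)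
  then have v1: "v + 1 \<in> units" "3 * m + 1 = (v + 1) * (2 * m)" "m + 1 = v * (2 * m)"
    using units_divide[OF m(4) m2] m0 by (simp_all add: v_def)
  have a: "lcong (dev0 m + dev0 (m + 1)) 0"
    using dev0_reflect[OF N3 units_minus[OF m(1)] m(2)] by (simp add: dev0_minus m)
  have b: "lcong (dev0 v + dev0 (v + 1)) 0"
    using dev0_reflect[OF N3 units_minus[OF v] v1(1)] by (simp add: dev0_minus v)
  have "lcong (dev0 (2 * m)) (dev0 2 + dev0 m)" by (rule dev0_additive[OF N3 two_unit m(1)])
  then have c: "lcong (dev0 (2 * m)) (0 + dev0 m)" using lcong_add[OF dev0_2 lcong_refl[of "dev0 m"]] lcong_trans by blast
  have d: "lcong (dev0 (m + 1)) (dev0 v + dev0 m)"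
    unfolding v1(3) using lcong_trans[OF dev0_additive[OF N3 v m2]] lcong_add[OF lcong_refl c] by simp
  have e: "lcong (dev0 (3 * m + 1)) (dev0 (v + 1) + dev0 m)"
    unfolding v1(2) using lcong_trans[OF dev0_additive[OF N3 v1(1) m2]] lcong_add[OF lcong_refl c] by simp
  have f: "lcong (dev0 (v + 1)) (- dev0 v)" using lcong_diff[OF b lcong_refl[of "dev0 v"]] by simp
  \<comment> \<open>From here \<open>dev0 v\<close> is \<open>- 2 * dev0 m\<close>, so
    \<open>dev0 (v + 1)\<close> is \<open>2 * dev0 m\<close>, and one more \<open>dev0 m\<close>
    completes a multiple of 3.\<close>
  have "lcong (dev0 v) (dev0 (m + 1) - dev0 m)" using lcong_diff[OF lcong_sym[OF d] lcong_refl[of "dev0 m"]] by simp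
  moreover have "lcong (dev0 (m + 1) - dev0 m) (- dev0 m - dev0 m)"
    using lcong_diff[OF a lcong_refl[of "dev0 m"]] by (intro lcong_diff lcong_refl) simp
  ultimately have g: "lcong (dev0 v) (- dev0 m - dev0 m)" using lcong_trans by blast
  have "lcong (dev0 (v + 1)) (- (- dev0 m - dev0 m))" using lcong_trans[OF f lcong_minus[OF g]] .
  from lcong_add[OF this lcong_refl[of "dev0 m"]] have "lcong (dev0 (v + 1) + dev0 m) (3 * dev0 m)" by simp
  then show ?thesis unfolding m(3) using e dev0_three_torsion[OF m(1)] lcong_trans by blast
qed

text \<open>Write \<open>k\<close> as the quotient of \<open>w * k\<close> by \<open>w\<close>, both
  in the class 4 modulo 9. For \<open>p\<close> at least 7 the candidates 2, 3, 4 for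
  \<open>w\<close> avoid 0, 1 and -2, and each of the two conditions on \<open>w * k\<close>
  excludes at most one of them. Modulo 5 only 2 and 4 are left for \<open>w\<close>, and both fail
  exactly when \<open>k\<close> is 4.\<close>

lemma dev0_1_mod_9:
  fixes k :: int
  assumes N3: "3 dvd N" and k: "coprime k (int N)" "[k = 1] (mod 9)" and k5: "5 dvd N \<Longrightarrow> \<not> [k = 4] (mod 5)"
  shows "lcong (dev0 (of_int k)) 0"
proof -
  define bad where "bad p a \<longleftrightarrow> int p dvd a * k - 1 \<or> int p dvd a * k + 2" for p :: nat and a :: int
  define r :: "nat \<Rightarrow> int" where
    "r p = (if p = 3 then 4 else if p = 5 then (if [k = 3] (mod 5) then 4 else 2)
      else if \<not> bad p 2 then 2 else if \<not> bad p 3 then 3 else 4)" for p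
  obtain w where w: "w > 0" "\<And>p. prime p \<Longrightarrow> p dvd N \<Longrightarrow> [w = r p] (mod int p)" "[w = r 3] (mod 9)"
    using simultaneous_residues_large[OF N_pos] N3 by metis
  then have w9: "[w = 4] (mod 9)" by (simp add: r_def)
  have main: "\<not> int p dvd w \<and> \<not> int p dvd w - 1 \<and> \<not> int p dvd w + 2 \<and> \<not> int p dvd w * k - 1 \<and> \<not> int p dvd w * k + 2 \<and> \<not> int p dvd w * k"
    if p: "prime p" "p dvd N" "p \<noteq> 3" for p
  proof -
    have p5: "p \<ge> 5" using prime_ge_5[OF p(1,2) odd_N p(3)] .
    have pk: "\<not> int p dvd k" using k(1) p unfolding coprime_int_iff_prime[OF N_pos] by blast
    note wp = w(2)[OF p(1,2)]
    have prime_p: "prime (int p)" using p(1) by simp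
    have *: "\<not> int p dvd r p \<and> \<not> int p dvd r p - 1 \<and> \<not> int p dvd r p + 2 \<and> \<not> bad p (r p)"
    proof (cases "p = 5")
      case True
      have "k mod 5 \<noteq> 0" using pk True by (simp add: dvd_eq_mod_eq_0)
      moreover have "k mod 5 \<noteq> 4" using k5 p(2) True by (simp add: cong_def)
      moreover have "0 \<le> k mod 5" "k mod 5 < 5" by simp_all
      ultimately have "k mod 5 = 1 \<or> k mod 5 = 2 \<or> k mod 5 = 3" by linarith
      then consider "k mod 5 = 1" | "k mod 5 = 2" | "k mod 5 = 3" by blast
      then show ?thesis
      proof cases
        case 1
        then have "r p = 2" using True by (simp add: r_def cong_def)
        moreover obtain q where "k = 5 * q + 1" using mult_div_mod_eq[of 5 k] 1 by metis
        then have "2 * k - 1 = 5 * (2 * q + 0) + 1" "2 * k + 2 = 5 * (2 * q + 0) + 4" by simp_all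
        then have "(2 * k - 1) mod 5 = 1" "(2 * k + 2) mod 5 = 4" by (simp_all only: mod_mult_self4) simp_all
        ultimately show ?thesis using True by (simp add: bad_def dvd_eq_mod_eq_0)
      next
        case 2
        then have "r p = 2" using True by (simp add: r_def cong_def)
        moreover obtain q where "k = 5 * q + 2" using mult_div_mod_eq[of 5 k] 2 by metis
        then have "2 * k - 1 = 5 * (2 * q + 0) + 3" "2 * k + 2 = 5 * (2 * q + 1) + 1" by simp_all
        then have "(2 * k - 1) mod 5 = 3" "(2 * k + 2) mod 5 = 1" by (simp_all only: mod_mult_self4) simp_all
        ultimately show ?thesis using True by (simp add: bad_def dvd_eq_mod_eq_0)
      next
        case 3
        then have "r p = 4" using True by (simp add: r_def cong_def)
        moreover obtain q where "k = 5 * q + 3" using mult_div_mod_eq[of 5 k] 3 by metis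
        then have "4 * k - 1 = 5 * (4 * q + 2) + 1" "4 * k + 2 = 5 * (4 * q + 2) + 4" by simp_all
        then have "(4 * k - 1) mod 5 = 1" "(4 * k + 2) mod 5 = 4" by (simp_all only: mod_mult_self4) simp_all
        ultimately show ?thesis using True by (simp add: bad_def dvd_eq_mod_eq_0)
      qed
    next
      case False
      have "p \<noteq> 6" using p(1) by auto
      then have p7: "int p \<ge> 7" using p5 False by simp
      have sm: "\<not> int p dvd j" if "0 < j" "j < 7" for j using zdvd_imp_le[of "int p" j] p7 that by auto
      have kk: "\<not> int p dvd j * k" if "0 < j" "j < 7" for j
        using prime_dvd_mult_iff[OF prime_p] pk sm[OF that] by blast
      have diff: False if "int p dvd a * k + c" "int p dvd b * k + c" "0 < b - a" "b - a < 7" for a b c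
      proof -
        have "int p dvd (b * k + c) - (a * k + c)" using that by (intro dvd_diff)
        then have "int p dvd (b - a) * k" by (simp add: left_diff_distrib)
        then show False using kk that(3,4) by blast
      qed
      have m: "\<not> (int p dvd a * k - 1 \<and> int p dvd b * k - 1)" "\<not> (int p dvd a * k + 2 \<and> int p dvd b * k + 2)"
        if "0 < b - a" "b - a < 7" for a b
        using diff[of a "- 1" b] diff[of a 2 b] that by auto
      have "\<not> bad p (r p)"
        using m[of 3 2] m[of 4 2] m[of 4 3] p(3) False unfolding r_def bad_def by auto
      moreover have "r p = 2 \<or> r p = 3 \<or> r p = 4" using p(3) False by (simp add: r_def)
      ultimately show ?thesis
        using sm[of 1] sm[of 2] sm[of 3] sm[of 4] sm[of 5] sm[of 6] by auto
    qed
    have "[w * k = r p * k] (mod int p)" using wp by (intro cong_mult cong_refl)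
    then have "[w * k - 1 = r p * k - 1] (mod int p)" "[w * k + 2 = r p * k + 2] (mod int p)"
      "[w - 1 = r p - 1] (mod int p)" "[w + 2 = r p + 2] (mod int p)"
      using wp by (auto intro!: cong_diff cong_add)
    moreover have "\<not> int p dvd w" using not_dvd_cong[OF wp] * by blast
    moreover from this have "\<not> int p dvd w * k" using prime_dvd_mult_iff[OF prime_p] pk by blast
    ultimately show ?thesis using * not_dvd_cong unfolding bad_def by metis
  qed
  have "lcong (dev0 (of_int w)) 0"
    by (rule dev0_4_mod_9[OF N3 w9]) (use main in blast)
  moreover have "[w * k = 4 * 1] (mod 9)" by (rule cong_mult[OF w9 k(2)])
  then have "lcong (dev0 (of_int (w * k))) 0"
    by (intro dev0_4_mod_9[OF N3]) (use main in \<open>simp; blast\<close>)+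
  moreover have "coprime w (int N)"
    unfolding coprime_int_iff_prime[OF N_pos]
  proof (intro allI impI)
    fix p assume p: "prime p" "p dvd N"
    show "\<not> int p dvd w"
    proof (cases "p = 3")
      case True
      have "[w = 4] (mod 3)" using w9 by (rule cong_dvd_modulus) simp
      then have "\<not> 3 dvd w" by (rule not_dvd_cong) simp
      then show ?thesis using True by simp
    qed (use main p in blast)
  qed
  then have "of_int w \<in> units" using w(1) by (simp add: units_of_int)
  moreover have "k \<noteq> 0" using k(2) by (auto simp: cong_def)
  then have "of_int k \<in> units" using k(1) by (simp add: units_of_int)
  ultimately have "lcong (dev0 (of_int w) + dev0 (of_int k)) 0" "lcong (dev0 (of_int w)) 0"
    using dev0_additive[OF N3, of "of_int w" "of_int k"] lcong_sym lcong_trans by (metis of_int_mult)+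
  from lcong_diff[OF this] show ?thesis by simp
qed

text \<open>If 3 is a unit, torsion suffices. Otherwise \<open>dev0 4\<close> vanishes, so factors 4
  are free. Up to sign a unit is 1 modulo 3, hence 1, 4 or 7 modulo 9, and multiplication by 1, 16
  or 4 leads to the class 1.\<close>

lemma dev0_zero: assumes x: "x \<in> units" shows "lcong (dev0 x) 0"
proof (cases "3 dvd N")
  case False
  have "prime (3::nat)" by simp
  then have "coprime 3 N" using False by (rule prime_imp_coprime)
  then have "coprime (3::int) (int N)" by (metis coprime_int_iff of_nat_numeral)
  then have "3 \<in> units" using units_of_int[of 3] by simp
  then show ?thesis using dev0_three_torsion[OF x] lcong_unit_cancel by blast
next
  case N3: True
  have unit: "of_int j \<in> units" if "coprime j (int N)" "j \<noteq> 0" for j using that by (simp add: units_of_int)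
  have c4: "coprime 4 (int N)"
  proof -
    have "coprime (2::int) (int N)" using odd_N by simp
    then have "coprime (2 * 2 :: int) (int N)" by (simp only: coprime_mult_left_iff)
    then show ?thesis by simp
  qed
  have "lcong (dev0 (2 * 2)) (dev0 2 + dev0 2)" by (rule dev0_additive[OF N3 two_unit two_unit])
  then have cc4: "lcong (dev0 4) 0" using lcong_add[OF dev0_2 dev0_2] lcong_trans by fastforce
  have quad: "lcong (dev0 (of_int j)) 0" if j: "coprime j (int N)" "j \<noteq> 0" "lcong (dev0 (of_int (4 * j))) 0" for j
  proof -
    have "4 \<in> units" using unit[OF c4] by simp
    then have "lcong (dev0 (of_int (4 * j))) (dev0 4 + dev0 (of_int j))"
      using dev0_additive[OF N3 _ unit[OF j(1,2)], of 4] by simp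
    then have "lcong (dev0 4 + dev0 (of_int j)) 0" using j(3) lcong_sym lcong_trans by blast
    from lcong_diff[OF this cc4] show ?thesis by simp
  qed
  have A: "lcong (dev0 (of_int j)) 0" if j: "coprime j (int N)" "[j = 1] (mod 9)" for j
  proof (cases "[j = 4] (mod 5)")
    case False
    then show ?thesis using dev0_1_mod_9[OF N3 j] by blast
  next
    case True
    \<comment> \<open>The power 64 of 4 is 1 modulo 9 and 4 modulo 5: it keeps the class modulo 9
      and moves the forbidden class 4 modulo 5 to 1.\<close>
    have "[64 * j = 64 * 1] (mod 9)" "[64 * j = 64 * 4] (mod 5)" by (rule cong_mult[OF cong_refl j(2)], rule cong_mult[OF cong_refl True])
    then have "[64 * j = 1] (mod 9)" "\<not> [64 * j = 4] (mod 5)" by (auto simp: cong_def)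
    moreover have "coprime (4 * (4 * (4 * j))) (int N)" using c4 j(1) by (simp only: coprime_mult_left_iff)
    then have "coprime (64 * j) (int N)" by simp
    ultimately have "lcong (dev0 (of_int (4 * (4 * (4 * j))))) 0" using dev0_1_mod_9[OF N3, of "64 * j"] by simp
    moreover have "j \<noteq> 0" using j(2) by (auto simp: cong_def)
    moreover have "coprime (4 * j) (int N)" "coprime (4 * (4 * j)) (int N)"
      using c4 j(1) by (simp_all only: coprime_mult_left_iff)
    ultimately show ?thesis using quad[of "4 * (4 * j)"] quad[of "4 * j"] quad[OF j(1)] by simp
  qed
  have B: "lcong (dev0 (of_int j)) 0" if j: "coprime j (int N)" "j mod 3 = 1" for j
  proof -
    have j0: "j \<noteq> 0" using j(2) by auto
    have "j mod 9 mod 3 = 1" using j(2) by (simp add: mod_mod_cancel)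
    moreover have "j mod 9 \<in> {0..<9}" by simp
    moreover have "{0..<9} = {0, 1, 2, 3, 4, 5, 6, 7, 8 :: int}" by auto
    ultimately have "j mod 9 = 1 \<or> j mod 9 = 4 \<or> j mod 9 = 7" by auto
    then consider "j mod 9 = 1" | "j mod 9 = 4" | "j mod 9 = 7" by blast
    then show ?thesis
    proof cases
      case 1
      then show ?thesis by (intro A j(1)) (simp add: cong_def)
    next
      case 2
      obtain q where "j = 9 * q + 4" using mult_div_mod_eq[of 9 j] 2 by metis
      then have "16 * j = 9 * (16 * q + 7) + 1" by simp
      then have "16 * j mod 9 = 1" by (simp only: mod_mult_self4) simp
      moreover have "coprime (4 * (4 * j)) (int N)" using c4 j(1) by (simp only: coprime_mult_left_iff)
      then have "coprime (16 * j) (int N)" by simp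
      ultimately have "lcong (dev0 (of_int (4 * (4 * j)))) 0" using A[of "16 * j"] by (simp add: cong_def)
      then show ?thesis using c4 j(1) j0 by - (rule quad[OF _ _ quad]; simp)
    next
      case 3
      obtain q where "j = 9 * q + 7" using mult_div_mod_eq[of 9 j] 3 by metis
      then have "4 * j = 9 * (4 * q + 3) + 1" by simp
      then have "4 * j mod 9 = 1" by (simp only: mod_mult_self4) simp
      moreover have "coprime (4 * j) (int N)" using c4 j(1) by simp
      ultimately have "lcong (dev0 (of_int (4 * j))) 0" using A[of "4 * j"] by (simp add: cong_def)
      then show ?thesis by (rule quad[OF j(1) j0])
    qed
  qed
  obtain k where k: "k > 0" "coprime k (int N)" "lcong x (of_int k)"
    using units_representative[OF x] by metis
  have ku: "of_int k \<in> units" using unit k by simp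
  have three: "prime (3::nat)" by simp
  have "\<not> int 3 dvd k"
    using k(2) N3 unfolding coprime_int_iff_prime[OF N_pos] by (metis three)
  then have "k mod 3 = 1 \<or> - k mod 3 = 1" by presburger
  then have "lcong (dev0 (of_int k)) 0"
  proof
    assume "- k mod 3 = 1"
    then have "lcong (dev0 (of_int (- k))) 0" using k by (intro B) simp_all
    then show ?thesis using dev0_minus[OF ku] by simp
  qed (rule B[OF k(2)])
  then show ?thesis using dev0_cong[OF x ku k(3)] lcong_trans by blast
qed

theorem t_pm_exact: "x \<in> units \<Longrightarrow> lcong (t (pm x e)) (x^2 * t e)"
  using lcong_trans[OF t_pm[of x e] lcong_add[OF lcong_refl dev0_zero[of x]]] by simp

end

section \<open>The big cell formula\<close>

context odd_level_data
begin

lemma unitsI: assumes "q \<in> loc" "q \<noteq> 0" "coprime (res q) (int N)" shows "q \<in> units"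
proof -
  define k where "k = res q mod int N + int N"
  have "k > 0" using N_pos by (simp add: k_def add_nonneg_pos)
  have c: "[k = res q] (mod int N)" by (simp add: k_def cong_def)
  then have "coprime k (int N)" using assms(3) by (metis cong_imp_coprime cong_sym)
  then have "of_int k \<in> units" using \<open>k > 0\<close> by (simp add: units_of_int)
  moreover have "lcong (of_int k) q" using c lcong_of_int lcong_trans[OF _ lcong_sym[OF lcong_res[OF assms(1)]]] by blast
  ultimately show ?thesis using loc_lcong_unit assms(1,2) by blast
qed

text \<open>Powers of \<open>T\<close> with exponents in \<open>loc\<close>, in the role of upper
  unipotent matrices.\<close>

definition E :: "rat \<Rightarrow> complex^'a^'a" where "E q = D (\<lambda>e. q * t e)"

lemma E_loc: "q \<in> loc \<Longrightarrow> q * t e \<in> loc"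
  by (intro loc_mult) simp_all

lemma E_add: "q \<in> loc \<Longrightarrow> r \<in> loc \<Longrightarrow> E q ** E r = E (q + r)"
  by (simp add: E_def D_mult E_loc distrib_right)

lemma E_cong: "q \<in> loc \<Longrightarrow> r \<in> loc \<Longrightarrow> lcong q r \<Longrightarrow> E q = E r"
  unfolding E_def by (intro D_cong E_loc) (use lcong_mult[OF _ _ _ lcong_refl] t_loc in auto)

lemma E_0 [simp]: "E 0 = mat 1"
  by (simp add: E_def)

lemma E_1: "E 1 = T"
  by (simp add: E_def T_D[symmetric])

lemma E_inverse: "q \<in> loc \<Longrightarrow> E q ** E (- q) = mat 1" "q \<in> loc \<Longrightarrow> E (- q) ** E q = mat 1"
  by (simp_all add: E_add loc_minus)

lemma Gm_E: assumes x: "x \<in> units" and q: "q \<in> loc" shows "Gm x ** E q = E (q / x^2) ** Gm x"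
proof -
  have l: "1 / x \<in> units" using x by blast
  have "lcong (q * t (pm (1 / x) e)) (q * ((1 / x)^2 * t e))" for e
    using t_pm_exact[OF l] q by (rule lcong_scale[rotated])
  then have "D (\<lambda>e. q * t (pm (1 / x) e)) = D (\<lambda>e. q * ((1 / x)^2 * t e))"
    using q unitsD(2)[OF l] by (intro D_cong loc_mult loc_power) simp_all
  moreover have "q * ((1 / x)^2 * t e) = q / x^2 * t e" for e by (simp add: power_divide)
  ultimately show ?thesis unfolding E_def Gm_D[OF x] by simp
qed

lemma C_Gm: "x \<in> units \<Longrightarrow> C ** Gm x = Gm (- x)" "x \<in> units \<Longrightarrow> Gm x ** C = Gm (- x)"
  using Gm_mult[of "- 1" x] Gm_mult[of x "- 1"] by (simp_all add: Gm_minus_1)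

lemma C_E: "q \<in> loc \<Longrightarrow> C ** E q = E q ** C"
  using Gm_E[of "- 1" q] by (simp add: Gm_minus_1)

text \<open>The big cell decomposition of the lower unipotent matrix with entry \<open>- x\<close>,
  which requires \<open>x\<close> to be a unit.\<close>

lemma S_E_S:
  assumes x: "x \<in> units"
  shows "Si ** E x ** S = E (- 1 / x) ** S ** Gm (1 / x) ** E (- 1 / x)"
proof -
  have l: "1 / x \<in> units" using x by blast
  have "lcong (- (x * t (pm (1 / x) e))) (- (x * ((1 / x)^2 * t e)))" for e
    by (intro lcong_minus lcong_scale t_pm_exact l unitsD(2) x)
  moreover have "- (x * ((1 / x)^2 * t e)) = - 1 / x * t e" for e
    using unitsD(1)[OF x] by (simp add: field_simps power2_eq_square)
  ultimately have "D (\<lambda>e. - (x * t (pm (1 / x) e))) = E (- 1 / x)"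
    unfolding E_def using unitsD(2)[OF x] unitsD(2)[OF l] unitsD(2)[OF units_minus[OF l]]
    by (intro D_cong loc_minus loc_mult) auto
  then have "S ** E x ** S = E (- 1 / x) ** (Si ** Gm (1 / x)) ** E (- 1 / x)"
    using S_D_S[OF x] by (simp add: E_def)
  then have "C ** (S ** E x ** S) = C ** (E (- 1 / x) ** (Si ** Gm (1 / x)) ** E (- 1 / x))" by simp
  then have "(C ** S) ** E x ** S = (C ** E (- 1 / x)) ** Si ** Gm (1 / x) ** E (- 1 / x)"
    by (simp only: matrix_mul_assoc)
  also have "C ** E (- 1 / x) = E (- 1 / x) ** C" using unitsD(2)[OF units_minus[OF l]] by (intro C_E) simp
  also have "E (- 1 / x) ** C ** Si ** Gm (1 / x) ** E (- 1 / x) =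
      E (- 1 / x) ** (C ** Si) ** Gm (1 / x) ** E (- 1 / x)" by (simp only: matrix_mul_assoc)
  finally show ?thesis by (simp add: C_S C_comm)
qed

text \<open>The expected value of the representation at the matrix with rows \<open>(a, b)\<close> and \<open>(c, d)\<close>:
  after multiplication by \<open>T ^ s\<close> and \<open>S\<close> the lower left entry \<open>- (d + s c)\<close> is a unit, and the big
  cell of the Bruhat decomposition applies.\<close>
definition bruhat :: "rat \<Rightarrow> rat \<Rightarrow> rat \<Rightarrow> rat \<Rightarrow> rat \<Rightarrow> complex^'a^'a" where
  "bruhat a b c d s = E ((b + s * a) / (d + s * c)) ** (S ** Gm (1 / (d + s * c))) **
     E (- c / (d + s * c)) ** Si ** E (- s)"

text \<open>Splitting \<open>E (- s)\<close> as \<open>E n ** S ** Si ** E (- (s + n))\<close>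
  creates a factor \<open>Si ** E n ** S\<close>. Two applications of \<open>S_E_S\<close> absorb
  it, and the result is the same word for \<open>s + n\<close>.\<close>

lemma bruhat_step:
  assumes l: "a \<in> loc" "b \<in> loc" "c \<in> loc" "d \<in> loc" "s \<in> loc" and det: "a * d - b * c = 1"
    and n: "n \<in> units" and u: "d + s * c \<in> units" and u': "d + (s + n) * c \<in> units"
  shows "bruhat a b c d s = bruhat a b c d (s + n)"
proof -
  define \<delta> where "\<delta> = d + s * c"
  define \<delta>' where "\<delta>' = d + (s + n) * c"
  define p where "p = (b + s * a) / \<delta>"
  \<comment> \<open>The sum of the two phases that meet after the first use of \<open>S_E_S\<close>,
    see \<open>ex1\<close>. It is a unit because \<open>\<delta>'\<close> is, so
    \<open>S_E_S\<close> can be used again.\<close>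
  define e where "e = - \<delta>' / (n * \<delta>)"
  have D: "\<delta> \<in> units" "\<delta>' \<in> units" using u u' by (simp_all add: \<delta>_def \<delta>'_def)
  note nz = unitsD(1)[OF D(1)] unitsD(1)[OF D(2)] unitsD(1)[OF n]
  have e: "e \<in> units" unfolding e_def using D n by (intro units_divide units_mult units_minus)
  have e0: "e \<noteq> 0" by (rule unitsD(1)[OF e])
  let ?P = "E ((b + (s + n) * a) / \<delta>')" and ?G' = "Gm (1 / \<delta>')"
    and ?G = "Gm (1 / \<delta>)" and ?Ge = "Gm (1 / e)" and ?Gn = "Gm (1 / n)"
    and ?E2 = "E (- 1 / (e * n^2))" and ?E1 = "E (- 1 / (e * \<delta>^2))" and ?Ee = "E (- 1 / e)"
    and ?En = "E (- 1 / n)" and ?Ec' = "E (- c / \<delta>')" and ?Ec = "E (- c / \<delta>)"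
  have dd: "\<delta>' = \<delta> + n * c" by (simp add: \<delta>_def \<delta>'_def algebra_simps)
  have det': "a * \<delta> - (b + s * a) * c = 1" using det by (simp add: \<delta>_def algebra_simps)
  have L: "p \<in> loc" "- c / \<delta> \<in> loc" "- 1 / n \<in> loc" "- 1 / e \<in> loc" "- s \<in> loc"
    "- 1 / (e * \<delta>^2) \<in> loc" "- 1 / (e * n^2) \<in> loc" "n \<in> loc" "- (s + n) \<in> loc"
  proof -
    show "p \<in> loc" unfolding p_def by (intro unitsD(4)[OF D(1)] loc_add loc_mult l)
    show "- c / \<delta> \<in> loc" by (intro unitsD(4)[OF D(1)] loc_minus l)
    have m1: "- 1 \<in> loc" by (rule unitsD(2)) simp
    show "- 1 / n \<in> loc" "- 1 / e \<in> loc" using unitsD(4)[OF n m1] unitsD(4)[OF e m1] by simp_all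
    show "- s \<in> loc" by (rule loc_minus[OF l(5)])
    show "n \<in> loc" by (rule unitsD(2)[OF n])
    then show "- (s + n) \<in> loc" by (intro loc_minus loc_add l)
    have "e * \<delta>^2 \<in> units" "e * n^2 \<in> units" unfolding power2_eq_square by (intro units_mult e D n)+
    then show "- 1 / (e * \<delta>^2) \<in> loc" "- 1 / (e * n^2) \<in> loc" using unitsD(4)[OF _ m1] by blast+
  qed
  have ex1: "- c / \<delta> + - 1 / n = e" unfolding e_def dd using nz by (simp add: field_simps)
  have ex2: "p + - 1 / (e * \<delta>^2) = (b + (s + n) * a) / \<delta>'"
  proof -
    have A: "- 1 / (e * \<delta>^2) = n / (\<delta> * \<delta>')" unfolding e_def using nz by (simp add: field_simps power2_eq_square)
    have "p + - 1 / (e * \<delta>^2) = ((b + s * a) * \<delta>' + n) / (\<delta> * \<delta>')"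
      unfolding p_def A using nz by (simp add: field_simps)
    also have "(b + s * a) * \<delta>' + n = (b + s * a) * \<delta> + n * ((b + s * a) * c + 1)" by (simp add: dd algebra_simps)
    also have "(b + s * a) * c + 1 = a * \<delta>" using det' by simp
    also have "(b + s * a) * \<delta> + n * (a * \<delta>) = (b + (s + n) * a) * \<delta>" by (simp add: algebra_simps)
    finally show ?thesis using nz by simp
  qed
  have ex3: "- 1 / (e * n^2) + - 1 / n = - c / \<delta>'"
  proof -
    have A: "- 1 / (e * n^2) = \<delta> / (n * \<delta>')" unfolding e_def using nz by (simp add: field_simps power2_eq_square)
    have "- 1 / (e * n^2) + - 1 / n = (\<delta> - \<delta>') / (n * \<delta>')" unfolding A using nz by (simp add: field_simps)
    also have "\<delta> - \<delta>' = n * (- c)" by (simp add: dd)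
    finally show ?thesis using nz by simp
  qed
  have ex4: "(1 / \<delta>) * (1 / e) * (1 / n) = - 1 / \<delta>'" unfolding e_def using nz by (simp add: field_simps)
  have U: "1 / \<delta> \<in> units" "1 / e \<in> units" "1 / n \<in> units" using D n e by auto
  have c1: "S ** ?G = Gm \<delta> ** S" using Gm_S(1)[OF D(1)] by simp
  have c2: "Gm \<delta> ** ?Ee = ?E1 ** Gm \<delta>"
    using Gm_E[OF D(1) L(4)] by (simp add: mult.commute)
  have c3: "?Ee ** ?Gn = ?Gn ** ?E2"
    using Gm_E[OF U(3) L(7)] nz by (simp add: power_divide)
  have c4: "Si ** E n ** S = ?En ** S ** ?Gn ** ?En" by (rule S_E_S[OF n])
  have c5: "Si ** E e ** S = ?Ee ** S ** ?Ge ** ?Ee" by (rule S_E_S[OF e])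
  have key: "E p ** (S ** ?G) ** ?Ec ** (Si ** E n ** S) =
      ?P ** (S ** ?G') ** ?Ec'"
  proof -
    have "E p ** (S ** ?G) ** ?Ec ** (Si ** E n ** S) =
        E p ** Gm \<delta> ** S ** (?Ec ** ?En) ** S ** ?Gn ** ?En"
      unfolding c4 c1 by (simp only: matrix_mul_assoc)
    also have "\<dots> = E p ** Gm \<delta> ** S ** E e ** S ** ?Gn ** ?En"
      unfolding E_add[OF L(2,3)] ex1 ..
    \<comment> \<open>This prepares \<open>Si ** E e ** S\<close>; the extra \<open>C\<close> is
      compensated by the minus sign in \<open>ex4\<close>.\<close>
    also have "\<dots> = E p ** Gm \<delta> ** (C ** Si) ** E e ** S ** ?Gn ** ?En"
      unfolding C_comm(2) ..
    also have "\<dots> = E p ** Gm \<delta> ** C ** (Si ** E e ** S) ** ?Gn ** ?En"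
      by (simp only: matrix_mul_assoc)
    also have "\<dots> = E p ** (Gm \<delta> ** C) ** ?Ee ** S ** ?Ge ** (?Ee ** ?Gn) ** ?En"
      unfolding c5 by (simp only: matrix_mul_assoc)
    also have "Gm \<delta> ** C = C ** Gm \<delta>" using C_Gm[OF D(1)] by simp
    also have "E p ** (C ** Gm \<delta>) ** ?Ee ** S ** ?Ge ** (?Ee ** ?Gn) ** ?En =
        (E p ** C) ** (Gm \<delta> ** ?Ee) ** S ** ?Ge ** ?Gn ** (?E2 ** ?En)"
      unfolding c3 by (simp only: matrix_mul_assoc)
    also have "E p ** C = C ** E p" using C_E[OF L(1)] by simp
    also have "C ** E p ** (Gm \<delta> ** ?Ee) ** S ** ?Ge ** ?Gn ** (?E2 ** ?En) =
        C ** (E p ** ?E1) ** (Gm \<delta> ** S) ** ?Ge ** ?Gn ** (?E2 ** ?En)"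
      unfolding c2 by (simp only: matrix_mul_assoc)
    also have "\<dots> = (C ** ?P) ** (S ** ?G) ** ?Ge ** ?Gn ** ?Ec'"
      unfolding E_add[OF L(1,6)] ex2 E_add[OF L(7,3)] ex3 c1 ..
    also have "C ** ?P = ?P ** C"
      unfolding ex2[symmetric] by (intro C_E loc_add L)
    also have "?P ** C ** (S ** ?G) ** ?Ge ** ?Gn ** ?Ec' =
        ?P ** ((C ** S) ** (?G ** ?Ge ** ?Gn)) ** ?Ec'"
      by (simp only: matrix_mul_assoc)
    also have "?G ** ?Ge ** ?Gn = C ** ?G'"
      using C_Gm(1)[OF units_inverse[OF D(2)]] ex4 Gm_mult[OF units_mult[OF U(1,2)] U(3)] Gm_mult[OF U(1,2)] by simp
    also have "(C ** S) ** (C ** ?G') = S ** ?G'"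
      by (simp add: matrix_mul_assoc C_S C_comm)
    finally show ?thesis .
  qed
  have "bruhat a b c d s = E p ** (S ** ?G) ** ?Ec ** Si ** E (- s)"
    by (simp add: bruhat_def p_def \<delta>_def)
  also have "E (- s) = E n ** (S ** Si) ** E (- (s + n))"
    using E_add[OF L(8,9)] by (simp add: S_Si)
  also have "E p ** (S ** ?G) ** ?Ec ** Si ** (E n ** (S ** Si) ** E (- (s + n))) =
      (E p ** (S ** ?G) ** ?Ec ** (Si ** E n ** S)) ** Si ** E (- (s + n))"
    by (simp only: matrix_mul_assoc)
  also have "\<dots> = bruhat a b c d (s + n)"
    unfolding key by (simp add: bruhat_def \<delta>'_def)
  finally show ?thesis .
qed

text \<open>The parameter \<open>- 1 / s\<close> is the one that leaves the leading factor
  unchanged: the new denominator is \<open>\<delta> / s\<close>, and the quotient in front is the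
  same.\<close>

lemma bruhat_S:
  assumes l: "a \<in> loc" "b \<in> loc" "c \<in> loc" "d \<in> loc" and s: "s \<in> units" and u: "d + s * c \<in> units"
  shows "bruhat a b c d s ** S = bruhat (- b) a (- d) c (- 1 / s)"
proof -
  define \<delta> where "\<delta> = d + s * c"
  have D: "\<delta> \<in> units" using u by (simp add: \<delta>_def)
  note nz = unitsD(1)[OF D] unitsD(1)[OF s]
  define p where "p = (b + s * a) / \<delta>"
  let ?Q' = "E (d * s / \<delta> / (- s)^2)" and ?Q = "E (d * s / \<delta>)" and ?R = "E (1 / s)"
    and ?H = "Gm (s / \<delta>)" and ?M = "Gm (- s)" and ?G = "Gm (1 / \<delta>)"
  have ex: "a + - 1 / s * - b = (b + s * a) / s" "c + - 1 / s * - d = \<delta> / s"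
    using nz by (simp_all add: \<delta>_def field_simps)
  have U: "1 / s \<in> units" "1 / \<delta> \<in> units" "\<delta> / s \<in> units" "s / \<delta> \<in> units" "- s \<in> units" using D s by auto
  have L: "- c / \<delta> \<in> loc" "1 / s \<in> loc" "d * s / \<delta> \<in> loc"
    using l unitsD(4)[OF D] unitsD(2)[OF U(1)] unitsD(2)[OF s] by (auto intro: loc_mult)
  have r: "bruhat (- b) a (- d) c (- 1 / s) = E p ** (S ** ?H) ** ?Q ** Si ** ?R"
    unfolding bruhat_def ex p_def using nz by simp
  have m: "- s \<in> units" using s by blast
  have "bruhat a b c d s ** S = E p ** (S ** ?G) ** E (- c / \<delta>) ** (Si ** E (- s) ** S)"
    by (simp add: bruhat_def p_def \<delta>_def matrix_mul_assoc)
  also have "Si ** E (- s) ** S = ?R ** S ** Gm (- 1 / s) ** ?R"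
    using S_E_S[OF m] by simp
  also have "?R ** S ** Gm (- 1 / s) = ?R ** (S ** Gm (- 1 / s))" by (simp add: matrix_mul_assoc)
  also have "S ** Gm (- 1 / s) = ?M ** S" using Gm_S(1)[OF m] by simp
  also have "E p ** (S ** ?G) ** E (- c / \<delta>) ** (?R ** (?M ** S) ** ?R) =
      E p ** S ** ?G ** (E (- c / \<delta>) ** ?R) ** ?M ** S ** ?R"
    by (simp only: matrix_mul_assoc)
  also have "E (- c / \<delta>) ** ?R = ?Q'"
  proof -
    have "- c / \<delta> + 1 / s = (\<delta> - s * c) / (s * \<delta>)" using nz by (simp add: field_simps)
    also have "\<dots> = d * s / \<delta> / (- s)^2" using nz by (simp add: \<delta>_def power2_eq_square)
    finally show ?thesis unfolding E_add[OF L(1,2)] by simp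
  qed
  also have "E p ** S ** ?G ** ?Q' ** ?M ** S ** ?R =
      E p ** S ** ?G ** (?Q' ** ?M) ** S ** ?R"
    by (simp only: matrix_mul_assoc)
  also have "?Q' ** ?M = ?M ** ?Q"
    using Gm_E[OF m L(3)] by simp
  also have "E p ** S ** ?G ** (?M ** ?Q) ** S ** ?R =
      E p ** S ** (?G ** ?M) ** ?Q ** S ** ?R"
    by (simp only: matrix_mul_assoc)
  also have "?G ** ?M = ?H ** C"
    using Gm_mult[OF U(2) m] C_Gm(2)[OF U(4)] by simp
  also have "E p ** S ** (?H ** C) ** ?Q ** S ** ?R =
      E p ** (S ** ?H) ** (C ** ?Q) ** S ** ?R"
    by (simp only: matrix_mul_assoc)
  also have "C ** ?Q = ?Q ** C" by (rule C_E[OF L(3)])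
  also have "E p ** (S ** ?H) ** (?Q ** C) ** S ** ?R =
      E p ** (S ** ?H) ** ?Q ** (C ** S) ** ?R"
    by (simp only: matrix_mul_assoc)
  finally show ?thesis unfolding r C_S .
qed

lemma bruhat_T:
  assumes "s \<in> loc"
  shows "bruhat a (b + a) c (d + c) s = bruhat a b c d (s + 1) ** T"
proof -
  have 1: "b + a + s * a = b + (s + 1) * a" "d + c + s * c = d + (s + 1) * c" by (simp_all add: algebra_simps)
  have "s + 1 \<in> loc" using assms by (rule loc_add) simp
  then have "E (- (s + 1)) ** E 1 = E (- s)"
    using E_add[OF loc_minus, of "s + 1" 1] by simp
  then have 2: "E (- s) = E (- (s + 1)) ** T" by (simp only: E_1)
  show ?thesis unfolding bruhat_def 1 2 by (simp only: matrix_mul_assoc)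
qed

section \<open>Independence of the big cell formula from the shift\<close>

lemma units_via_residue:
  assumes "q \<in> loc" "q \<noteq> 0" "[res q = k] (mod int N)" "\<And>p. prime p \<Longrightarrow> p dvd N \<Longrightarrow> \<not> int p dvd k"
  shows "q \<in> units"
proof (rule unitsI[OF assms(1,2)])
  have "coprime k (int N)" unfolding coprime_int_iff_prime[OF N_pos] using assms(4) by blast
  then show "coprime (res q) (int N)" using assms(3) by (metis cong_imp_coprime cong_sym)
qed

lemma unit_not_dvd: "x \<in> units \<Longrightarrow> [res x = k] (mod int N) \<Longrightarrow> prime p \<Longrightarrow> p dvd N \<Longrightarrow> \<not> int p dvd k"
  using coprime_res[of x] cong_imp_coprime[of "res x" k "int N"] coprime_int_iff_prime[OF N_pos, of k] by blast

lemma res_affine: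
  assumes "c \<in> loc" "d \<in> loc" "s \<in> loc"
  shows "[res (d + s * c) = res d + res s * res c] (mod int N)"
  using cong_trans[OF res_add[OF assms(2) loc_mult[OF assms(3,1)]] cong_add[OF cong_refl res_mult[OF assms(3,1)]]] .

lemma res_affine_int:
  assumes "c \<in> loc" "d \<in> loc"
  shows "[res (d + of_int w * c) = res d + w * res c] (mod int N)"
  using cong_trans[OF res_affine[OF assms loc_of_int] cong_add[OF cong_refl cong_mult[OF res_of_int cong_refl]]] .

lemma large_root_bound:
  fixes c d :: rat
  assumes "c \<noteq> 0 \<or> d \<noteq> 0"
  shows "of_int w > \<bar>d / c\<bar> \<Longrightarrow> d + of_int w * c \<noteq> 0"
proof
  assume w: "of_int w > \<bar>d / c\<bar>" and 0: "d + of_int w * c = 0"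
  show False
  proof (cases "c = 0")
    case False
    then have "of_int w = - (d / c)" using 0 by (simp add: field_simps add_eq_0_iff2)
    then show False using w by linarith
  qed (use 0 assms in simp)
qed

text \<open>An integer \<open>w\<close> is sought whose differences to \<open>s\<close> and
  \<open>s'\<close> are units, so that \<open>bruhat_step\<close> links both to \<open>w\<close>. If
  \<open>s\<close> and \<open>s'\<close> differ modulo 3, both differences and the denominator may
  be impossible to handle together; then \<open>w\<close> is taken congruent to \<open>s'\<close>
  modulo 3, and a second move completes the link.\<close>

lemma bruhat_move:
  assumes l: "a \<in> loc" "b \<in> loc" "c \<in> loc" "d \<in> loc" and det: "a * d - b * c = 1"
    and s: "s \<in> loc" "s' \<in> loc" and u: "d + s * c \<in> units" and u': "d + s' * c \<in> units"
  obtains w :: int where "bruhat a b c d s = bruhat a b c d (of_int w)" "d + of_int w * c \<in> units"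
    "(3 dvd N \<longrightarrow> [res s = res s'] (mod 3)) \<Longrightarrow> bruhat a b c d s' = bruhat a b c d (of_int w)"
    "3 dvd N \<Longrightarrow> \<not> [res s = res s'] (mod 3) \<Longrightarrow> [w = res s'] (mod 3)"
proof -
  define r where "r p = (if p = 3 \<and> \<not> [res s = res s'] (mod 3) then res s' else
    SOME r. \<not> int p dvd r - res s \<and> \<not> int p dvd r - res s' \<and> \<not> int p dvd res d + r * res c)" for p :: nat
  \<comment> \<open>A large \<open>w\<close> keeps \<open>w - s\<close>, \<open>w - s'\<close> and
    \<open>d + w * c\<close> nonzero as rationals, as \<open>units\<close> requires besides coprime
    residues.\<close>
  define B where "B = \<lceil>\<bar>s\<bar> + \<bar>s'\<bar> + \<bar>d / c\<bar>\<rceil>"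
  obtain w where w: "w > B" "\<And>p. prime p \<Longrightarrow> p dvd N \<Longrightarrow> [w = r p] (mod int p)"
    using simultaneous_residues_large[OF N_pos] by metis
  have wB: "of_int w > \<bar>s\<bar> + \<bar>s'\<bar> + \<bar>d / c\<bar>"
  proof -
    have "\<bar>s\<bar> + \<bar>s'\<bar> + \<bar>d / c\<bar> \<le> of_int B" unfolding B_def by (rule le_of_int_ceiling)
    also have "of_int B < (of_int w :: rat)" using w(1) by simp
    finally show ?thesis .
  qed
  then have bd: "\<bar>s\<bar> < of_int w" "\<bar>s'\<bar> < of_int w" "\<bar>d / c\<bar> < of_int w"
    using abs_ge_zero[of s] abs_ge_zero[of s'] abs_ge_zero[of "d / c"] by linarith+
  note wp = w(2)
  have us: "\<not> int p dvd res d + res s * res c" "\<not> int p dvd res d + res s' * res c" if "prime p" "p dvd N" for p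
    using unit_not_dvd[OF u res_affine[OF l(3,4) s(1)] that] unit_not_dvd[OF u' res_affine[OF l(3,4) s(2)] that] .
  have rp: "\<not> int p dvd r p - res s \<and> \<not> int p dvd res d + r p * res c \<and>
      ((p = 3 \<longrightarrow> [res s = res s'] (mod 3)) \<longrightarrow> \<not> int p dvd r p - res s')"
    if p: "prime p" "p dvd N" for p
  proof (cases "p = 3 \<and> \<not> [res s = res s'] (mod 3)")
    case True
    then have "\<not> [res s' = res s] (mod 3)" using cong_sym by blast
    then have "\<not> int p dvd res s' - res s" using True by (simp add: cong_iff_dvd_diff)
    then show ?thesis using True us(2)[OF p] by (simp add: r_def)
  next
    case False
    have "odd p" using odd_N p(2) dvd_trans by blast
    moreover have "p = 3 \<Longrightarrow> int p dvd res s - res s'" using False by (simp add: cong_iff_dvd_diff)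
    ultimately have "\<not> int p dvd r p - res s \<and> \<not> int p dvd r p - res s' \<and> \<not> int p dvd res d + r p * res c"
      using someI_ex[OF avoid_three_residues[OF p(1) _ us(1)[OF p], of "res s'"]] False unfolding r_def by auto
    then show ?thesis by blast
  qed
  have shift: "\<not> int p dvd w - k" if "prime p" "p dvd N" "\<not> int p dvd r p - k" for p k
    using not_dvd_cong[OF cong_diff[OF wp cong_refl]] that by blast
  have uw: "d + of_int w * c \<in> units"
  proof (rule units_via_residue[OF _ _ res_affine_int[OF l(3,4)]])
    show "d + of_int w * c \<in> loc" by (intro loc_add loc_mult l loc_of_int)
    have "c \<noteq> 0 \<or> d \<noteq> 0" using unitsD(1)[OF u] by auto
    then show "d + of_int w * c \<noteq> 0" by (rule large_root_bound) (rule bd(3))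
    show "\<not> int p dvd res d + w * res c" if "prime p" "p dvd N" for p
      using not_dvd_cong[OF cong_add[OF cong_refl cong_mult[OF wp[OF that] cong_refl]]] rp[OF that] by blast
  qed
  have move: "bruhat a b c d q = bruhat a b c d (of_int w)"
    if q: "q \<in> loc" "d + q * c \<in> units" "\<bar>q\<bar> < of_int w" "\<And>p. prime p \<Longrightarrow> p dvd N \<Longrightarrow> \<not> int p dvd r p - res q" for q
  proof -
    have "of_int w - q \<in> units"
    proof (rule units_via_residue)
      show "of_int w - q \<in> loc" using q(1) by (intro loc_diff loc_of_int)
      show "of_int w - q \<noteq> 0" using q(3) by auto
      have "lcong (of_int w - q) (of_int w - of_int (res q))" using lcong_res[OF q(1)] by (intro lcong_diff lcong_refl)
      then have "lcong (of_int w - q) (of_int (w - res q))" by simp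
      then show "[res (of_int w - q) = w - res q] (mod int N)"
        using lcong_res[of "of_int w - q"] q(1) lcong_sym lcong_trans lcong_of_int by (meson loc_diff loc_of_int)
      show "\<not> int p dvd w - res q" if "prime p" "p dvd N" for p
        using shift[OF that q(4)[OF that]] .
    qed
    then have "bruhat a b c d q = bruhat a b c d (q + (of_int w - q))"
      using l q det uw by (intro bruhat_step) simp_all
    then show ?thesis by simp
  qed
  show ?thesis
  proof
    show "bruhat a b c d s = bruhat a b c d (of_int w)"
      using s(1) u bd(1) rp by (intro move) auto
    show "d + of_int w * c \<in> units" by (rule uw)
    show "bruhat a b c d s' = bruhat a b c d (of_int w)" if "3 dvd N \<longrightarrow> [res s = res s'] (mod 3)"
      using s(2) u' bd(2) rp that by (intro move) auto
    show "[w = res s'] (mod 3)" if "3 dvd N" "\<not> [res s = res s'] (mod 3)"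
      using wp[of 3] that by (simp add: r_def)
  qed
qed

lemma bruhat_independent:
  assumes l: "a \<in> loc" "b \<in> loc" "c \<in> loc" "d \<in> loc" and det: "a * d - b * c = 1"
    and s: "s \<in> loc" "s' \<in> loc" and u: "d + s * c \<in> units" and u': "d + s' * c \<in> units"
  shows "bruhat a b c d s = bruhat a b c d s'"
proof -
  have near: "bruhat a b c d q = bruhat a b c d s'"
    if q: "q \<in> loc" "d + q * c \<in> units" "3 dvd N \<longrightarrow> [res q = res s'] (mod 3)" for q
    using bruhat_move[OF l det q(1) s(2) q(2) u'] q(3) by metis
  show ?thesis
  proof (cases "3 dvd N \<longrightarrow> [res s = res s'] (mod 3)")
    case True
    then show ?thesis using near s u by blast
  next
    case False
    then obtain w where w: "bruhat a b c d s = bruhat a b c d (of_int w)" "d + of_int w * c \<in> units"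
      "[w = res s'] (mod 3)"
      using bruhat_move[OF l det s u u'] by metis
    have "3 dvd N \<longrightarrow> [res (of_int w) = res s'] (mod 3)"
      using cong_res_3[OF _ res_of_int] w(3) cong_trans by blast
    then have "bruhat a b c d (of_int w) = bruhat a b c d s'" using w(2) by (intro near) simp_all
    then show ?thesis using w(1) by simp
  qed
qed

text \<open>At each prime 1 or 2 works: if both failed, the prime would divide \<open>c\<close> and
  \<open>d\<close>, against the determinant. The shift itself must be a unit so that
  \<open>- 1 / s\<close> makes sense in \<open>bruhat_S\<close>.\<close>

lemma unit_shift_exists:
  assumes l: "a \<in> loc" "b \<in> loc" "c \<in> loc" "d \<in> loc" and det: "a * d - b * c = 1"
  shows "\<exists>s\<in>units. d + s * c \<in> units"
proof -
  define r :: "nat \<Rightarrow> int" where "r p = (if int p dvd res d + res c then 2 else 1)" for p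
  obtain w where w: "w > \<lceil>\<bar>d / c\<bar>\<rceil>" "\<And>p. prime p \<Longrightarrow> p dvd N \<Longrightarrow> [w = r p] (mod int p)"
    using simultaneous_residues_large[OF N_pos] by metis
  have wB: "of_int w > \<bar>d / c\<bar>" using w(1) by (simp add: ceiling_less_iff)
  then have w0: "w > 0" by (metis abs_ge_zero of_int_0_less_iff order_le_less_trans)
  note wp = w(2)
  have rp: "\<not> int p dvd r p \<and> \<not> int p dvd res d + r p * res c" if p: "prime p" "p dvd N" for p
  proof -
    have "odd p" using odd_N p(2) dvd_trans by blast
    then have "p \<ge> 3" using prime_ge_2_nat[OF p(1)] by (cases "p = 2") auto
    then have "\<not> int p dvd 1" "\<not> int p dvd 2" using zdvd_imp_le[of "int p" 2] by auto
    moreover have "\<not> int p dvd res d + 2 * res c" if *: "int p dvd res d + res c"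
    proof
      assume "int p dvd res d + 2 * res c"
      then have "int p dvd (res d + 2 * res c) - (res d + res c)" using * by (rule dvd_diff)
      then have c: "int p dvd res c" by simp
      then have d: "int p dvd res d" using * by (metis dvd_add_left_iff)
      have "[res (a * d - b * c) = res a * res d - res b * res c] (mod int N)"
      proof -
        have "lcong (a * d - b * c) (of_int (res a) * of_int (res d) - of_int (res b) * of_int (res c))"
          by (intro lcong_diff lcong_mult lcong_res l loc_of_int)
        then have "lcong (a * d - b * c) (of_int (res a * res d - res b * res c))" by simp
        then show ?thesis using lcong_res[of "a * d - b * c"] l lcong_sym lcong_trans lcong_of_int by (meson loc_diff loc_mult)
      qed
      then have "\<not> int p dvd res a * res d - res b * res c"
        using unit_not_dvd[of "a * d - b * c"] det p by simp
      then show False using c d by (simp add: dvd_diff)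
    qed
    ultimately show ?thesis by (simp add: r_def)
  qed
  have "c \<noteq> 0 \<or> d \<noteq> 0" using det by auto
  then have "d + of_int w * c \<noteq> 0" by (rule large_root_bound) (rule wB)
  moreover have "\<not> int p dvd res d + w * res c" if "prime p" "p dvd N" for p
    using not_dvd_cong[OF cong_add[OF cong_refl cong_mult[OF wp[OF that] cong_refl]]] rp[OF that] by blast
  ultimately have "d + of_int w * c \<in> units"
    by (intro units_via_residue[OF _ _ res_affine_int[OF l(3,4)]] loc_add loc_mult l loc_of_int)
  moreover have "\<not> int p dvd w" if "prime p" "p dvd N" for p
    using not_dvd_cong[OF wp[OF that]] rp[OF that] by blast
  then have "of_int w \<in> units"
    using w0 by (intro units_via_residue[OF loc_of_int _ res_of_int]) auto
  ultimately show ?thesis by blast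
qed

end

text \<open>Euclid's algorithm on the lower row. The case \<open>T_inv\<close> permits quotients of
  either sign, while inverses of \<open>S\<close> come from its cube.\<close>

lemma SL2_int_induct [consumes 1, case_names one T T_inv S]:
  fixes P :: "int \<Rightarrow> int \<Rightarrow> int \<Rightarrow> int \<Rightarrow> bool"
  assumes "a * d - b * c = 1" and one: "P 1 0 0 1"
    and T: "\<And>a b c d. a * d - b * c = 1 \<Longrightarrow> P a b c d \<Longrightarrow> P a (b + a) c (d + c)"
    and T_inv: "\<And>a b c d. a * d - b * c = 1 \<Longrightarrow> P a b c d \<Longrightarrow> P a (b - a) c (d - c)"
    and S: "\<And>a b c d. a * d - b * c = 1 \<Longrightarrow> P a b c d \<Longrightarrow> P (- b) a (- d) c"
  shows "P a b c d"
proof -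
  have power: "P a (b + k * a) c (d + k * c)" if "a * d - b * c = 1" "P a b c d" for a b c d k
  proof (induction k rule: int_induct[where k = 0])
    case base
    then show ?case using that by simp
  next
    case (step1 i)
    have "a * (d + i * c) - (b + i * a) * c = 1" using that(1) by (simp add: algebra_simps)
    from T[OF this step1(2)] show ?case by (simp add: algebra_simps)
  next
    case (step2 i)
    have "a * (d + i * c) - (b + i * a) * c = 1" using that(1) by (simp add: algebra_simps)
    from T_inv[OF this step2(2)] show ?case by (simp add: algebra_simps)
  qed
  have S2: "P (- a) (- b) (- c) (- d)" if "a * d - b * c = 1" "P a b c d" for a b c d
  proof -
    have "- b * c - a * - d = 1" using that(1) by simp
    from S[OF this S[OF that]] show ?thesis by simp
  qed
  have S3: "P b (- a) d (- c)" if "a * d - b * c = 1" "P a b c d" for a b c d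
  proof -
    have "- b * c - a * - d = 1" using that(1) by simp
    from S2[OF this S[OF that]] show ?thesis by simp
  qed
  show ?thesis using assms(1)
  proof (induction "nat \<bar>c\<bar>" arbitrary: a b c d rule: less_induct)
    case less
    show ?case
    proof (cases "c = 0")
      case True
      then have "a * d = 1" using less(2) by simp
      then have "a = 1 \<and> d = 1 \<or> a = - 1 \<and> d = - 1" by (simp add: zmult_eq_1_iff)
      then show ?thesis
      proof
        assume "a = 1 \<and> d = 1"
        then show ?thesis using power[OF _ one, of b] True by simp
      next
        assume "a = - 1 \<and> d = - 1"
        then show ?thesis using power[OF _ S2[OF _ one], of "- b"] True by simp
      qed
    next
      case False
      define k where "k = d div c"
      define d' where "d' = d - k * c"
      define b' where "b' = b - k * a"
      have "d' = d mod c" by (simp add: d'_def k_def minus_div_mult_eq_mod)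
      then have small: "\<bar>d'\<bar> < \<bar>c\<bar>" using False abs_mod_less by simp
      have det: "- b' * c - a * - d' = 1" using less(2) by (simp add: b'_def d'_def algebra_simps)
      \<comment> \<open>Multiplying the reduced matrix by \<open>S\<close> moves the remainder
        \<open>d'\<close> into the lower left corner, where the measure drops; \<open>S3\<close>
        takes that \<open>S\<close> back.\<close>
      have "P (- b') a (- d') c" by (rule less(1)[OF _ det]) (use small in simp)
      from S3[OF det this] have "P a b' c d'" by simp
      then have "P a (b' + k * a) c (d' + k * c)"
        using less(2) by (intro power) (simp_all add: b'_def d'_def algebra_simps)
      then show ?thesis by (simp add: b'_def d'_def)
    qed
  qed
qed

definition mat2 :: "int \<Rightarrow> int \<Rightarrow> int \<Rightarrow> int \<Rightarrow> int^2^2" where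
  "mat2 a b c d = vector [vector [a, b], vector [c, d]]"

lemma mat2_nth [simp]:
  "mat2 a b c d $ 1 $ 1 = a" "mat2 a b c d $ 1 $ 2 = b" "mat2 a b c d $ 2 $ 1 = c" "mat2 a b c d $ 2 $ 2 = d"
  by (simp_all add: mat2_def)

lemma mat2_mult: "mat2 a b c d ** mat2 a' b' c' d' = mat2 (a * a' + b * c') (a * b' + b * d') (c * a' + d * c') (c * b' + d * d')"
  by (simp add: vec_eq_iff forall_2 matrix_mult_nth sum_2)

lemma mat2_SL2Z: "mat2 a b c d \<in> SL2Z \<longleftrightarrow> a * d - b * c = 1"
  by (simp add: SL2Z_def det_2)

lemma mat2_one: "mat2 1 0 0 1 = mat 1"
  by (simp add: vec_eq_iff forall_2 mat_def)

lemma mat2_cases: "A = mat2 (A $ 1 $ 1) (A $ 1 $ 2) (A $ 2 $ 1) (A $ 2 $ 2)"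
  by (simp add: vec_eq_iff forall_2)

context odd_level_data
begin

text \<open>The induction carries the formula for all admissible \<open>s\<close> at once, since
  \<open>T\<close> shifts the parameter and \<open>S\<close> replaces a unit parameter
  \<open>q\<close> by \<open>- 1 / q\<close>. After the step for \<open>S\<close>,
  \<open>bruhat_independent\<close> returns from that special value to any \<open>s\<close>.\<close>

lemma representation_bruhat:
  fixes a b c d :: int
  assumes \<rho>: "modular_representation S T \<rho>" and det: "a * d - b * c = 1"
    and s: "s \<in> loc" "of_int d + s * of_int c \<in> units"
  shows "\<rho> (mat2 a b c d) = bruhat (of_int a) (of_int b) (of_int c) (of_int d) s"
proof -
  have one: "\<rho> (mat 1) = mat 1"
    and mult: "\<And>A B. A \<in> SL2Z \<Longrightarrow> B \<in> SL2Z \<Longrightarrow> \<rho> (A ** B) = \<rho> A ** \<rho> B"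
    and \<rho>S: "\<rho> (mat2 0 1 (- 1) 0) = S" and \<rho>T: "\<rho> (mat2 1 1 0 1) = T"
    using \<rho> unfolding modular_representation_def mat2_def by auto
  have ST: "mat2 0 1 (- 1) 0 \<in> SL2Z" "mat2 1 1 0 1 \<in> SL2Z" by (simp_all add: mat2_SL2Z)
  have TE: "T ** E (- 1) = mat 1" using E_inverse(1)[of 1] by (simp add: E_1)
  have "\<forall>s\<in>loc. of_int d + s * of_int c \<in> units \<longrightarrow>
      \<rho> (mat2 a b c d) = bruhat (of_int a) (of_int b) (of_int c) (of_int d) s"
    using det
  proof (induction a b c d rule: SL2_int_induct)
    case one
    have "bruhat 1 0 0 1 s = mat 1" if "s \<in> loc" for s
    proof -
      have "bruhat 1 0 0 1 s = E s ** (S ** Si) ** E (- s)" by (simp add: bruhat_def matrix_mul_assoc)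
      then show ?thesis using E_inverse(1)[OF that] by (simp add: S_Si)
    qed
    then show ?case by (simp add: mat2_one \<open>\<rho> (mat 1) = mat 1\<close>)
  next
    case (T a b c d)
    have "mat2 a (b + a) c (d + c) = mat2 a b c d ** mat2 1 1 0 1" by (simp add: mat2_mult add.commute)
    then have r: "\<rho> (mat2 a (b + a) c (d + c)) = \<rho> (mat2 a b c d) ** T"
      using mult ST T(1) by (simp add: mat2_SL2Z \<rho>T)
    show ?case
    proof (intro ballI impI)
      fix s assume s: "s \<in> loc" "of_int (d + c) + s * of_int c \<in> units"
      have "s + 1 \<in> loc" using s(1) by (rule loc_add) simp
      moreover have "of_int d + (s + 1) * of_int c \<in> units" using s(2) by (simp add: algebra_simps)
      ultimately have "\<rho> (mat2 a b c d) = bruhat (of_int a) (of_int b) (of_int c) (of_int d) (s + 1)"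
        using T(2) by blast
      then show "\<rho> (mat2 a (b + a) c (d + c)) = bruhat (of_int a) (of_int (b + a)) (of_int c) (of_int (d + c)) s"
        unfolding r using bruhat_T[OF s(1)] by simp
    qed
  next
    case (T_inv a b c d)
    have "a * (d - c) - (b - a) * c = 1" using T_inv(1) by (simp add: algebra_simps)
    moreover have "mat2 a b c d = mat2 a (b - a) c (d - c) ** mat2 1 1 0 1" by (simp add: mat2_mult)
    ultimately have r: "\<rho> (mat2 a b c d) = \<rho> (mat2 a (b - a) c (d - c)) ** T"
      using mult ST by (simp add: mat2_SL2Z \<rho>T)
    show ?case
    proof (intro ballI impI)
      fix s assume s: "s \<in> loc" "of_int (d - c) + s * of_int c \<in> units"
      have l: "s - 1 \<in> loc" using s(1) by (rule loc_diff) simp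
      moreover have "of_int d + (s - 1) * of_int c \<in> units" using s(2) by (simp add: algebra_simps)
      ultimately have "\<rho> (mat2 a b c d) = bruhat (of_int a) (of_int b) (of_int c) (of_int d) (s - 1)"
        using T_inv(2) by blast
      also have "\<dots> = bruhat (of_int a) (of_int (b - a)) (of_int c) (of_int (d - c)) s ** T"
        using bruhat_T[OF l, of "of_int a" "of_int (b - a)" "of_int c" "of_int (d - c)"] by simp
      finally have "\<rho> (mat2 a (b - a) c (d - c)) ** (T ** E (- 1)) =
          bruhat (of_int a) (of_int (b - a)) (of_int c) (of_int (d - c)) s ** (T ** E (- 1))"
        unfolding r by (simp add: matrix_mul_assoc)
      then show "\<rho> (mat2 a (b - a) c (d - c)) = bruhat (of_int a) (of_int (b - a)) (of_int c) (of_int (d - c)) s"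
        by (simp add: TE)
    qed
  next
    case (S a b c d)
    have "mat2 (- b) a (- d) c = mat2 a b c d ** mat2 0 1 (- 1) 0" by (simp add: mat2_mult)
    then have r: "\<rho> (mat2 (- b) a (- d) c) = \<rho> (mat2 a b c d) ** S"
      using mult ST S(1) by (simp add: mat2_SL2Z \<rho>S)
    have det: "of_int a * of_int d - of_int b * of_int c = (1 :: rat)"
      using S(1) by (metis of_int_1 of_int_diff of_int_mult)
    then obtain q where q: "q \<in> units" "of_int d + q * of_int c \<in> units"
      using unit_shift_exists[of "of_int a" "of_int b" "of_int c" "of_int d"] by auto
    have q': "- 1 / q \<in> units" using units_divide[OF units_1(2) q(1)] by simp
    have "of_int c + - 1 / q * - of_int d = (of_int d + q * of_int c) / q"
      using unitsD(1)[OF q(1)] by (simp add: field_simps)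
    then have u: "of_int c + - 1 / q * - of_int d \<in> units" using units_divide[OF q(2,1)] by simp
    have eq: "\<rho> (mat2 (- b) a (- d) c) = bruhat (- of_int b) (of_int a) (- of_int d) (of_int c) (- 1 / q)"
      unfolding r using S(2) q unitsD(2)[OF q(1)] bruhat_S[OF loc_of_int loc_of_int loc_of_int loc_of_int q, of a b] by simp
    show ?case
    proof (intro ballI impI)
      fix s assume s: "s \<in> loc" "of_int c + s * of_int (- d) \<in> units"
      have "bruhat (- of_int b) (of_int a) (- of_int d) (of_int c) (- 1 / q) =
          bruhat (- of_int b) (of_int a) (- of_int d) (of_int c) s"
      proof (rule bruhat_independent)
        show "- of_int b * of_int c - of_int a * - of_int d = (1 :: rat)" using det by simp
        show "- 1 / q \<in> loc" by (rule unitsD(2)[OF q'])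
      qed (use s u loc_minus in auto)
      then show "\<rho> (mat2 (- b) a (- d) c) = bruhat (of_int (- b)) (of_int a) (of_int (- d)) (of_int c) s"
        unfolding eq by simp
    qed
  qed
  then show ?thesis using s by blast
qed

lemma representation_trivial:
  assumes \<rho>: "modular_representation S T \<rho>" and A: "A \<in> principal_congruence_subgroup N"
  shows "\<rho> A = mat 1"
proof -
  define a b c d where "a = A $ 1 $ 1" and "b = A $ 1 $ 2" and "c = A $ 2 $ 1" and "d = A $ 2 $ 2"
  have A2: "A = mat2 a b c d" unfolding a_def b_def c_def d_def by (rule mat2_cases)
  have det: "a * d - b * c = 1" using A by (simp add: principal_congruence_subgroup_def A2 mat2_SL2Z)
  have cong: "[A $ i $ j = (mat 1 :: int^2^2) $ i $ j] (mod int N)" for i j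
    using A by (simp add: principal_congruence_subgroup_def)
  have b: "lcong (of_int b) 0" and c: "lcong (of_int c) 0" and d: "lcong (of_int d) 1"
    using cong[of 1 2] cong[of 2 1] cong[of 2 2] lcong_of_int[of b 0] lcong_of_int[of c 0] lcong_of_int[of d 1]
    by (simp_all add: A2 mat_def)
  \<comment> \<open>The shift 0 fails only for \<open>d = 0\<close>, which forces
    \<open>N = 1\<close>. Shifting by \<open>N\<close> then gives the denominator
    \<open>N * c\<close>, nonzero by the determinant.\<close>
  define s :: rat where "s = (if d = 0 then of_nat N else 0)"
  have "lcong (of_nat N) 0" unfolding lcong_def by (rule bexI[of _ 1]) simp_all
  then have s: "s \<in> loc" "lcong s 0" by (simp_all add: s_def)
  have dl: "of_int d + s * of_int c \<in> loc" using s by (intro loc_add loc_mult) simp_all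
  have bl: "of_int b + s * of_int a \<in> loc" using s by (intro loc_add loc_mult) simp_all
  have "lcong (of_int d + s * of_int c) (1 + 0 * of_int c)" "lcong (of_int b + s * of_int a) (0 + 0 * of_int a)"
    by (intro lcong_add lcong_mult d b s lcong_refl; simp)+
  then have \<delta>: "lcong (of_int d + s * of_int c) 1" and \<beta>: "lcong (of_int b + s * of_int a) 0" by simp_all
  have "of_int d + s * of_int c \<noteq> 0" using det N_pos by (auto simp: s_def)
  then have u: "of_int d + s * of_int c \<in> units"
    using loc_lcong_unit[OF units_1(1) lcong_sym[OF \<delta>] dl] by blast
  define \<delta> where "\<delta> = of_int d + s * of_int c"
  have D: "\<delta> \<in> units" and D1: "lcong \<delta> 1" using u \<open>lcong (of_int d + s * of_int c) 1\<close> by (simp_all add: \<delta>_def)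
  have div0: "lcong (q / \<delta>) 0" if "lcong q 0" for q
    using lcong_scale[OF unitsD(3)[OF D] that] by simp
  have E1: "E q = mat 1" if "q \<in> loc" "lcong q 0" for q
    using E_cong[OF that(1) _ that(2)] by simp
  have "E ((of_int b + s * of_int a) / \<delta>) = mat 1"
    by (rule E1[OF unitsD(4)[OF D bl] div0[OF \<beta>]])
  moreover have "E (- of_int c / \<delta>) = mat 1"
    using lcong_minus[OF c] by (intro E1 unitsD(4)[OF D] div0 loc_minus) simp_all
  moreover have "E (- s) = mat 1"
    using lcong_minus[OF s(2)] s(1) by (intro E1 loc_minus) simp_all
  moreover have "Gm (1 / \<delta>) = mat 1"
  proof -
    have "lcong (1 / \<delta> * \<delta>) (1 / \<delta> * 1)" using D1 unitsD(3)[OF D] by (rule lcong_scale[rotated])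
    then have "lcong 1 (1 / \<delta>)" using unitsD(1)[OF D] by simp
    then show ?thesis using Gm_cong[OF units_1(1) units_inverse[OF D]] by simp
  qed
  ultimately have "bruhat (of_int a) (of_int b) (of_int c) (of_int d) s = mat 1"
    unfolding bruhat_def \<delta>_def[symmetric] by (simp add: S_Si)
  then show ?thesis
    unfolding A2 using representation_bruhat[OF \<rho> det s(1) u] by simp
qed

end

theorem theorem4:
  fixes z :: "'a::finite"
    and S T :: "complex^'a^'a"
    and \<rho> :: "int^2^2 \<Rightarrow> complex^'a^'a"
    and N :: nat
  assumes "rcft_modular_data z S T"
    and "modular_representation S T \<rho>"
    and "N = matrix_order T"
    and "odd N"
  shows "congruence_property \<rho> N"
proof -
  interpret rcft_modular_data z S T by fact
  have "matrix_pow T N = mat 1"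
    using LeastI_ex[OF T_finite_order] assms(3) unfolding matrix_order_def by blast
  then interpret odd_level_data z S T N
    using assms(4) by unfold_locales
  show ?thesis
    unfolding congruence_property_def using representation_trivial[OF assms(2)] by blast
qed

end
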